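(* Let $\mathcal{G}$ and $\mathcal{H}$ be Hausdorff, ample groupoids. Then there is an isometric isomorphism of Banach algebras $L^I(\mathcal{G}) \cong L^I(\mathcal{H})$ if and only if there is an isomorphism of topological groupoids $\mathcal{G} \cong \mathcal{H}$.
   Context: Groupoids: for a groupoid $\mathcal{G}$ with unit space $\mathcal{G}^{(0)}$, the range and source maps are $\mathsf{r}(x)=xx^{-1}$, $\mathsf{s}(x)=x^{-1}x$, and $xy$ is defined if and only if $\mathsf{s}(x)=\mathsf{r}(y)$. Write $\mathcal{G}_u=\mathsf{s}^{-1}(u)$ and $\mathcal{G}^u=\mathsf{r}^{-1}(u)$ for $u\in\mathcal{G}^{(0)}$. An étale groupoid is a groupoid with a locally compact topology such that multiplication and inversion are continuous, $\mathcal{G}^{(0)}$ is Hausdorff in the relative topology, and $\mathsf{r}$ is a local homeomorphism. A bisection is a subset $U\subseteq\mathcal{G}$ on which $\mathsf{s}$ and $\mathsf{r}$ are injective. An ample groupoid is an étale groupoid whose topology has a basis of compact, open bisections. An isomorphism of étale (topological) groupoids is a groupoid homomorphism that is also a homeomorphism. Convolution algebra: for $\mathcal{G}$ Hausdorff étale, $C_c(\mathcal{G})$ is the space of continuous compactly supported functions $\mathcal{G}\to\mathbb{C}$ with product $(f\ast g)(x)=\sum_{y\in\mathcal{G}_{\mathsf{s}(x)}} f(xy^{-1})g(y)$. The $I$-norm is $$\|f\|_I=\max\Big\{\sup_{u\in\mathcal{G}^{(0)}}\sum_{x\in\mathcal{G}_u}|f(x)|,\ \sup_{u\in\mathcal{G}^{(0)}}\sum_{x\in\mathcal{G}^u}|f(x)|\Big\}.$$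 It is submultiplicative, and $L^I(\mathcal{G})$ denotes the Banach algebra obtained as the completion of $C_c(\mathcal{G})$ in $\|\cdot\|_I$. An isometric isomorphism of Banach algebras is a bijective, linear, multiplicative, isometric map; it is not required to preserve any involution. *)

theory Defs
  imports "HOL-Analysis.Analysis"
begin

text \<open>
  The set of arrows of a groupoid is the \<^const>\<open>topspace\<close> of its topology, so the empty
  groupoid is included. The product is a total function whose values matter only on the set
  \<open>gcomp\<close> of composable pairs.
\<close>

record 'a topgroupoid =
  gtop :: "'a topology"
  gcomp :: "('a \<times> 'a) set"
  gmult :: "'a \<Rightarrow> 'a \<Rightarrow> 'a"
  ginv :: "'a \<Rightarrow> 'a"

abbreviation arrows :: "('a, 'm) topgroupoid_scheme \<Rightarrow> 'a set" where
  "arrows G \<equiv> topspace (gtop G)"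

definition is_groupoid :: "('a, 'm) topgroupoid_scheme \<Rightarrow> bool" where
  "is_groupoid G \<longleftrightarrow>
     gcomp G \<subseteq> arrows G \<times> arrows G \<and>
     (\<forall>(x, y) \<in> gcomp G. gmult G x y \<in> arrows G) \<and>
     (\<forall>x \<in> arrows G. ginv G x \<in> arrows G \<and> ginv G (ginv G x) = x) \<and>
     (\<forall>x y z. (x, y) \<in> gcomp G \<longrightarrow> (y, z) \<in> gcomp G \<longrightarrow>
        (gmult G x y, z) \<in> gcomp G \<and> (x, gmult G y z) \<in> gcomp G \<and>
        gmult G (gmult G x y) z = gmult G x (gmult G y z)) \<and>
     (\<forall>x \<in> arrows G. (ginv G x, x) \<in> gcomp G \<and> (x, ginv G x) \<in> gcomp G) \<and>
     (\<forall>x y. (x, y) \<in> gcomp G \<longrightarrow>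
        gmult G (ginv G x) (gmult G x y) = y \<and> gmult G (gmult G x y) (ginv G y) = x)"

definition grange :: "('a, 'm) topgroupoid_scheme \<Rightarrow> 'a \<Rightarrow> 'a" where
  "grange G x = gmult G x (ginv G x)"

definition gsource :: "('a, 'm) topgroupoid_scheme \<Rightarrow> 'a \<Rightarrow> 'a" where
  "gsource G x = gmult G (ginv G x) x"

definition gunits :: "('a, 'm) topgroupoid_scheme \<Rightarrow> 'a set" where
  "gunits G = grange G ` arrows G"

definition source_fibre :: "('a, 'm) topgroupoid_scheme \<Rightarrow> 'a \<Rightarrow> 'a set" where
  "source_fibre G u = {x \<in> arrows G. gsource G x = u}"

definition range_fibre :: "('a, 'm) topgroupoid_scheme \<Rightarrow> 'a \<Rightarrow> 'a set" where
  "range_fibre G u = {x \<in> arrows G. grange G x = u}"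

lemma gcomp_iff:
  assumes "is_groupoid G"
  shows "(x, y) \<in> gcomp G \<longleftrightarrow> x \<in> arrows G \<and> y \<in> arrows G \<and> gsource G x = grange G y"
proof -
  have assoc: "(gmult G a b, c) \<in> gcomp G" "(a, gmult G b c) \<in> gcomp G"
      "gmult G (gmult G a b) c = gmult G a (gmult G b c)"
    if "(a, b) \<in> gcomp G" "(b, c) \<in> gcomp G" for a b c
    using assms that unfolding is_groupoid_def by blast+
  have inv: "(ginv G a, a) \<in> gcomp G" "(a, ginv G a) \<in> gcomp G" "ginv G (ginv G a) = a"
    if "a \<in> arrows G" for a
    using assms that unfolding is_groupoid_def by blast+
  have cancel: "gmult G (ginv G a) (gmult G a b) = b" "gmult G (gmult G a b) (ginv G b) = a"
    if "(a, b) \<in> gcomp G" for a b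
    using assms that unfolding is_groupoid_def by blast+
  have arr: "a \<in> arrows G" "b \<in> arrows G" if "(a, b) \<in> gcomp G" for a b
    using assms that unfolding is_groupoid_def by blast+
  show ?thesis
  proof (intro iffI conjI)
    assume xy: "(x, y) \<in> gcomp G"
    show x: "x \<in> arrows G" and y: "y \<in> arrows G" using arr[OF xy] by auto
    have "gmult G (ginv G x) (gmult G (gmult G x y) (ginv G y)) =
          gmult G (gmult G (ginv G x) (gmult G x y)) (ginv G y)"
      using assoc[OF inv(1)[OF x] xy] assoc[OF xy inv(2)[OF y]]
        assoc[of "ginv G x" "gmult G x y" "ginv G y"] by simp
    then show "gsource G x = grange G y"
      unfolding gsource_def grange_def by (simp only: cancel[OF xy])
  next
    assume "x \<in> arrows G \<and> y \<in> arrows G \<and> gsource G x = grange G y"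
    then have x: "x \<in> arrows G" and y: "y \<in> arrows G" and eq: "gsource G x = grange G y"
      by auto
    have 1: "(x, gsource G x) \<in> gcomp G"
      unfolding gsource_def using assoc(2)[OF inv(2)[OF x] inv(1)[OF x]] .
    have 2: "(gsource G x, y) \<in> gcomp G"
      unfolding eq grange_def using assoc(1)[OF inv(2)[OF y] inv(1)[OF y]] .
    have "gmult G x (gsource G x) = x"
      unfolding gsource_def using cancel(1)[OF inv(1)[OF x]] inv(3)[OF x] by simp
    then show "(x, y) \<in> gcomp G" using assoc(1)[OF 1 2] by simp
  qed
qed

definition local_homeomorphism :: "'a topology \<Rightarrow> 'b topology \<Rightarrow> ('a \<Rightarrow> 'b) \<Rightarrow> bool" where
  "local_homeomorphism X Y f \<longleftrightarrow>
     f \<in> topspace X \<rightarrow> topspace Y \<and>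
     (\<forall>x \<in> topspace X. \<exists>U. openin X U \<and> x \<in> U \<and> openin Y (f ` U) \<and>
        homeomorphic_map (subtopology X U) (subtopology Y (f ` U)) f)"

definition etale_groupoid :: "('a, 'm) topgroupoid_scheme \<Rightarrow> bool" where
  "etale_groupoid G \<longleftrightarrow>
     is_groupoid G \<and>
     locally_compact_space (gtop G) \<and>
     continuous_map (subtopology (prod_topology (gtop G) (gtop G)) (gcomp G)) (gtop G)
       (\<lambda>(x, y). gmult G x y) \<and>
     continuous_map (gtop G) (gtop G) (ginv G) \<and>
     Hausdorff_space (subtopology (gtop G) (gunits G)) \<and>
     local_homeomorphism (gtop G) (subtopology (gtop G) (gunits G)) (grange G)"

definition bisection :: "('a, 'm) topgroupoid_scheme \<Rightarrow> 'a set \<Rightarrow> bool" where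
  "bisection G U \<longleftrightarrow> U \<subseteq> arrows G \<and> inj_on (gsource G) U \<and> inj_on (grange G) U"

definition ample_groupoid :: "('a, 'm) topgroupoid_scheme \<Rightarrow> bool" where
  "ample_groupoid G \<longleftrightarrow>
     etale_groupoid G \<and>
     openin (gtop G) =
       arbitrary union_of (\<lambda>U. openin (gtop G) U \<and> compactin (gtop G) U \<and> bisection G U)"

definition groupoid_hom ::
  "('a, 'm) topgroupoid_scheme \<Rightarrow> ('b, 'n) topgroupoid_scheme \<Rightarrow> ('a \<Rightarrow> 'b) \<Rightarrow> bool" where
  "groupoid_hom G H \<phi> \<longleftrightarrow>
     \<phi> \<in> arrows G \<rightarrow> arrows H \<and>
     (\<forall>(x, y) \<in> gcomp G. (\<phi> x, \<phi> y) \<in> gcomp H \<and> \<phi> (gmult G x y) = gmult H (\<phi> x) (\<phi> y))"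

definition topgroupoid_iso ::
  "('a, 'm) topgroupoid_scheme \<Rightarrow> ('b, 'n) topgroupoid_scheme \<Rightarrow> ('a \<Rightarrow> 'b) \<Rightarrow> bool" where
  "topgroupoid_iso G H \<phi> \<longleftrightarrow> groupoid_hom G H \<phi> \<and> homeomorphic_map (gtop G) (gtop H) \<phi>"

record 'v normed_alg =
  acarrier :: "'v set"
  aadd :: "'v \<Rightarrow> 'v \<Rightarrow> 'v"
  ascale :: "complex \<Rightarrow> 'v \<Rightarrow> 'v"
  amult :: "'v \<Rightarrow> 'v \<Rightarrow> 'v"
  anorm :: "'v \<Rightarrow> real"

definition isometric_alg_iso :: "'v normed_alg \<Rightarrow> 'w normed_alg \<Rightarrow> ('v \<Rightarrow> 'w) \<Rightarrow> bool" where
  "isometric_alg_iso A B \<Phi> \<longleftrightarrow>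
     bij_betw \<Phi> (acarrier A) (acarrier B) \<and>
     (\<forall>a \<in> acarrier A. \<forall>b \<in> acarrier A. \<Phi> (aadd A a b) = aadd B (\<Phi> a) (\<Phi> b)) \<and>
     (\<forall>c. \<forall>a \<in> acarrier A. \<Phi> (ascale A c a) = ascale B c (\<Phi> a)) \<and>
     (\<forall>a \<in> acarrier A. \<forall>b \<in> acarrier A. \<Phi> (amult A a b) = amult B (\<Phi> a) (\<Phi> b)) \<and>
     (\<forall>a \<in> acarrier A. anorm B (\<Phi> a) = anorm A a)"

definition adist :: "'v normed_alg \<Rightarrow> 'v \<Rightarrow> 'v \<Rightarrow> real" where
  "adist A a b = anorm A (aadd A a (ascale A (-1) b))"

text \<open>
  The completion consists of the classes of Cauchy sequences modulo sequences whose distance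
  tends to zero, with operations induced termwise. The operations are stated through a chosen
  representative; for a normed algebra the result does not depend on the choice.
\<close>

definition cauchy_seqs :: "'v normed_alg \<Rightarrow> (nat \<Rightarrow> 'v) set" where
  "cauchy_seqs A = {s. (\<forall>n. s n \<in> acarrier A) \<and>
     (\<forall>e>0. \<exists>N. \<forall>m\<ge>N. \<forall>n\<ge>N. adist A (s m) (s n) < e)}"

definition cauchy_rel :: "'v normed_alg \<Rightarrow> ((nat \<Rightarrow> 'v) \<times> (nat \<Rightarrow> 'v)) set" where
  "cauchy_rel A = {(s, t). s \<in> cauchy_seqs A \<and> t \<in> cauchy_seqs A \<and>
     (\<lambda>n. adist A (s n) (t n)) \<longlonglongrightarrow> 0}"

definition class_rep :: "(nat \<Rightarrow> 'v) set \<Rightarrow> nat \<Rightarrow> 'v" where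
  "class_rep X = (SOME s. s \<in> X)"

definition alg_completion :: "'v normed_alg \<Rightarrow> (nat \<Rightarrow> 'v) set normed_alg" where
  "alg_completion A = \<lparr>
     acarrier = cauchy_seqs A // cauchy_rel A,
     aadd = (\<lambda>X Y. cauchy_rel A `` {\<lambda>n. aadd A (class_rep X n) (class_rep Y n)}),
     ascale = (\<lambda>c X. cauchy_rel A `` {\<lambda>n. ascale A c (class_rep X n)}),
     amult = (\<lambda>X Y. cauchy_rel A `` {\<lambda>n. amult A (class_rep X n) (class_rep Y n)}),
     anorm = (\<lambda>X. lim (\<lambda>n. anorm A (class_rep X n)))\<rparr>"

text \<open>Functions on a groupoid are extended by zero outside the set of arrows.\<close>

definition Cc_funs :: "('a, 'm) topgroupoid_scheme \<Rightarrow> ('a \<Rightarrow> complex) set" where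
  "Cc_funs G = {f. continuous_map (gtop G) euclidean f \<and>
     compactin (gtop G) (gtop G closure_of {x \<in> arrows G. f x \<noteq> 0}) \<and>
     (\<forall>x. x \<notin> arrows G \<longrightarrow> f x = 0)}"

definition gconvolution ::
  "('a, 'm) topgroupoid_scheme \<Rightarrow> ('a \<Rightarrow> complex) \<Rightarrow> ('a \<Rightarrow> complex) \<Rightarrow> 'a \<Rightarrow> complex" where
  "gconvolution G f g x =
     (if x \<in> arrows G
      then \<Sum>\<^sub>\<infinity>y \<in> source_fibre G (gsource G x). f (gmult G x (ginv G y)) * g y
      else 0)"

text \<open>
  The suprema are taken in \<^typ>\<open>ennreal\<close>, where the supremum over an empty unit space is 0.
  They are finite for functions in \<open>Cc_funs G\<close> when \<open>G\<close> is etale.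
\<close>

definition I_norm :: "('a, 'm) topgroupoid_scheme \<Rightarrow> ('a \<Rightarrow> complex) \<Rightarrow> real" where
  "I_norm G f = enn2real (max
     (SUP u \<in> gunits G. \<Sum>\<^sub>\<infinity>x \<in> source_fibre G u. ennreal (cmod (f x)))
     (SUP u \<in> gunits G. \<Sum>\<^sub>\<infinity>x \<in> range_fibre G u. ennreal (cmod (f x))))"

definition Cc :: "('a, 'm) topgroupoid_scheme \<Rightarrow> ('a \<Rightarrow> complex) normed_alg" where
  "Cc G = \<lparr>
     acarrier = Cc_funs G,
     aadd = (\<lambda>f g x. f x + g x),
     ascale = (\<lambda>c f x. c * f x),
     amult = gconvolution G,
     anorm = I_norm G\<rparr>"

definition LI :: "('a, 'm) topgroupoid_scheme \<Rightarrow> (nat \<Rightarrow> 'a \<Rightarrow> complex) set normed_alg" where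
  "LI G = alg_completion (Cc G)"

end

theory Submission
  imports Defs
begin

text \<open>
  The completion \<^term>\<open>LI G\<close> is realised by the functions on \<open>G\<close> that are limits of
  \<^term>\<open>Cc_funs G\<close> in the \<open>I\<close>-norm. Two families of elements are visible from the product and
  the norm alone. First, \<open>d\<close> satisfies \<open>\<parallel>a + i t d a\<parallel> \<le> (1 + C t\<^sup>2) \<parallel>a\<parallel>\<close> for all \<open>a\<close> and all real
  \<open>t\<close> exactly if it is a real function supported on the units. Second, if \<open>a\<close> and \<open>b\<close> are
  contractions, mutually inverse relative to the idempotents \<open>a b\<close> and \<open>b a\<close> of the first
  family, then the equality case of \<open>1 = \<Sum> a(z) b(z\<^sup>-\<^sup>1) \<le> \<Sum> \<bar>a(z)\<bar> \<le> 1\<close> shows that \<open>a\<close> is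
  unimodular on a compact open bisection and zero elsewhere.

  An isometric isomorphism \<open>\<Phi>\<close> preserves both families, so \<open>U \<mapsto> supp \<Phi>(1\<^sub>U)\<close> is a multiplicative
  order isomorphism between the compact open bisections of the two groupoids. By compactness,
  points correspond to the families of compact open bisections containing them, which turns this
  map into a homeomorphism of the arrow spaces. It is compatible with source, range and product
  because these can be read off from products of bisections.
\<close>

subsection \<open>Groupoid arithmetic\<close>

text \<open>What makes the units visible to the norm is orders of growth in t: if d is nonzero at an
  arrow outside the units, perturbing by i t d adds a term of first order to a source fibre sum, in
  a place where the test function vanishes, so no multiple of t^2 can absorb it. A real function h
  on the units only multiplies values by 1 + i t h, whose modulus exceeds 1 by a term of second
  order.

  The remaining obstacle is a phase: \<Phi> of an indicator is unimodular on its support but in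
  general not an indicator, so \<Phi> does not map indicators to indicators and neither does its
  inverse. Hence only supports are compared. They behave well for two reasons: a bisection in the
  left factor leaves at most one term in each convolution sum, so supports multiply without
  cancellation, and functions on the units act by pointwise multiplication, so they cannot enlarge a
  support.\<close>

locale groupoid =
  fixes G :: "('a, 'm) topgroupoid_scheme"
  assumes is_groupoid: "is_groupoid G"
begin

abbreviation A where "A \<equiv> arrows G"
abbreviation mult (infixl "\<cdot>" 70) where "x \<cdot> y \<equiv> gmult G x y"
abbreviation inv where "inv \<equiv> ginv G"
abbreviation r where "r \<equiv> grange G"
abbreviation s where "s \<equiv> gsource G"
abbreviation E where "E \<equiv> gunits G"

lemma comp_iff: "(x, y) \<in> gcomp G \<longleftrightarrow> x \<in> A \<and> y \<in> A \<and> s x = r y"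
  by (rule gcomp_iff[OF is_groupoid])

lemma mult_closed: "x \<in> A \<Longrightarrow> y \<in> A \<Longrightarrow> s x = r y \<Longrightarrow> x \<cdot> y \<in> A"
  using is_groupoid comp_iff unfolding is_groupoid_def by blast

lemma inv_closed [simp]: "x \<in> A \<Longrightarrow> inv x \<in> A"
  and inv_inv [simp]: "x \<in> A \<Longrightarrow> inv (inv x) = x"
  using is_groupoid unfolding is_groupoid_def by auto

lemma assoc:
  assumes "x \<in> A" "y \<in> A" "z \<in> A" "s x = r y" "s y = r z"
  shows "(x \<cdot> y) \<cdot> z = x \<cdot> (y \<cdot> z)"
    and source_mult_aux: "s (x \<cdot> y) = r z" and range_mult_aux: "s x = r (y \<cdot> z)"
proof -
  have "(x, y) \<in> gcomp G" "(y, z) \<in> gcomp G" using assms comp_iff by auto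
  then have "(x \<cdot> y, z) \<in> gcomp G" "(x, y \<cdot> z) \<in> gcomp G" "(x \<cdot> y) \<cdot> z = x \<cdot> (y \<cdot> z)"
    using is_groupoid unfolding is_groupoid_def by blast+
  then show "(x \<cdot> y) \<cdot> z = x \<cdot> (y \<cdot> z)" "s (x \<cdot> y) = r z" "s x = r (y \<cdot> z)"
    using comp_iff by auto
qed

lemma source_inv [simp]: "x \<in> A \<Longrightarrow> s (inv x) = r x"
  and range_inv [simp]: "x \<in> A \<Longrightarrow> r (inv x) = s x"
  by (simp_all add: gsource_def grange_def)

text \<open>The associativity axiom also asserts that \<open>(x \<cdot> y, z)\<close> is composable;
  the choice \<open>z = inv y\<close> turns this into the source of the product.\<close>

lemma source_mult [simp]:
  assumes "x \<in> A" "y \<in> A" "s x = r y" shows "s (x \<cdot> y) = s y"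
  using source_mult_aux[of x y "inv y"] assms by simp

lemma range_mult [simp]:
  assumes "x \<in> A" "y \<in> A" "s x = r y" shows "r (x \<cdot> y) = r x"
  using range_mult_aux[of "inv x" x y] assms by simp

lemma cancel:
  assumes "x \<in> A" "y \<in> A" "s x = r y"
  shows inv_mult_cancel [simp]: "inv x \<cdot> (x \<cdot> y) = y"
    and mult_inv_cancel [simp]: "(x \<cdot> y) \<cdot> inv y = x"
  using is_groupoid assms comp_iff unfolding is_groupoid_def by blast+

lemma mult_inv_mult_cancel [simp]:
  assumes "x \<in> A" "y \<in> A" "r x = r y" shows "x \<cdot> (inv x \<cdot> y) = y"
  using inv_mult_cancel[of "inv x" y] assms by simp

lemma range_closed [simp]: "x \<in> A \<Longrightarrow> r x \<in> A"
  and source_closed [simp]: "x \<in> A \<Longrightarrow> s x \<in> A"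
  by (simp_all add: grange_def gsource_def mult_closed)

lemma mult_range [simp]: "x \<in> A \<Longrightarrow> r x \<cdot> x = x"
  unfolding grange_def using mult_inv_cancel[of x "inv x"] by simp

lemma mult_source [simp]: "x \<in> A \<Longrightarrow> x \<cdot> s x = x"
  unfolding gsource_def using inv_mult_cancel[of "inv x" x] by simp

lemma range_range [simp]: "x \<in> A \<Longrightarrow> r (r x) = r x"
  and source_range [simp]: "x \<in> A \<Longrightarrow> s (r x) = r x"
proof -
  assume x: "x \<in> A"
  have "r (x \<cdot> inv x) = r x" "s (x \<cdot> inv x) = r x" using x by simp_all
  then show "r (r x) = r x" "s (r x) = r x" by (simp_all only: grange_def[of G x, symmetric])
qed

lemma range_source [simp]: "x \<in> A \<Longrightarrow> r (s x) = s x"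
  and source_source [simp]: "x \<in> A \<Longrightarrow> s (s x) = s x"
  using range_range[of "inv x"] source_range[of "inv x"] by simp_all

lemma range_unit: "x \<in> A \<Longrightarrow> r x \<in> E"
  by (simp add: gunits_def)

lemma source_unit: "x \<in> A \<Longrightarrow> s x \<in> E"
  using range_unit[of "inv x"] by simp

lemma units_subset: "E \<subseteq> A"
  by (auto simp: gunits_def)

lemma unit_arrow: "u \<in> E \<Longrightarrow> u \<in> A"
  using units_subset by blast

lemma unit_range [simp]: "u \<in> E \<Longrightarrow> r u = u"
  and unit_source [simp]: "u \<in> E \<Longrightarrow> s u = u"
  by (auto simp: gunits_def)

lemma unit_iff: "u \<in> E \<longleftrightarrow> u \<in> A \<and> r u = u"
  using range_unit unit_arrow by force

lemma mult_inv_unit [simp]: "x \<in> A \<Longrightarrow> x \<cdot> inv x = r x"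
  and inv_mult_unit [simp]: "x \<in> A \<Longrightarrow> inv x \<cdot> x = s x"
  by (simp_all add: grange_def gsource_def)

lemma inv_unit [simp]: "u \<in> E \<Longrightarrow> inv u = u"
proof -
  assume u: "u \<in> E"
  then have "r (inv u) \<cdot> inv u = inv u" "u \<cdot> inv u = u"
    using mult_range[of "inv u"] mult_inv_unit[of u] unit_arrow by auto
  then show ?thesis using u unit_arrow by auto
qed

lemma inv_mult:
  assumes "x \<in> A" "y \<in> A" "s x = r y"
  shows "inv (x \<cdot> y) = inv y \<cdot> inv x"
proof -
  let ?z = "x \<cdot> y"
  have z: "?z \<in> A" using assms mult_closed by blast
  have "inv y \<cdot> inv x = inv y \<cdot> (y \<cdot> inv ?z)"
  proof -
    have "inv x = inv x \<cdot> r x" using assms mult_source[of "inv x"] by simp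
    also have "\<dots> = inv x \<cdot> (?z \<cdot> inv ?z)" using assms z by simp
    also have "\<dots> = (inv x \<cdot> ?z) \<cdot> inv ?z" using assms z by (intro assoc(1)[symmetric]) auto
    also have "\<dots> = y \<cdot> inv ?z" using assms by simp
    finally show ?thesis by simp
  qed
  also have "\<dots> = inv ?z" using assms z by (intro inv_mult_cancel) auto
  finally show ?thesis by simp
qed

lemma mult_left_cancel:
  assumes "x \<in> A" "y \<in> A" "z \<in> A" "s x = r y" "s x = r z" "x \<cdot> y = x \<cdot> z"
  shows "y = z"
  using assms inv_mult_cancel by metis

lemma source_fibre_iff: "x \<in> source_fibre G u \<longleftrightarrow> x \<in> A \<and> s x = u"
  and range_fibre_iff: "x \<in> range_fibre G u \<longleftrightarrow> x \<in> A \<and> r x = u"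
  by (auto simp: source_fibre_def range_fibre_def)

lemma bij_betw_inv_fibre: "bij_betw inv (range_fibre G u) (source_fibre G u)"
  by (rule bij_betw_byWitness[of _ inv]) (auto simp: source_fibre_iff range_fibre_iff)

text \<open>The substitution z = x y^{-1} between the two ways of indexing the factorizations of
  \<open>x\<close>, by the left or by the right factor.\<close>

lemma bij_betw_left_translation:
  assumes "x \<in> A"
  shows "bij_betw (\<lambda>z. inv z \<cdot> x) (range_fibre G (r x)) (source_fibre G (s x))"
proof (rule bij_betw_byWitness[of _ "\<lambda>y. x \<cdot> inv y"])
  show "\<forall>z\<in>range_fibre G (r x). x \<cdot> inv (inv z \<cdot> x) = z"
    using assms by (auto simp: range_fibre_iff inv_mult)
  show "\<forall>y\<in>source_fibre G (s x). inv (x \<cdot> inv y) \<cdot> x = y"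
  proof
    fix y assume y: "y \<in> source_fibre G (s x)"
    then have "inv (x \<cdot> inv y) = y \<cdot> inv x" using assms by (auto simp: source_fibre_iff inv_mult)
    then show "inv (x \<cdot> inv y) \<cdot> x = y"
      using mult_inv_cancel[of y "inv x"] assms y by (auto simp: source_fibre_iff)
  qed
qed (use assms in \<open>auto simp: source_fibre_iff range_fibre_iff mult_closed\<close>)

text \<open>Indexing by the left factor suits a left argument supported on a bisection or on the
  units, which has at most one relevant point over \<open>r x\<close>. In estimates on range fibres
  it is also the form in which the right argument can be summed first.\<close>

lemma conv_eq:
  assumes "x \<in> A"
  shows "gconvolution G f g x = (\<Sum>\<^sub>\<infinity>z\<in>range_fibre G (r x). f z * g (inv z \<cdot> x))"
proof -
  have "gconvolution G f g x = (\<Sum>\<^sub>\<infinity>y\<in>source_fibre G (s x). f (x \<cdot> inv y) * g y)"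
    using assms by (simp add: gconvolution_def)
  also have "\<dots> = (\<Sum>\<^sub>\<infinity>z\<in>range_fibre G (r x). f (x \<cdot> inv (inv z \<cdot> x)) * g (inv z \<cdot> x))"
    using infsum_reindex_bij_betw[OF bij_betw_left_translation[OF assms],
        of "\<lambda>y. f (x \<cdot> inv y) * g y"] by presburger
  also have "\<dots> = (\<Sum>\<^sub>\<infinity>z\<in>range_fibre G (r x). f z * g (inv z \<cdot> x))"
    using assms by (intro infsum_cong) (auto simp: range_fibre_iff inv_mult)
  finally show ?thesis .
qed

end

subsection \<open>Compact open bisections\<close>

text \<open>Under setwise product and inverse this is the inverse semigroup of compact open
  bisections, ordered by inclusion. It is the invariant that the algebra determines.\<close>

definition cobs :: "('a, 'm) topgroupoid_scheme \<Rightarrow> 'a set set" where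
  "cobs G = {U. openin (gtop G) U \<and> compactin (gtop G) U \<and> bisection G U}"

locale hausdorff_ample_groupoid =
  fixes G :: "('a, 'm) topgroupoid_scheme"
  assumes ample: "ample_groupoid G"
    and hausdorff: "Hausdorff_space (gtop G)"

sublocale hausdorff_ample_groupoid \<subseteq> groupoid
  using ample by unfold_locales (auto simp: ample_groupoid_def etale_groupoid_def)

context hausdorff_ample_groupoid
begin

abbreviation X where "X \<equiv> gtop G"

lemma etale: "etale_groupoid G"
  using ample by (simp add: ample_groupoid_def)

lemma cob_open: "U \<in> cobs G \<Longrightarrow> openin X U"
  and cob_compact: "U \<in> cobs G \<Longrightarrow> compactin X U"
  and cob_inj_range: "U \<in> cobs G \<Longrightarrow> inj_on r U"
  and cob_inj_source: "U \<in> cobs G \<Longrightarrow> inj_on s U"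
  by (auto simp: cobs_def bisection_def)

lemma compact_closed: "compactin X K \<Longrightarrow> closedin X K"
  using hausdorff compactin_imp_closedin by blast

lemma cob_closed: "U \<in> cobs G \<Longrightarrow> closedin X U"
  using cob_compact compact_closed by blast

lemma cob_subset: "U \<in> cobs G \<Longrightarrow> U \<subseteq> A"
  using cob_open openin_subset by blast

lemma cob_arrow: "U \<in> cobs G \<Longrightarrow> x \<in> U \<Longrightarrow> x \<in> A"
  using cob_subset by blast

lemma cob_basis:
  assumes "openin X W" "x \<in> W"
  obtains U where "U \<in> cobs G" "x \<in> U" "U \<subseteq> W"
  using assms ample unfolding ample_groupoid_def openin_topology_base_unique cobs_def
  by (smt (verit, best) mem_Collect_eq)

text \<open>In a Hausdorff space compact open sets are clopen, so this applies to intersections and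
  differences of compact open bisections.\<close>

lemma cob_subset_clopen:
  assumes "U \<in> cobs G" "V \<subseteq> U" "openin X V" "closedin X V"
  shows "V \<in> cobs G"
  using assms closed_compactin[of X U V] unfolding cobs_def bisection_def
  by (auto intro: inj_on_subset)

lemma cob_Int: "U \<in> cobs G \<Longrightarrow> V \<in> cobs G \<Longrightarrow> U \<inter> V \<in> cobs G"
  by (meson cob_subset_clopen Int_lower1 openin_Int closedin_Int cob_open cob_closed)

lemma cob_Diff: "U \<in> cobs G \<Longrightarrow> V \<in> cobs G \<Longrightarrow> U - V \<in> cobs G"
  by (meson cob_subset_clopen Diff_subset openin_diff closedin_diff cob_open cob_closed)

lemma continuous_inv: "continuous_map X X inv"
  using etale by (simp add: etale_groupoid_def)

lemma continuous_mult:
  "continuous_map (subtopology (prod_topology X X) (gcomp G)) X (\<lambda>(x, y). x \<cdot> y)"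
  using etale by (simp add: etale_groupoid_def)

lemma continuous_range: "continuous_map X X r"
proof -
  have "continuous_map X (subtopology (prod_topology X X) (gcomp G)) (\<lambda>x. (x, inv x))"
    using continuous_inv
    by (intro continuous_map_into_subtopology continuous_map_pairedI) (auto simp: comp_iff)
  from continuous_map_compose[OF this continuous_mult] show ?thesis
    by (rule continuous_map_eq) simp
qed

lemma continuous_source: "continuous_map X X s"
proof -
  have "continuous_map X X (r \<circ> inv)"
    using continuous_inv continuous_range continuous_map_compose by blast
  then show ?thesis by (rule continuous_map_eq) auto
qed

lemma range_local_homeomorphism:
  assumes "x \<in> A"
  obtains U where "openin X U" "x \<in> U" "openin (subtopology X E) (r ` U)"
    "homeomorphic_map (subtopology X U) (subtopology (subtopology X E) (r ` U)) r"
  using etale assms unfolding etale_groupoid_def local_homeomorphism_def by blast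

text \<open>Near a unit \<open>u\<close> the map \<open>r\<close> is injective on an open
  \<open>U\<close>. If \<open>x\<close> and \<open>r x\<close> both lie in \<open>U\<close>, then
  \<open>r (r x) = r x\<close> forces \<open>x = r x\<close>, so a whole neighbourhood of
  \<open>u\<close> consists of units.\<close>

lemma open_units: "openin X E"
proof (subst openin_subopen, intro ballI)
  fix u assume u: "u \<in> E"
  obtain U where U: "openin X U" "u \<in> U"
    "homeomorphic_map (subtopology X U) (subtopology (subtopology X E) (r ` U)) r"
    using range_local_homeomorphism[of u] u unit_arrow by blast
  have inj: "inj_on r U"
    using homeomorphic_imp_injective_map[OF U(3)] U(1) openin_subset
    by (metis topspace_subtopology_subset)
  let ?V = "U \<inter> {x \<in> A. r x \<in> U}"
  have "openin X ?V"
    using U(1) continuous_range by (intro openin_Int openin_continuous_map_preimage)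
  moreover have "u \<in> ?V" using U u unit_arrow by simp
  moreover have "?V \<subseteq> E"
  proof
    fix x assume "x \<in> ?V"
    then have "r x = x" "x \<in> A" using inj_onD[OF inj, of "r x" x] by simp_all
    then show "x \<in> E" unfolding unit_iff by blast
  qed
  ultimately show "\<exists>T. openin X T \<and> u \<in> T \<and> T \<subseteq> E" by blast
qed

text \<open>The local homeomorphism yields images that are open relative to the units;
  \<open>open_units\<close> makes them open among all arrows.\<close>

lemma open_range_image:
  assumes "openin X W" shows "openin X (r ` W)"
proof (subst openin_subopen, intro ballI)
  fix u assume "u \<in> r ` W"
  then obtain x where x: "x \<in> W" "u = r x" by blast
  then have "x \<in> A" using assms openin_subset by blast
  then obtain U where U: "openin X U" "x \<in> U" "openin (subtopology X E) (r ` U)"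
    "homeomorphic_map (subtopology X U) (subtopology (subtopology X E) (r ` U)) r"
    using range_local_homeomorphism by blast
  have "openin (subtopology X U) (W \<inter> U)"
    using assms openin_subtopology by blast
  then have "openin (subtopology (subtopology X E) (r ` U)) (r ` (W \<inter> U))"
    using homeomorphic_imp_open_map[OF U(4)] by (simp add: open_map_def)
  then have "openin (subtopology X E) (r ` (W \<inter> U))"
    using U(3) openin_open_subtopology by blast
  then have "openin X (r ` (W \<inter> U))"
    using open_units openin_open_subtopology by blast
  then show "\<exists>T. openin X T \<and> u \<in> T \<and> T \<subseteq> r ` W"
    using x U by blast
qed

lemma cob_range_image:
  assumes "U \<in> cobs G" shows "r ` U \<in> cobs G"
proof -
  have "bisection G (r ` U)"
    unfolding bisection_def
  proof (intro conjI inj_onI)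
    have U: "U \<subseteq> A" using assms by (rule cob_subset)
    then show "r ` U \<subseteq> A" by (auto intro: range_closed)
    fix u v assume "u \<in> r ` U" "v \<in> r ` U"
    then have "u \<in> E" "v \<in> E" using U range_unit by fast+
    then show "s u = s v \<Longrightarrow> u = v" "r u = r v \<Longrightarrow> u = v" by simp_all
  qed
  then show ?thesis
    using open_range_image[OF cob_open[OF assms]]
      image_compactin[OF cob_compact[OF assms] continuous_range]
    unfolding cobs_def by blast
qed

lemma cob_range_image_units: "U \<in> cobs G \<Longrightarrow> r ` U \<subseteq> E"
  using cob_subset range_unit by fast

lemma cob_inv_image:
  assumes "U \<in> cobs G" shows "inv ` U \<in> cobs G"
proof -
  have "inv ` U = {x \<in> A. inv x \<in> U}"
    using cob_subset[OF assms] by force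
  then have "openin X (inv ` U)"
    using openin_continuous_map_preimage[OF continuous_inv cob_open[OF assms]] by simp
  moreover have "compactin X (inv ` U)"
    using image_compactin[OF cob_compact continuous_inv] assms by blast
  moreover have "bisection G (inv ` U)"
    unfolding bisection_def
  proof (intro conjI inj_onI)
    have U: "U \<subseteq> A" using assms by (rule cob_subset)
    then show "inv ` U \<subseteq> A" by (auto intro: inv_closed)
    fix x y assume "x \<in> inv ` U" "y \<in> inv ` U"
    then obtain x' y' where *: "x' \<in> U" "x = inv x'" "y' \<in> U" "y = inv y'" by blast
    then have "x' \<in> A" "y' \<in> A" using U by blast+
    then show "x = y" if "s x = s y"
      using inj_onD[OF cob_inj_range[OF assms], of x' y'] * that by simp
    show "x = y" if "r x = r y"
      using \<open>x' \<in> A\<close> \<open>y' \<in> A\<close> inj_onD[OF cob_inj_source[OF assms], of x' y'] * that by simp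
  qed
  ultimately show ?thesis unfolding cobs_def by blast
qed

section \<open>Local sections of the range map and products of sets of arrows\<close>

definition sect :: "'a set \<Rightarrow> 'a \<Rightarrow> 'a" where
  "sect U = the_inv_into U r"

lemma sect_range: "U \<in> cobs G \<Longrightarrow> x \<in> U \<Longrightarrow> sect U (r x) = x"
  by (simp add: sect_def the_inv_into_f_f cob_inj_range)

lemma sect_in: "U \<in> cobs G \<Longrightarrow> u \<in> r ` U \<Longrightarrow> sect U u \<in> U"
  and range_sect: "U \<in> cobs G \<Longrightarrow> u \<in> r ` U \<Longrightarrow> r (sect U u) = u"
  using sect_range by auto

text \<open>A continuous bijection from a compact space to a Hausdorff space is closed, hence
  \<open>r\<close> restricted to \<open>U\<close> is a homeomorphism onto its image, with inverse
  \<open>sect U\<close>. Off that image the values of \<open>sect U\<close> are unspecified.\<close>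

lemma continuous_sect:
  assumes "U \<in> cobs G"
  shows "continuous_map (subtopology X (r ` U)) X (sect U)"
proof -
  let ?U = "subtopology X U" and ?R = "subtopology X (r ` U)"
  have tops: "topspace ?U = U" "topspace ?R = r ` U"
    using cob_subset[OF assms] cob_subset[OF cob_range_image[OF assms]] by auto
  have "continuous_map ?U ?R r"
    by (rule continuous_map_into_subtopology)
      (use continuous_map_from_subtopology[OF continuous_range] tops(1) in auto)
  moreover have "closed_map ?U ?R r"
    using calculation compact_space_subtopology[OF cob_compact[OF assms]]
      Hausdorff_imp_kc_space[OF Hausdorff_space_subtopology[OF hausdorff]]
      continuous_imp_closed_map_gen by blast
  ultimately have "homeomorphic_map ?U ?R r"
    using cob_inj_range[OF assms] tops by (intro bijective_closed_imp_homeomorphic_map) auto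
  then obtain g where g: "homeomorphic_maps ?U ?R r g"
    using homeomorphic_map_maps by blast
  then have "continuous_map ?R X g"
    using continuous_map_into_fulltopology unfolding homeomorphic_maps_def by blast
  moreover have "g u = sect U u" if "u \<in> r ` U" for u
  proof -
    have "g (r x) = x" if "x \<in> U" for x
      using g that tops(1) unfolding homeomorphic_maps_def by blast
    then show ?thesis using that sect_range[OF assms] by auto
  qed
  ultimately show ?thesis using tops(2) continuous_map_eq by metis
qed

text \<open>Composability is equality of two continuous maps into a Hausdorff space. Closedness is
  what keeps products of compact sets of arrows compact.\<close>

lemma closed_composable: "closedin (prod_topology X X) (gcomp G)"
proof -
  have "gcomp G = {p \<in> topspace (prod_topology X X). (s \<circ> fst) p = (r \<circ> snd) p}"
    unfolding set_eq_iff split_paired_all by (simp add: comp_iff)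
  moreover have "closedin (prod_topology X X) \<dots>"
    by (intro closedin_continuous_maps_eq[OF hausdorff]
        continuous_map_compose[OF continuous_map_fst continuous_source]
        continuous_map_compose[OF continuous_map_snd continuous_range])
  ultimately show ?thesis by simp
qed

definition set_mult :: "'a set \<Rightarrow> 'a set \<Rightarrow> 'a set" where
  "set_mult U V = (\<lambda>(x, y). x \<cdot> y) ` ((U \<times> V) \<inter> gcomp G)"

lemma set_mult_iff:
  assumes "U \<subseteq> A" "V \<subseteq> A"
  shows "z \<in> set_mult U V \<longleftrightarrow> (\<exists>x\<in>U. \<exists>y\<in>V. s x = r y \<and> z = x \<cdot> y)"
proof -
  have *: "(x, y) \<in> (U \<times> V) \<inter> gcomp G \<longleftrightarrow> x \<in> U \<and> y \<in> V \<and> s x = r y" for x y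
    using assms by (auto simp only: comp_iff Int_iff mem_Sigma_iff)
  show ?thesis
    by (simp only: set_mult_def image_iff Bex_def split_paired_Ex case_prod_conv *) blast
qed

lemma compact_set_mult:
  assumes "compactin X K" "compactin X L"
  shows "compactin X (set_mult K L)"
proof -
  have "compactin (prod_topology X X) ((K \<times> L) \<inter> gcomp G)"
    using assms closed_composable by (intro compact_Int_closedin) (auto simp: compactin_Times)
  then have "compactin (subtopology (prod_topology X X) (gcomp G)) ((K \<times> L) \<inter> gcomp G)"
    by (simp add: compactin_subtopology)
  then show ?thesis
    unfolding set_mult_def using image_compactin continuous_mult by blast
qed

end

subsection \<open>Fibrewise summability and convolution\<close>

lemma has_sum_sum:
  fixes f :: "'i \<Rightarrow> 'j \<Rightarrow> 'c :: topological_comm_monoid_add"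
  assumes "finite F" "\<And>x. x \<in> F \<Longrightarrow> (f x has_sum S x) Y"
  shows "((\<lambda>y. \<Sum>x\<in>F. f x y) has_sum (\<Sum>x\<in>F. S x)) Y"
  using assms by (induction F rule: finite_induct) (auto intro!: has_sum_add)

lemma abs_summable_if_sums_bounded:
  fixes f :: "'i \<Rightarrow> 'b::real_normed_vector"
  assumes "\<And>T. finite T \<Longrightarrow> T \<subseteq> Y \<Longrightarrow> (\<Sum>y\<in>T. norm (f y)) \<le> C"
  shows "(\<lambda>y. norm (f y)) summable_on Y"
  using assms by (intro nonneg_bdd_above_summable_on bdd_aboveI2[where M = C]) auto

text \<open>A Schur test: column sums of the kernel are controlled by a weight of bounded total
  mass. The kernel is abstract so that the source half and the range half of the norm estimate for
  convolution are both instances.\<close>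

lemma sum_norm_infsum_le:
  fixes K :: "'i \<Rightarrow> 'j \<Rightarrow> 'b::banach" and w :: "'j \<Rightarrow> real"
  assumes F: "finite F" and C: "0 \<le> C"
    and K: "\<And>y. y \<in> Y \<Longrightarrow> (\<Sum>x\<in>F. norm (K x y)) \<le> C * w y"
    and w: "\<And>T. finite T \<Longrightarrow> T \<subseteq> Y \<Longrightarrow> sum w T \<le> D"
  shows "(\<Sum>x\<in>F. norm (infsum (K x) Y)) \<le> C * D"
proof -
  have *: "(\<Sum>y\<in>T. \<Sum>x\<in>F. norm (K x y)) \<le> C * D" if "finite T" "T \<subseteq> Y" for T
  proof -
    have "(\<Sum>y\<in>T. \<Sum>x\<in>F. norm (K x y)) \<le> (\<Sum>y\<in>T. C * w y)"
      using K that by (intro sum_mono) auto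
    also have "\<dots> \<le> C * D"
      using w[OF that] C by (simp add: mult_left_mono flip: sum_distrib_left)
    finally show ?thesis .
  qed
  have summable: "(\<lambda>y. norm (K x y)) summable_on Y" if "x \<in> F" for x
  proof (rule abs_summable_if_sums_bounded[where C = "C * D"])
    fix T assume T: "finite T" "T \<subseteq> Y"
    have "(\<Sum>y\<in>T. norm (K x y)) \<le> (\<Sum>y\<in>T. \<Sum>x\<in>F. norm (K x y))"
      using F that by (intro sum_mono member_le_sum) auto
    then show "(\<Sum>y\<in>T. norm (K x y)) \<le> C * D" using *[OF T] by linarith
  qed
  have "(\<Sum>x\<in>F. norm (infsum (K x) Y)) \<le> (\<Sum>x\<in>F. infsum (\<lambda>y. norm (K x y)) Y)"
    using summable by (intro sum_mono norm_infsum_bound)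
  also have "\<dots> \<le> C * D"
    using has_sum_sum[OF F has_sum_infsum[OF summable]] *
    by (rule has_sum_le_finite_sums)
  finally show ?thesis .
qed

text \<open>
  The inequality \<open>I_norm G f \<le> C\<close>, but without the junk value of \<^const>\<open>I_norm\<close>, which is 0 when
  the suprema are infinite.
\<close>

definition fibre_bounded :: "('a, 'm) topgroupoid_scheme \<Rightarrow> ('a \<Rightarrow> complex) \<Rightarrow> real \<Rightarrow> bool" where
  "fibre_bounded G f C \<longleftrightarrow>
     (\<forall>F u. finite F \<longrightarrow> F \<subseteq> source_fibre G u \<or> F \<subseteq> range_fibre G u \<longrightarrow> (\<Sum>x\<in>F. cmod (f x)) \<le> C)"

lemma fibre_bounded_source:
  "fibre_bounded G f C \<Longrightarrow> finite F \<Longrightarrow> F \<subseteq> source_fibre G u \<Longrightarrow> (\<Sum>x\<in>F. cmod (f x)) \<le> C"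
  and fibre_bounded_range:
  "fibre_bounded G f C \<Longrightarrow> finite F \<Longrightarrow> F \<subseteq> range_fibre G u \<Longrightarrow> (\<Sum>x\<in>F. cmod (f x)) \<le> C"
  unfolding fibre_bounded_def by blast+

lemma fibre_bounded_nonneg: "fibre_bounded G f C \<Longrightarrow> 0 \<le> C"
  using fibre_bounded_source[of G f C "{}"] by simp

lemma fibre_bounded_mono: "fibre_bounded G f C \<Longrightarrow> C \<le> D \<Longrightarrow> fibre_bounded G f D"
  unfolding fibre_bounded_def by (meson order_trans)

lemma fibre_bounded_dominated:
  assumes "fibre_bounded G g C" "0 \<le> c" "\<And>x. x \<in> arrows G \<Longrightarrow> cmod (f x) \<le> c * cmod (g x)"
  shows "fibre_bounded G f (c * C)"
  unfolding fibre_bounded_def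
proof (intro allI impI)
  fix F u assume F: "finite F" "F \<subseteq> source_fibre G u \<or> F \<subseteq> range_fibre G u"
  then have "(\<Sum>x\<in>F. cmod (f x)) \<le> (\<Sum>x\<in>F. c * cmod (g x))"
    by (intro sum_mono assms(3)) (auto simp: source_fibre_def range_fibre_def)
  also have "\<dots> = c * (\<Sum>x\<in>F. cmod (g x))" by (simp add: sum_distrib_left)
  also have "\<dots> \<le> c * C"
    using assms(1,2) F unfolding fibre_bounded_def by (intro mult_left_mono) blast+
  finally show "(\<Sum>x\<in>F. cmod (f x)) \<le> c * C" .
qed

lemma fibre_bounded_add:
  assumes "fibre_bounded G f C" "fibre_bounded G g D"
  shows "fibre_bounded G (\<lambda>x. f x + g x) (C + D)"
  unfolding fibre_bounded_def
proof (intro allI impI)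
  fix F u assume F: "finite F" "F \<subseteq> source_fibre G u \<or> F \<subseteq> range_fibre G u"
  have "(\<Sum>x\<in>F. cmod (f x + g x)) \<le> (\<Sum>x\<in>F. cmod (f x)) + (\<Sum>x\<in>F. cmod (g x))"
    unfolding sum.distrib[symmetric] by (intro sum_mono norm_triangle_ineq)
  also have "\<dots> \<le> C + D"
    using assms F unfolding fibre_bounded_def by (intro add_mono) blast+
  finally show "(\<Sum>x\<in>F. cmod (f x + g x)) \<le> C + D" .
qed

lemma fibre_bounded_scale:
  "fibre_bounded G f C \<Longrightarrow> fibre_bounded G (\<lambda>x. c * f x) (cmod c * C)"
  by (rule fibre_bounded_dominated) (auto simp: norm_mult)

lemma fibre_bounded_diff:
  assumes "fibre_bounded G f C" "fibre_bounded G g D"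
  shows "fibre_bounded G (\<lambda>x. f x - g x) (C + D)"
  using fibre_bounded_add[OF assms(1) fibre_bounded_scale[OF assms(2), of "-1"]] by simp

lemma fibre_bounded_pointwise:
  assumes "fibre_bounded G f C" "x \<in> arrows G" shows "cmod (f x) \<le> C"
  using fibre_bounded_source[OF assms(1), of "{x}" "gsource G x"] assms(2)
  by (simp add: source_fibre_def)

lemma fibre_bounded_zero: "fibre_bounded G (\<lambda>x. 0) 0"
  by (simp add: fibre_bounded_def)

text \<open>The bound concerns finite sums only, so it passes to pointwise limits, as in Fatou's
  lemma.\<close>

lemma fibre_bounded_limit:
  assumes "\<And>n. N \<le> n \<Longrightarrow> fibre_bounded G (f n) C" "\<And>x. x \<in> arrows G \<Longrightarrow> (\<lambda>n. f n x) \<longlonglongrightarrow> g x"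
  shows "fibre_bounded G g C"
  unfolding fibre_bounded_def
proof (intro allI impI)
  fix F u assume F: "finite F" "F \<subseteq> source_fibre G u \<or> F \<subseteq> range_fibre G u"
  have lim: "(\<lambda>n. \<Sum>x\<in>F. cmod (f n x)) \<longlonglongrightarrow> (\<Sum>x\<in>F. cmod (g x))"
    using F by (intro tendsto_sum tendsto_norm assms(2)) (auto simp: source_fibre_def range_fibre_def)
  have "(\<Sum>x\<in>F. cmod (f n x)) \<le> C" if "N \<le> n" for n
    using assms(1)[OF that] F unfolding fibre_bounded_def by blast
  then show "(\<Sum>x\<in>F. cmod (g x)) \<le> C"
    by (intro LIMSEQ_le_const2[OF lim]) blast
qed

lemma infsum_ennreal_le_iff:
  assumes "0 \<le> C"
  shows "(\<Sum>\<^sub>\<infinity>x\<in>S. ennreal (cmod (f x))) \<le> ennreal C \<longleftrightarrow>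
    (\<forall>F. finite F \<longrightarrow> F \<subseteq> S \<longrightarrow> (\<Sum>x\<in>F. cmod (f x)) \<le> C)"
proof -
  have "(\<Sum>\<^sub>\<infinity>x\<in>S. ennreal (cmod (f x))) =
      (SUP F\<in>{F. finite F \<and> F \<subseteq> S}. \<Sum>x\<in>F. ennreal (cmod (f x)))"
    by (rule nonneg_infsum_complete) simp
  then show ?thesis using assms by (simp add: SUP_le_iff imp_conjL)
qed

section \<open>The I-norm in terms of finite fibre sums\<close>

context groupoid
begin

lemma fibre_bounded_iff_ennreal:
  assumes "0 \<le> C"
  shows "max (SUP u \<in> E. \<Sum>\<^sub>\<infinity>x \<in> source_fibre G u. ennreal (cmod (f x)))
    (SUP u \<in> E. \<Sum>\<^sub>\<infinity>x \<in> range_fibre G u. ennreal (cmod (f x))) \<le> ennreal C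
    \<longleftrightarrow> fibre_bounded G f C"
    (is "?N \<le> _ \<longleftrightarrow> _")
proof -
  have "?N \<le> ennreal C \<longleftrightarrow> (\<forall>u\<in>E. \<forall>F. finite F \<longrightarrow>
      F \<subseteq> source_fibre G u \<or> F \<subseteq> range_fibre G u \<longrightarrow> (\<Sum>x\<in>F. cmod (f x)) \<le> C)"
    unfolding max.bounded_iff SUP_le_iff infsum_ennreal_le_iff[OF assms] by blast
  also have "\<dots> \<longleftrightarrow> fibre_bounded G f C"
  proof
    assume *: "\<forall>u\<in>E. \<forall>F. finite F \<longrightarrow>
      F \<subseteq> source_fibre G u \<or> F \<subseteq> range_fibre G u \<longrightarrow> (\<Sum>x\<in>F. cmod (f x)) \<le> C"
    show "fibre_bounded G f C"
      unfolding fibre_bounded_def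
    proof (intro allI impI)
      fix F u assume F: "finite F" "F \<subseteq> source_fibre G u \<or> F \<subseteq> range_fibre G u"
      show "(\<Sum>x\<in>F. cmod (f x)) \<le> C"
      \<comment> \<open>The suprema run over units, while \<open>u\<close> is arbitrary here. A
        nonempty \<open>F\<close> forces \<open>u\<close> to be a unit; for empty \<open>F\<close>
        the bound is \<open>0 \<le> C\<close>.\<close>
      proof (cases "F = {}")
        case False
        then obtain x where "x \<in> F" by blast
        then have "x \<in> A" "s x = u \<or> r x = u"
          using F(2) unfolding source_fibre_def range_fibre_def by blast+
        then have "u \<in> E" using source_unit[of x] range_unit[of x] by metis
        then show ?thesis using * F by blast
      qed (use assms in simp)
    qed
  qed (simp add: fibre_bounded_def)
  finally show ?thesis .
qed

text \<open>Some finite bound \<open>D\<close> must be known beforehand: it excludes infinite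
  suprema, which \<open>enn2real\<close> would turn into 0.\<close>

lemma I_norm_le_iff:
  assumes "fibre_bounded G f D" "0 \<le> C"
  shows "I_norm G f \<le> C \<longleftrightarrow> fibre_bounded G f C"
proof -
  define N where "N = max (SUP u \<in> E. \<Sum>\<^sub>\<infinity>x \<in> source_fibre G u. ennreal (cmod (f x)))
    (SUP u \<in> E. \<Sum>\<^sub>\<infinity>x \<in> range_fibre G u. ennreal (cmod (f x)))"
  have N: "N \<le> ennreal B \<longleftrightarrow> fibre_bounded G f B" if "0 \<le> B" for B
    unfolding N_def by (rule fibre_bounded_iff_ennreal[OF that])
  have "N \<noteq> top"
    using N[of D] assms(1) fibre_bounded_nonneg[OF assms(1)] neq_top_trans ennreal_neq_top by blast
  then have "enn2real N \<le> C \<longleftrightarrow> N \<le> ennreal C"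
    using enn2real_le enn2real_leI assms(2) by blast
  then show ?thesis using N[OF assms(2)] by (simp add: I_norm_def N_def)
qed

lemma I_norm_nonneg: "0 \<le> I_norm G f"
  by (simp add: I_norm_def)

lemma fibre_bounded_I_norm: "fibre_bounded G f D \<Longrightarrow> fibre_bounded G f (I_norm G f)"
  using I_norm_le_iff[OF _ I_norm_nonneg] by blast

lemma I_norm_le: "fibre_bounded G f C \<Longrightarrow> I_norm G f \<le> C"
  using I_norm_le_iff fibre_bounded_nonneg by blast

section \<open>Convolution of fibrewise summable functions\<close>

lemma right_translation:
  assumes "y \<in> A"
  shows "inj_on (\<lambda>x. x \<cdot> inv y) (source_fibre G (s y))"
    and "(\<lambda>x. x \<cdot> inv y) ` source_fibre G (s y) \<subseteq> source_fibre G (r y)"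
proof (rule inj_onI)
  fix a b assume "a \<in> source_fibre G (s y)" "b \<in> source_fibre G (s y)" "a \<cdot> inv y = b \<cdot> inv y"
  then show "a = b"
    using mult_inv_cancel[of a "inv y"] mult_inv_cancel[of b "inv y"] assms
    by (simp add: source_fibre_iff)
next
  show "(\<lambda>x. x \<cdot> inv y) ` source_fibre G (s y) \<subseteq> source_fibre G (r y)"
    using assms by (auto simp: source_fibre_iff mult_closed)
qed

lemma left_translation:
  assumes "z \<in> A"
  shows "inj_on (\<lambda>x. inv z \<cdot> x) (range_fibre G (r z))"
    and "(\<lambda>x. inv z \<cdot> x) ` range_fibre G (r z) \<subseteq> range_fibre G (s z)"
proof (rule inj_onI)
  fix a b assume ab: "a \<in> range_fibre G (r z)" "b \<in> range_fibre G (r z)" "inv z \<cdot> a = inv z \<cdot> b"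
  then have "z \<cdot> (inv z \<cdot> a) = a" "z \<cdot> (inv z \<cdot> b) = b"
    using assms unfolding range_fibre_iff by (metis mult_inv_mult_cancel)+
  then show "a = b" using ab(3) by metis
next
  show "(\<lambda>x. inv z \<cdot> x) ` range_fibre G (r z) \<subseteq> range_fibre G (s z)"
  proof
    fix y assume "y \<in> (\<lambda>x. inv z \<cdot> x) ` range_fibre G (r z)"
    then obtain x where x: "x \<in> A" "r x = r z" "y = inv z \<cdot> x"
      unfolding range_fibre_iff image_iff Bex_def by blast
    then have "y \<in> A" "r y = s z" using assms mult_closed[of "inv z" x] by simp_all
    then show "y \<in> range_fibre G (s z)" by (simp add: range_fibre_iff)
  qed
qed

text \<open>Submultiplicativity. On a source fibre, for fixed \<open>y\<close> the map taking x to x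
  y^{-1} injects into the source fibre over \<open>r y\<close>, so the sum over \<open>x\<close> is
  at most \<open>C\<close> times |g(y)|. On a range fibre the form \<open>conv_eq\<close> lets the
  values of \<open>g\<close> be summed first, with left translations in place of right ones.\<close>

lemma fibre_bounded_conv:
  assumes f: "fibre_bounded G f C" and g: "fibre_bounded G g D"
  shows "fibre_bounded G (gconvolution G f g) (C * D)"
proof -
  have C: "0 \<le> C" and D: "0 \<le> D" using f g fibre_bounded_nonneg by auto
  have source: "(\<Sum>x\<in>F. cmod (gconvolution G f g x)) \<le> C * D"
    if F: "finite F" "F \<subseteq> source_fibre G u" for F u
  proof -
    have "(\<Sum>x\<in>F. cmod (\<Sum>\<^sub>\<infinity>y\<in>source_fibre G u. f (x \<cdot> inv y) * g y)) \<le> C * D"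
    proof (rule sum_norm_infsum_le[where w = "\<lambda>y. cmod (g y)"])
      fix y assume "y \<in> source_fibre G u"
      then have y: "y \<in> A" "s y = u" by (auto simp: source_fibre_iff)
      have "(\<Sum>x\<in>F. cmod (f (x \<cdot> inv y))) = (\<Sum>z\<in>(\<lambda>x. x \<cdot> inv y) ` F. cmod (f z))"
        using right_translation(1)[OF y(1)] F(2) y(2)
        by (subst sum.reindex) (auto intro: inj_on_subset)
      also have "\<dots> \<le> C"
        using right_translation(2)[OF y(1)] F y(2)
        by (intro fibre_bounded_source[OF f, of _ "r y"]) blast+
      finally show "(\<Sum>x\<in>F. cmod (f (x \<cdot> inv y) * g y)) \<le> C * cmod (g y)"
        by (simp add: norm_mult mult_right_mono flip: sum_distrib_right)
    qed (use F C fibre_bounded_source[OF g] in auto)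
    moreover have "gconvolution G f g x = (\<Sum>\<^sub>\<infinity>y\<in>source_fibre G u. f (x \<cdot> inv y) * g y)"
      if "x \<in> F" for x
      using F(2) that by (auto simp: gconvolution_def source_fibre_iff)
    ultimately show ?thesis by simp
  qed
  have range: "(\<Sum>x\<in>F. cmod (gconvolution G f g x)) \<le> C * D"
    if F: "finite F" "F \<subseteq> range_fibre G u" for F u
  proof -
    have "(\<Sum>x\<in>F. cmod (\<Sum>\<^sub>\<infinity>z\<in>range_fibre G u. f z * g (inv z \<cdot> x))) \<le> D * C"
    proof (rule sum_norm_infsum_le[where w = "\<lambda>z. cmod (f z)"])
      fix z assume "z \<in> range_fibre G u"
      then have z: "z \<in> A" "r z = u" by (auto simp: range_fibre_iff)
      have "(\<Sum>x\<in>F. cmod (g (inv z \<cdot> x))) = (\<Sum>y\<in>(\<lambda>x. inv z \<cdot> x) ` F. cmod (g y))"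
        using left_translation(1)[OF z(1)] F(2) z(2)
        by (subst sum.reindex) (auto intro: inj_on_subset)
      also have "\<dots> \<le> D"
        using left_translation(2)[OF z(1)] F z(2)
        by (intro fibre_bounded_range[OF g, of _ "s z"]) blast+
      finally show "(\<Sum>x\<in>F. cmod (f z * g (inv z \<cdot> x))) \<le> D * cmod (f z)"
        by (simp add: norm_mult mult.commute[of D] mult_left_mono flip: sum_distrib_left)
    qed (use F D fibre_bounded_range[OF f] in auto)
    moreover have "gconvolution G f g x = (\<Sum>\<^sub>\<infinity>z\<in>range_fibre G u. f z * g (inv z \<cdot> x))"
      if "x \<in> F" for x
      using F(2) that conv_eq[of x f g] by (auto simp: range_fibre_iff)
    ultimately show ?thesis by (simp add: mult.commute)
  qed
  show ?thesis
    unfolding fibre_bounded_def using source range by blast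
qed

lemma conv_summable:
  assumes x: "x \<in> A" and f: "fibre_bounded G f C" and g: "fibre_bounded G g D"
  shows "(\<lambda>y. f (x \<cdot> inv y) * g y) summable_on source_fibre G (s x)"
proof -
  have C: "0 \<le> C" using f fibre_bounded_nonneg by auto
  show ?thesis
  proof (rule abs_summable_summable, rule abs_summable_if_sums_bounded)
    fix T assume T: "finite T" "T \<subseteq> source_fibre G (s x)"
    have "(\<Sum>y\<in>T. cmod (f (x \<cdot> inv y) * g y)) \<le> (\<Sum>y\<in>T. C * cmod (g y))"
    proof (rule sum_mono)
      fix y assume "y \<in> T"
      then have "x \<cdot> inv y \<in> A" using T x by (intro mult_closed) (auto simp: source_fibre_iff)
      then show "cmod (f (x \<cdot> inv y) * g y) \<le> C * cmod (g y)"
        using fibre_bounded_pointwise[OF f] by (simp add: norm_mult mult_right_mono)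
    qed
    also have "\<dots> \<le> C * D"
      using fibre_bounded_source[OF g T] C by (simp add: mult_left_mono flip: sum_distrib_left)
    finally show "(\<Sum>y\<in>T. cmod (f (x \<cdot> inv y) * g y)) \<le> C * D" .
  qed
qed

lemma conv_outside: "x \<notin> A \<Longrightarrow> gconvolution G f g x = 0"
  by (simp add: gconvolution_def)

lemma conv_add_left:
  assumes "fibre_bounded G f C" "fibre_bounded G g D" "fibre_bounded G h B"
  shows "gconvolution G (\<lambda>x. f x + g x) h = (\<lambda>x. gconvolution G f h x + gconvolution G g h x)"
proof
  fix x show "gconvolution G (\<lambda>x. f x + g x) h x = gconvolution G f h x + gconvolution G g h x"
    using infsum_add[OF conv_summable[OF _ assms(1,3), of x] conv_summable[OF _ assms(2,3), of x]]
    by (cases "x \<in> A") (simp_all add: gconvolution_def distrib_right)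
qed

lemma conv_add_right:
  assumes "fibre_bounded G f C" "fibre_bounded G g D" "fibre_bounded G h B"
  shows "gconvolution G h (\<lambda>x. f x + g x) = (\<lambda>x. gconvolution G h f x + gconvolution G h g x)"
proof
  fix x show "gconvolution G h (\<lambda>x. f x + g x) x = gconvolution G h f x + gconvolution G h g x"
    using infsum_add[OF conv_summable[OF _ assms(3,1), of x] conv_summable[OF _ assms(3,2), of x]]
    by (cases "x \<in> A") (simp_all add: gconvolution_def distrib_left)
qed

lemma conv_scale_left:
  "gconvolution G (\<lambda>x. c * f x) g = (\<lambda>x. c * gconvolution G f g x)"
proof
  fix x show "gconvolution G (\<lambda>x. c * f x) g x = c * gconvolution G f g x"
    by (simp add: gconvolution_def mult.assoc infsum_cmult_right')
qed

lemma conv_scale_right: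
  "gconvolution G f (\<lambda>x. c * g x) = (\<lambda>x. c * gconvolution G f g x)"
proof
  fix x show "gconvolution G f (\<lambda>x. c * g x) x = c * gconvolution G f g x"
    by (simp add: gconvolution_def mult.left_commute infsum_cmult_right')
qed

lemma conv_diff_left:
  assumes "fibre_bounded G f C" "fibre_bounded G g D" "fibre_bounded G h B"
  shows "gconvolution G (\<lambda>x. f x - g x) h = (\<lambda>x. gconvolution G f h x - gconvolution G g h x)"
  using conv_add_left[OF assms(1) fibre_bounded_scale[OF assms(2), of "-1"] assms(3)]
    conv_scale_left[of "-1" g h] by simp

lemma conv_diff_right:
  assumes "fibre_bounded G f C" "fibre_bounded G g D" "fibre_bounded G h B"
  shows "gconvolution G h (\<lambda>x. f x - g x) = (\<lambda>x. gconvolution G h f x - gconvolution G h g x)"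
  using conv_add_right[OF assms(1) fibre_bounded_scale[OF assms(2), of "-1"] assms(3)]
    conv_scale_right[of h "-1" g] by simp

text \<open>Infinite sums are evaluated only in this situation later on: one factor lives on a
  bisection or on the units.\<close>

lemma conv_single:
  assumes x: "x \<in> A" and z: "z \<in> A" "r z = r x"
    and zero: "\<And>z'. z' \<in> A \<Longrightarrow> r z' = r x \<Longrightarrow> z' \<noteq> z \<Longrightarrow> f z' * g (inv z' \<cdot> x) = 0"
  shows "gconvolution G f g x = f z * g (inv z \<cdot> x)"
proof -
  have "gconvolution G f g x = (\<Sum>\<^sub>\<infinity>z'\<in>{z}. f z' * g (inv z' \<cdot> x))"
    unfolding conv_eq[OF x] using z zero
    by (intro infsum_cong_neutral) (auto simp: range_fibre_iff)
  then show ?thesis by simp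
qed

lemma conv_zero:
  assumes "\<And>z. z \<in> A \<Longrightarrow> r z = r x \<Longrightarrow> f z * g (inv z \<cdot> x) = 0"
  shows "gconvolution G f g x = 0"
proof (cases "x \<in> A")
  case True
  then show ?thesis
    unfolding conv_eq[OF True] using assms by (intro infsum_0) (auto simp: range_fibre_iff)
qed (rule conv_outside)

text \<open>The only unit with range \<open>r x\<close> is \<open>r x\<close> itself. Functions on
  the units therefore act from the left as multipliers, which is the mechanism behind every later
  statement about hermitian elements.\<close>

lemma conv_unit_left:
  assumes "x \<in> A" "\<And>z. z \<notin> E \<Longrightarrow> f z = 0"
  shows "gconvolution G f g x = f (r x) * g x"
proof -
  have "gconvolution G f g x = f (r x) * g (inv (r x) \<cdot> x)"
  proof (rule conv_single)
    fix z assume "z \<in> A" "r z = r x" "z \<noteq> r x"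
    then have "z \<notin> E" using unit_range by metis
    then show "f z * g (inv z \<cdot> x) = 0" using assms(2) by simp
  qed (use assms(1) in auto)
  then show ?thesis using assms(1) range_unit by simp
qed

lemma conv_unit_right:
  assumes "x \<in> A" "\<And>z. z \<notin> E \<Longrightarrow> g z = 0"
  shows "gconvolution G f g x = f x * g (s x)"
proof -
  have "gconvolution G f g x = f x * g (inv x \<cdot> x)"
  proof (rule conv_single)
    fix z assume z: "z \<in> A" "r z = r x" "z \<noteq> x"
    \<comment> \<open>If z^{-1} x is a unit it equals its range, which is s(z) = z^{-1} z;
      cancelling z^{-1} gives x = z.\<close>
    have "inv z \<cdot> x \<notin> E"
    proof
      assume "inv z \<cdot> x \<in> E"
      then have "inv z \<cdot> x = r (inv z \<cdot> x)" using unit_range by metis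
      also have "\<dots> = s z" using z assms(1) by simp
      also have "\<dots> = inv z \<cdot> z" using z by simp
      finally show False using mult_left_cancel[of "inv z" x z] z assms(1) by simp
    qed
    then show "f z * g (inv z \<cdot> x) = 0" using assms(2) by simp
  qed (use assms(1) in auto)
  then show ?thesis using assms(1) by simp
qed

end

subsection \<open>Compactly supported functions\<close>

lemma continuous_map_mult_complex:
  fixes f g :: "'a \<Rightarrow> complex"
  assumes "continuous_map X euclidean f" "continuous_map X euclidean g"
  shows "continuous_map X euclidean (\<lambda>x. f x * g x)"
  using assms by (simp add: continuous_map_atin tendsto_mult)

lemma continuous_map_cases_clopen:
  assumes W: "openin X W" "closedin X W" and f: "continuous_map (subtopology X W) Y f"
    and c: "c \<in> topspace Y"
  shows "continuous_map X Y (\<lambda>x. if x \<in> W then f x else c)"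
  unfolding continuous_map_def
proof (intro conjI allI impI)
  have WX: "W \<subseteq> topspace X" using W(1) openin_subset by blast
  then have "f x \<in> topspace Y" if "x \<in> W" for x
    using f that unfolding continuous_map_def by auto
  then show "(\<lambda>x. if x \<in> W then f x else c) \<in> topspace X \<rightarrow> topspace Y"
    using c by auto
  fix V assume V: "openin Y V"
  have "openin (subtopology X W) {x \<in> topspace (subtopology X W). f x \<in> V}"
    using f V by (rule openin_continuous_map_preimage)
  then have "openin X {x \<in> W. f x \<in> V}"
    using WX openin_trans_full[OF _ W(1)] by (simp add: inf_absorb2)
  then have "openin X ({x \<in> W. f x \<in> V} \<union> (if c \<in> V then topspace X - W else {}))"
    using W(2) by (intro openin_Un) auto
  moreover have "{x \<in> topspace X. (if x \<in> W then f x else c) \<in> V} =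
      {x \<in> W. f x \<in> V} \<union> (if c \<in> V then topspace X - W else {})"
    using WX by auto
  ultimately show "openin X {x \<in> topspace X. (if x \<in> W then f x else c) \<in> V}" by simp
qed

context hausdorff_ample_groupoid
begin

text \<open>Compact sets are closed here, so the closure of the nonzero set is compact as soon as
  some compact set contains the nonzero set. This removes closures from all support
  computations.\<close>

lemma Cc_iff:
  "f \<in> Cc_funs G \<longleftrightarrow> continuous_map X euclidean f \<and>
    (\<exists>K. compactin X K \<and> {x \<in> A. f x \<noteq> 0} \<subseteq> K) \<and> (\<forall>x. x \<notin> A \<longrightarrow> f x = 0)"
proof -
  have "compactin X (X closure_of S) \<longleftrightarrow> (\<exists>K. compactin X K \<and> S \<subseteq> K)" if "S \<subseteq> A" for S
  proof
    assume "compactin X (X closure_of S)"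
    then show "\<exists>K. compactin X K \<and> S \<subseteq> K" using closure_of_subset[OF that] by blast
  next
    assume "\<exists>K. compactin X K \<and> S \<subseteq> K"
    then obtain K where "compactin X K" "S \<subseteq> K" by blast
    then show "compactin X (X closure_of S)"
      using closed_compactin closure_of_minimal compact_closed closedin_closure_of by metis
  qed
  from this[OF Collect_restrict] show ?thesis by (simp only: Cc_funs_def mem_Collect_eq)
qed

lemma CcI:
  assumes "continuous_map X euclidean f" "compactin X K" "\<And>x. f x \<noteq> 0 \<Longrightarrow> x \<in> K"
  shows "f \<in> Cc_funs G"
  unfolding Cc_iff using assms compactin_subset_topspace[OF assms(2)] by blast

lemma CcD:
  assumes "f \<in> Cc_funs G"
  obtains K where "continuous_map X euclidean f" "compactin X K" "\<And>x. f x \<noteq> 0 \<Longrightarrow> x \<in> K"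
  using assms unfolding Cc_iff by blast

lemma Cc_outside: "f \<in> Cc_funs G \<Longrightarrow> x \<notin> A \<Longrightarrow> f x = 0"
  unfolding Cc_iff by blast

lemma Cc_add:
  assumes "f \<in> Cc_funs G" "g \<in> Cc_funs G" shows "(\<lambda>x. f x + g x) \<in> Cc_funs G"
proof -
  obtain K where K: "continuous_map X euclidean f" "compactin X K" "\<And>x. f x \<noteq> 0 \<Longrightarrow> x \<in> K"
    using CcD[OF assms(1)] by blast
  obtain L where L: "continuous_map X euclidean g" "compactin X L" "\<And>x. g x \<noteq> 0 \<Longrightarrow> x \<in> L"
    using CcD[OF assms(2)] by blast
  show ?thesis
  proof (rule CcI)
    show "continuous_map X euclidean (\<lambda>x. f x + g x)" using K L by (intro continuous_map_add)
    show "compactin X (K \<union> L)" using K L by (intro compactin_Un)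
    fix x assume "f x + g x \<noteq> 0"
    then have "f x \<noteq> 0 \<or> g x \<noteq> 0" by auto
    then show "x \<in> K \<union> L" using K(3) L(3) by blast
  qed
qed

lemma Cc_scale:
  assumes "f \<in> Cc_funs G" shows "(\<lambda>x. c * f x) \<in> Cc_funs G"
proof -
  obtain K where K: "continuous_map X euclidean f" "compactin X K" "\<And>x. f x \<noteq> 0 \<Longrightarrow> x \<in> K"
    using CcD[OF assms(1)] by blast
  then show ?thesis
    by (intro CcI[OF continuous_map_mult_complex[OF _ K(1)] K(2)]) auto
qed

lemma Cc_zero: "(\<lambda>x. 0) \<in> Cc_funs G"
  by (rule CcI[of _ "{}"]) auto

lemma Cc_diff:
  assumes "f \<in> Cc_funs G" "g \<in> Cc_funs G" shows "(\<lambda>x. f x - g x) \<in> Cc_funs G"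
  using Cc_add[OF assms(1) Cc_scale[OF assms(2), of "-1"]] by simp

lemma Cc_restrict:
  assumes f: "f \<in> Cc_funs G" and U: "openin X U" "closedin X U"
  shows "(\<lambda>x. if x \<in> U then f x else 0) \<in> Cc_funs G"
proof -
  obtain K where K: "continuous_map X euclidean f" "compactin X K" "\<And>x. f x \<noteq> 0 \<Longrightarrow> x \<in> K"
    using CcD[OF assms(1)] by blast
  have "continuous_map X euclidean (\<lambda>x. if x \<in> U then f x else 0)"
    using U continuous_map_from_subtopology[OF K(1)] by (rule continuous_map_cases_clopen) simp
  then show ?thesis using K(2) by (rule CcI) (use K(3) in \<open>auto split: if_splits\<close>)
qed

lemma Cc_indicator:
  assumes "U \<in> cobs G" shows "indicator U \<in> Cc_funs G"
proof (rule CcI[OF _ cob_compact[OF assms]])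
  have "continuous_map X euclidean (\<lambda>x. if x \<in> U then 1 else 0 :: complex)"
    using cob_open[OF assms] cob_closed[OF assms] by (rule continuous_map_cases_clopen) auto
  then show "continuous_map X euclidean (indicator U :: 'a \<Rightarrow> complex)"
    by (rule continuous_map_eq) auto
qed (auto simp: indicator_def split: if_splits)

lemma Cc_bounded:
  assumes "f \<in> Cc_funs G" obtains M where "\<And>x. cmod (f x) \<le> M" "0 \<le> M"
proof -
  obtain K where K: "continuous_map X euclidean f" "compactin X K" "\<And>x. f x \<noteq> 0 \<Longrightarrow> x \<in> K"
    using CcD[OF assms(1)] by blast
  have "compact (f ` K)" using image_compactin[OF K(2,1)] by simp
  then obtain M where "\<And>z. z \<in> f ` K \<Longrightarrow> cmod z \<le> M"
    using compact_imp_bounded bounded_iff by metis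
  then have "cmod (f x) \<le> max M 0" for x using K(3)[of x] by fastforce
  then show thesis using that by force
qed

text \<open>A bisection meets every source fibre and every range fibre in at most one point, so each
  fibre sum has at most one nonzero term.\<close>

lemma fibre_bounded_bisection:
  assumes "bisection G U" "\<And>x. x \<notin> U \<Longrightarrow> f x = 0" "\<And>x. cmod (f x) \<le> M" "0 \<le> M"
  shows "fibre_bounded G f M"
  unfolding fibre_bounded_def
proof (intro allI impI)
  fix F u assume F: "finite F" "F \<subseteq> source_fibre G u \<or> F \<subseteq> range_fibre G u"
  have "x = y" if "x \<in> F \<inter> U" "y \<in> F \<inter> U" for x y
  proof -
    have "s x = s y \<or> r x = r y"
      using F(2) that unfolding source_fibre_def range_fibre_def by blast
    then show ?thesis using that assms(1) unfolding bisection_def inj_on_def by blast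
  qed
  then have "F \<inter> U = {} \<or> (\<exists>x. F \<inter> U = {x})" by blast
  moreover have "(\<Sum>x\<in>F. cmod (f x)) = (\<Sum>x\<in>F \<inter> U. cmod (f x))"
    using F(1) assms(2) by (intro sum.mono_neutral_right) auto
  ultimately show "(\<Sum>x\<in>F. cmod (f x)) \<le> M" using assms(3,4) by auto
qed

lemma cob_bisection: "U \<in> cobs G \<Longrightarrow> bisection G U"
  by (simp add: cobs_def)

text \<open>Finitely many compact open bisections cover the support. They are clopen, so cutting a
  function off along one of them keeps it continuous, and no partition of unity is involved.\<close>

lemma Cc_induct [consumes 1, case_names zero add bisection]:
  assumes f: "f \<in> Cc_funs G" and zero: "P (\<lambda>x. 0)"
    and add: "\<And>f g. f \<in> Cc_funs G \<Longrightarrow> g \<in> Cc_funs G \<Longrightarrow> P f \<Longrightarrow> P g \<Longrightarrow> P (\<lambda>x. f x + g x)"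
    and bis: "\<And>f U. f \<in> Cc_funs G \<Longrightarrow> U \<in> cobs G \<Longrightarrow> (\<And>x. x \<notin> U \<Longrightarrow> f x = 0) \<Longrightarrow> P f"
  shows "P f"
proof -
  obtain K where K: "compactin X K" "\<And>x. f x \<noteq> 0 \<Longrightarrow> x \<in> K" using CcD[OF f] by blast
  have "K \<subseteq> \<Union> (cobs G)"
  proof
    fix x assume "x \<in> K"
    then have "x \<in> A" using compactin_subset_topspace[OF K(1)] by blast
    then show "x \<in> \<Union> (cobs G)" using cob_basis[OF openin_topspace] by blast
  qed
  moreover have "\<forall>U\<in>cobs G. openin X U" using cob_open by blast
  ultimately obtain \<V> where \<V>: "finite \<V>" "\<V> \<subseteq> cobs G" "K \<subseteq> \<Union>\<V>"
    using K(1) unfolding compactin_def by meson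
  have *: "P f" if "finite \<U>" "\<U> \<subseteq> cobs G" "f \<in> Cc_funs G" "\<And>x. f x \<noteq> 0 \<Longrightarrow> x \<in> \<Union>\<U>" for \<U> f
    using that
  proof (induction \<U> arbitrary: f rule: finite_induct)
    case empty
    then have "f = (\<lambda>x. 0)" by auto
    then show ?case using zero by simp
  next
    case (insert U \<U>)
    let ?g = "\<lambda>x. if x \<in> U then f x else 0" and ?h = "\<lambda>x. if x \<in> A - U then f x else 0"
    have U: "U \<in> cobs G" using insert.prems(1) by blast
    have g: "?g \<in> Cc_funs G"
      using insert.prems(2) cob_open[OF U] cob_closed[OF U] by (rule Cc_restrict)
    have h: "?h \<in> Cc_funs G"
      using insert.prems(2) cob_open[OF U] cob_closed[OF U] by (intro Cc_restrict) auto
    have "P ?g" using g U by (rule bis) auto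
    moreover have "P ?h"
    proof (rule insert.IH[OF _ h])
      show "\<U> \<subseteq> cobs G" using insert.prems(1) by blast
      fix x assume "?h x \<noteq> 0"
      then have "f x \<noteq> 0" "x \<notin> U" by (auto split: if_splits)
      then show "x \<in> \<Union>\<U>" using insert.prems(3) by blast
    qed
    moreover have "f = (\<lambda>x. ?g x + ?h x)"
      using Cc_outside[OF insert.prems(2)] by auto
    ultimately show ?case using add[OF g h] by simp
  qed
  show ?thesis
  proof (rule *[OF \<V>(1,2) f])
    fix x assume "f x \<noteq> 0"
    then show "x \<in> \<Union>\<V>" using K(2) \<V>(3) by blast
  qed
qed

lemma Cc_fibre_bounded:
  assumes "f \<in> Cc_funs G" shows "\<exists>C. fibre_bounded G f C"
  using assms
proof (induction rule: Cc_induct)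
  case zero
  then show ?case using fibre_bounded_zero by blast
next
  case (add f g)
  then show ?case using fibre_bounded_add by blast
next
  case (bisection f U)
  obtain M where M: "\<And>x. cmod (f x) \<le> M" "0 \<le> M" using Cc_bounded[OF bisection(1)] by blast
  have "fibre_bounded G f M"
    by (rule fibre_bounded_bisection[OF cob_bisection[OF bisection(2)]]) (use bisection(3) M in auto)
  then show ?case ..
qed

text \<open>The factor \<open>f\<close> singles out the one arrow of \<open>U\<close> with range
  \<open>r x\<close>. Convolution becomes a weighted left translation by that arrow.\<close>

lemma conv_bisection:
  assumes U: "U \<in> cobs G" and f: "\<And>x. x \<notin> U \<Longrightarrow> f x = 0" and x: "x \<in> A"
  shows "gconvolution G f g x =
    (if r x \<in> r ` U then f (sect U (r x)) * g (inv (sect U (r x)) \<cdot> x) else 0)"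
proof (cases "r x \<in> r ` U")
  case True
  have z: "sect U (r x) \<in> U" "r (sect U (r x)) = r x"
    using sect_in[OF U True] range_sect[OF U True] by auto
  have "gconvolution G f g x = f (sect U (r x)) * g (inv (sect U (r x)) \<cdot> x)"
  proof (rule conv_single[OF x cob_arrow[OF U z(1)] z(2)])
    fix z' assume z': "r z' = r x" "z' \<noteq> sect U (r x)"
    have "z' \<notin> U"
    proof
      assume "z' \<in> U"
      then have "sect U (r z') = z'" by (rule sect_range[OF U])
      then show False using z' by simp
    qed
    then show "f z' * g (inv z' \<cdot> x) = 0" using f by simp
  qed
  then show ?thesis using True by simp
next
  case False
  have "gconvolution G f g x = 0"
  proof (rule conv_zero)
    fix z assume "r z = r x"
    then have "z \<notin> U" using False by (metis imageI)
    then show "f z * g (inv z \<cdot> x) = 0" using f by simp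
  qed
  then show ?thesis using False by simp
qed

lemma continuous_translation:
  assumes U: "U \<in> cobs G"
  defines "W \<equiv> {x \<in> A. r x \<in> r ` U}"
  shows "continuous_map (subtopology X W) X (\<lambda>x. sect U (r x))"
    and "continuous_map (subtopology X W) X (\<lambda>x. inv (sect U (r x)) \<cdot> x)"
proof -
  have W: "topspace (subtopology X W) = W" by (auto simp: W_def)
  have "continuous_map (subtopology X W) (subtopology X (r ` U)) r"
    by (rule continuous_map_into_subtopology[OF continuous_map_from_subtopology[OF continuous_range]])
      (unfold W, auto simp: W_def)
  from continuous_map_compose[OF this continuous_sect[OF U]]
  show \<rho>: "continuous_map (subtopology X W) X (\<lambda>x. sect U (r x))"
    by (simp add: o_def)
  have "continuous_map (subtopology X W) X (\<lambda>x. inv (sect U (r x)))"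
    using continuous_map_compose[OF \<rho> continuous_inv] by (simp add: o_def)
  moreover have "continuous_map (subtopology X W) X (\<lambda>x. x)"
    by (intro continuous_map_from_subtopology) simp
  ultimately have "continuous_map (subtopology X W) (prod_topology X X)
      (\<lambda>x. (inv (sect U (r x)), x))"
    by (intro continuous_map_pairedI)
  moreover have "(inv (sect U (r x)), x) \<in> gcomp G" if "x \<in> W" for x
  proof -
    have x: "x \<in> A" "r x \<in> r ` U" using that by (auto simp: W_def)
    have "sect U (r x) \<in> A" using cob_arrow[OF U sect_in[OF U x(2)]] .
    then show ?thesis using x(1) range_sect[OF U x(2)] by (simp add: comp_iff)
  qed
  ultimately have "continuous_map (subtopology X W) (subtopology (prod_topology X X) (gcomp G))
      (\<lambda>x. (inv (sect U (r x)), x))"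
    unfolding continuous_map_in_subtopology W by blast
  from continuous_map_compose[OF this continuous_mult]
  show "continuous_map (subtopology X W) X (\<lambda>x. inv (sect U (r x)) \<cdot> x)"
    by (simp add: o_def)
qed

text \<open>The translation formula is continuous on the set \<open>W\<close> of arrows whose range
  is the range of an arrow of \<open>U\<close>. This set is clopen, so the extension by zero is
  continuous, and the support lies in the compact product of \<open>U\<close> with a compact set
  carrying \<open>g\<close>.\<close>

lemma Cc_conv_bisection:
  assumes f: "f \<in> Cc_funs G" and U: "U \<in> cobs G" and fU: "\<And>x. x \<notin> U \<Longrightarrow> f x = 0"
    and g: "g \<in> Cc_funs G"
  shows "gconvolution G f g \<in> Cc_funs G"
proof -
  define W where "W = {x \<in> A. r x \<in> r ` U}"
  have fc: "continuous_map X euclidean f" using CcD[OF f] by blast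
  obtain K where K: "continuous_map X euclidean g" "compactin X K" "\<And>x. g x \<noteq> 0 \<Longrightarrow> x \<in> K"
    using CcD[OF g] by blast
  have eq: "gconvolution G f g x =
    (if x \<in> W then f (sect U (r x)) * g (inv (sect U (r x)) \<cdot> x) else 0)" for x
  proof (cases "x \<in> A")
    case True
    then have "x \<in> W \<longleftrightarrow> r x \<in> r ` U" by (simp add: W_def)
    then show ?thesis using conv_bisection[of U f x g] U fU True by presburger
  next
    case False
    then have "x \<notin> W" by (simp add: W_def)
    then show ?thesis using conv_outside[OF False] by simp
  qed
  have clopen: "openin X W" "closedin X W"
    unfolding W_def using cob_range_image[OF U]
    by (auto intro: openin_continuous_map_preimage[OF continuous_range]
        closedin_continuous_map_preimage[OF continuous_range] cob_open cob_closed)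
  show ?thesis
  proof (rule CcI)
    have "continuous_map (subtopology X W) euclidean
        (\<lambda>x. f (sect U (r x)) * g (inv (sect U (r x)) \<cdot> x))"
      using continuous_map_compose[OF continuous_translation(1)[OF U] fc]
        continuous_map_compose[OF continuous_translation(2)[OF U] K(1)]
      unfolding W_def by (intro continuous_map_mult_complex) (simp_all add: o_def)
    from continuous_map_cases_clopen[OF clopen this, of 0]
    show "continuous_map X euclidean (gconvolution G f g)"
      unfolding eq[abs_def] by simp
    show "compactin X (set_mult U K)" using cob_compact[OF U] K(2) by (rule compact_set_mult)
    fix x assume nz: "gconvolution G f g x \<noteq> 0"
    define y where "y = sect U (r x)"
    have "x \<in> W" using nz eq by metis
    then have x: "x \<in> A" "r x \<in> r ` U" by (simp_all add: W_def)
    have y: "y \<in> U" "r y = r x"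
      unfolding y_def using sect_in[OF U x(2)] range_sect[OF U x(2)] by simp_all
    have "y \<in> A" using cob_arrow[OF U y(1)] .
    have "g (inv y \<cdot> x) \<noteq> 0" using nz \<open>x \<in> W\<close> by (simp add: eq y_def)
    then have "inv y \<cdot> x \<in> K" by (rule K(3))
    moreover have "s y = r (inv y \<cdot> x)" "x = y \<cdot> (inv y \<cdot> x)"
      using x(1) y(2) \<open>y \<in> A\<close> by simp_all
    ultimately show "x \<in> set_mult U K"
      using y(1) cob_subset[OF U] compactin_subset_topspace[OF K(2)] set_mult_iff[of U K x]
      by blast
  qed
qed

lemma Cc_conv:
  assumes f: "f \<in> Cc_funs G" and g: "g \<in> Cc_funs G"
  shows "gconvolution G f g \<in> Cc_funs G"
  using f
proof (induction rule: Cc_induct)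
  case zero
  have "gconvolution G (\<lambda>x. 0) g = (\<lambda>x. 0)" by (auto simp: gconvolution_def)
  then show ?case using Cc_zero by simp
next
  case (add f f')
  obtain C C' D where b: "fibre_bounded G f C" "fibre_bounded G f' C'" "fibre_bounded G g D"
    using Cc_fibre_bounded[OF add(1)] Cc_fibre_bounded[OF add(2)] Cc_fibre_bounded[OF g] by blast
  show ?case unfolding conv_add_left[OF b] using add(3,4) by (rule Cc_add)
next
  case (bisection f U)
  then show ?case using g by (intro Cc_conv_bisection)
qed

end

subsection \<open>The completion as an algebra of functions\<close>

text \<open>Closeness is expressed by \<open>fibre_bounded\<close>, because \<open>I_norm\<close> of
  a difference not yet known to be bounded could be the default value 0.\<close>

definition LF :: "('a, 'm) topgroupoid_scheme \<Rightarrow> ('a \<Rightarrow> complex) set" where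
  "LF G = {f. (\<forall>x. x \<notin> arrows G \<longrightarrow> f x = 0) \<and>
     (\<forall>e>0. \<exists>g \<in> Cc_funs G. fibre_bounded G (\<lambda>x. f x - g x) e)}"

definition LF_alg :: "('a, 'm) topgroupoid_scheme \<Rightarrow> ('a \<Rightarrow> complex) normed_alg" where
  "LF_alg G = (Cc G)\<lparr>acarrier := LF G\<rparr>"

lemma LF_alg_simps [simp]:
  "acarrier (LF_alg G) = LF G"
  "aadd (LF_alg G) f g = (\<lambda>x. f x + g x)"
  "ascale (LF_alg G) c f = (\<lambda>x. c * f x)"
  "amult (LF_alg G) f g = gconvolution G f g"
  "anorm (LF_alg G) f = I_norm G f"
  by (simp_all add: LF_alg_def Cc_def)

text \<open>
  As a set of sequences, this is the element of \<^term>\<open>LI G\<close> that \<open>f\<close> stands for.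
\<close>

definition approximants :: "('a, 'm) topgroupoid_scheme \<Rightarrow> ('a \<Rightarrow> complex) \<Rightarrow> (nat \<Rightarrow> 'a \<Rightarrow> complex) set"
  where "approximants G f = {t. (\<forall>n. t n \<in> Cc_funs G) \<and>
     (\<forall>e>0. \<exists>N. \<forall>n\<ge>N. fibre_bounded G (\<lambda>x. f x - t n x) e)}"

text \<open>Neither the record nor \<open>isometric_alg_iso\<close> says that operations stay in the
  carrier. The inverse of an isomorphism is shown multiplicative by applying it to \<Phi> of a
  product, which has to lie in the carrier for this.\<close>

definition alg_closed :: "'v normed_alg \<Rightarrow> bool" where
  "alg_closed A \<longleftrightarrow> (\<forall>a\<in>acarrier A. \<forall>b\<in>acarrier A. aadd A a b \<in> acarrier A \<and> amult A a b \<in> acarrier A) \<and>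
     (\<forall>c. \<forall>a\<in>acarrier A. ascale A c a \<in> acarrier A)"

lemma isometric_alg_iso_trans:
  assumes "isometric_alg_iso A B \<Phi>" "isometric_alg_iso B C \<Psi>"
  shows "isometric_alg_iso A C (\<Psi> \<circ> \<Phi>)"
proof -
  have "\<Phi> a \<in> acarrier B" if "a \<in> acarrier A" for a
    using assms(1) that by (auto simp: isometric_alg_iso_def bij_betw_def)
  then show ?thesis
    using assms unfolding isometric_alg_iso_def by (auto intro: bij_betw_trans)
qed

lemma isometric_alg_iso_inverse:
  assumes \<Phi>: "isometric_alg_iso A B \<Phi>" and closed: "alg_closed A"
  shows "isometric_alg_iso B A (inv_into (acarrier A) \<Phi>)"
proof -
  let ?\<Psi> = "inv_into (acarrier A) \<Phi>"
  have bij: "bij_betw \<Phi> (acarrier A) (acarrier B)"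
    using \<Phi> by (simp add: isometric_alg_iso_def)
  have \<Psi>: "?\<Psi> b \<in> acarrier A" "\<Phi> (?\<Psi> b) = b" if "b \<in> acarrier B" for b
    using bij that by (auto simp: bij_betw_def inv_into_into f_inv_into_f)
  have \<Psi>\<Phi>: "?\<Psi> (\<Phi> a) = a" if "a \<in> acarrier A" for a
    using bij that by (simp add: bij_betw_def)
  have hom: "\<Phi> (aadd A a b) = aadd B (\<Phi> a) (\<Phi> b)" "\<Phi> (amult A a b) = amult B (\<Phi> a) (\<Phi> b)"
      "\<Phi> (ascale A c a) = ascale B c (\<Phi> a)" "anorm B (\<Phi> a) = anorm A a"
    if "a \<in> acarrier A" "b \<in> acarrier A" for a b c
    using \<Phi> that by (simp_all add: isometric_alg_iso_def)
  have cl: "aadd A a b \<in> acarrier A" "amult A a b \<in> acarrier A" "ascale A c a \<in> acarrier A"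
    if "a \<in> acarrier A" "b \<in> acarrier A" for a b c
    using closed that by (simp_all add: alg_closed_def)
  have "?\<Psi> (aadd B a b) = aadd A (?\<Psi> a) (?\<Psi> b)" "?\<Psi> (amult B a b) = amult A (?\<Psi> a) (?\<Psi> b)"
    "?\<Psi> (ascale B c a) = ascale A c (?\<Psi> a)" "anorm A (?\<Psi> a) = anorm B a"
    if "a \<in> acarrier B" "b \<in> acarrier B" for a b c
    using hom[OF \<Psi>(1)[OF that(1)] \<Psi>(1)[OF that(2)]] cl[OF \<Psi>(1)[OF that(1)] \<Psi>(1)[OF that(2)]]
      \<Psi>\<Phi> \<Psi>(2)[OF that(1)] \<Psi>(2)[OF that(2)]
    by metis+
  then show ?thesis
    unfolding isometric_alg_iso_def using bij_betw_inv_into[OF bij] by blast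
qed

lemma adist_Cc: "adist (Cc G) f g = I_norm G (\<lambda>x. f x - g x)"
  by (simp add: adist_def Cc_def)

lemma LF_outside: "f \<in> LF G \<Longrightarrow> x \<notin> arrows G \<Longrightarrow> f x = 0"
  by (simp add: LF_def)

lemma LF_approx:
  assumes "f \<in> LF G" "0 < e"
  obtains g where "g \<in> Cc_funs G" "fibre_bounded G (\<lambda>x. f x - g x) e"
  using assms unfolding LF_def by blast

lemma fibre_bounded_diff_commute:
  "fibre_bounded G (\<lambda>x. f x - g x) C \<longleftrightarrow> fibre_bounded G (\<lambda>x. g x - f x) C"
  by (simp add: fibre_bounded_def norm_minus_commute)

lemma fibre_bounded_diff_trans:
  assumes "fibre_bounded G (\<lambda>x. f x - g x) C" "fibre_bounded G (\<lambda>x. g x - h x) D"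
  shows "fibre_bounded G (\<lambda>x. f x - h x) (C + D)"
  using fibre_bounded_add[OF assms] by simp

lemma approximantsD:
  assumes "t \<in> approximants G f"
  shows "t n \<in> Cc_funs G"
    and "0 < e \<Longrightarrow> \<exists>N. \<forall>n\<ge>N. fibre_bounded G (\<lambda>x. f x - t n x) e"
  using assms by (auto simp: approximants_def)

lemma approximants_nonempty:
  assumes "f \<in> LF G" shows "approximants G f \<noteq> {}"
proof -
  have "\<exists>g. g \<in> Cc_funs G \<and> fibre_bounded G (\<lambda>x. f x - g x) (inverse (real (Suc n)))" for n
    using LF_approx[OF assms, of "inverse (real (Suc n))"] by auto
  then obtain t where t: "\<And>n. t n \<in> Cc_funs G"
    "\<And>n. fibre_bounded G (\<lambda>x. f x - t n x) (inverse (real (Suc n)))" by metis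
  have "\<exists>N. \<forall>n\<ge>N. fibre_bounded G (\<lambda>x. f x - t n x) e" if e: "0 < e" for e
  proof -
    obtain N where N: "inverse (real (Suc N)) < e" using reals_Archimedean[OF e] by blast
    have "fibre_bounded G (\<lambda>x. f x - t n x) e" if "N \<le> n" for n
    proof (rule fibre_bounded_mono[OF t(2)])
      have "inverse (real (Suc n)) \<le> inverse (real (Suc N))" using that by simp
      then show "inverse (real (Suc n)) \<le> e" using N by linarith
    qed
    then show ?thesis by blast
  qed
  then have "t \<in> approximants G f" using t(1) by (simp add: approximants_def)
  then show ?thesis by blast
qed

lemma class_rep_approximants: "f \<in> LF G \<Longrightarrow> class_rep (approximants G f) \<in> approximants G f"
  unfolding class_rep_def using approximants_nonempty[of f G] some_in_eq by blast

text \<open>The norm dominates every point value, so an approximating sequence determines its limit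
  pointwise.\<close>

lemma approximants_inj:
  assumes "f \<in> LF G" "g \<in> LF G" "t \<in> approximants G f" "t \<in> approximants G g"
  shows "f = g"
proof
  fix x
  show "f x = g x"
  proof (cases "x \<in> arrows G")
    case True
    have "cmod (f x - g x) \<le> 0"
    proof (rule field_le_epsilon)
      fix e :: real assume "0 < e"
      then have e: "0 < e / 2" by simp
      obtain M where M: "\<And>n. M \<le> n \<Longrightarrow> fibre_bounded G (\<lambda>x. f x - t n x) (e / 2)"
        using approximantsD(2)[OF assms(3) e] by blast
      obtain N where N: "\<And>n. N \<le> n \<Longrightarrow> fibre_bounded G (\<lambda>x. g x - t n x) (e / 2)"
        using approximantsD(2)[OF assms(4) e] by blast
      have "fibre_bounded G (\<lambda>x. f x - g x) (e / 2 + e / 2)"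
        using M[of "max M N"] N[of "max M N"]
        by (intro fibre_bounded_diff_trans) (auto simp: fibre_bounded_diff_commute[of G g])
      then show "cmod (f x - g x) \<le> 0 + e" using fibre_bounded_pointwise[OF _ True] by force
    qed
    then show ?thesis by simp
  qed (use assms(1,2) LF_outside in metis)
qed

section \<open>Closure properties of the function algebra and limits of Cauchy sequences\<close>

context hausdorff_ample_groupoid
begin

lemma LF_Cc: "f \<in> Cc_funs G \<Longrightarrow> f \<in> LF G"
  unfolding LF_def using Cc_outside fibre_bounded_zero fibre_bounded_mono
  by (smt (verit) cancel_comm_monoid_add_class.diff_cancel fibre_bounded_def mem_Collect_eq sum.neutral norm_zero)

lemma LF_fibre_bounded:
  assumes "f \<in> LF G" shows "\<exists>C. fibre_bounded G f C"
proof -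
  obtain g where g: "g \<in> Cc_funs G" "fibre_bounded G (\<lambda>x. f x - g x) 1"
    using LF_approx[OF assms zero_less_one] by blast
  obtain C where "fibre_bounded G g C" using Cc_fibre_bounded[OF g(1)] by blast
  from fibre_bounded_add[OF g(2) this] show ?thesis by auto
qed

lemma LF_I_norm: "f \<in> LF G \<Longrightarrow> fibre_bounded G f (I_norm G f)"
  using LF_fibre_bounded fibre_bounded_I_norm by blast

lemma small_scale_bound:
  assumes "0 < (e::real)" "0 \<le> C" obtains d where "0 < d" "C * d \<le> e"
proof
  show "0 < e / (C + 1)" using assms by simp
  have "C * (e / (C + 1)) \<le> (C + 1) * (e / (C + 1))" using assms by (intro mult_right_mono) auto
  also have "\<dots> = e" using assms by simp
  finally show "C * (e / (C + 1)) \<le> e" .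
qed

lemma LF_scale:
  assumes "f \<in> LF G" shows "(\<lambda>x. c * f x) \<in> LF G"
  unfolding LF_def mem_Collect_eq
proof (intro conjI allI impI)
  fix e :: real assume "0 < e"
  then obtain d where d: "0 < d" "cmod c * d \<le> e" using small_scale_bound norm_ge_zero by blast
  obtain g where g: "g \<in> Cc_funs G" "fibre_bounded G (\<lambda>x. f x - g x) d"
    using LF_approx[OF assms d(1)] by blast
  have "fibre_bounded G (\<lambda>x. c * f x - c * g x) e"
    using fibre_bounded_mono[OF fibre_bounded_scale[OF g(2), of c] d(2)]
    by (simp add: right_diff_distrib)
  then show "\<exists>g\<in>Cc_funs G. fibre_bounded G (\<lambda>x. c * f x - g x) e"
    using Cc_scale[OF g(1), of c] by (intro bexI)
qed (use LF_outside[OF assms] in simp)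

lemma LF_add:
  assumes "f \<in> LF G" "g \<in> LF G" shows "(\<lambda>x. f x + g x) \<in> LF G"
  unfolding LF_def mem_Collect_eq
proof (intro conjI allI impI)
  fix e :: real assume "0 < e"
  then have e: "0 < e / 2" by simp
  obtain f' where f': "f' \<in> Cc_funs G" "fibre_bounded G (\<lambda>x. f x - f' x) (e / 2)"
    using LF_approx[OF assms(1) e] by blast
  obtain g' where g': "g' \<in> Cc_funs G" "fibre_bounded G (\<lambda>x. g x - g' x) (e / 2)"
    using LF_approx[OF assms(2) e] by blast
  have "fibre_bounded G (\<lambda>x. (f x + g x) - (f' x + g' x)) e"
    using fibre_bounded_add[OF f'(2) g'(2)] by (simp add: algebra_simps)
  then show "\<exists>h\<in>Cc_funs G. fibre_bounded G (\<lambda>x. f x + g x - h x) e"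
    using Cc_add[OF f'(1) g'(1)] by (intro bexI)
qed (use LF_outside[OF assms(1)] LF_outside[OF assms(2)] in simp)

lemma LF_diff:
  assumes "f \<in> LF G" "g \<in> LF G" shows "(\<lambda>x. f x - g x) \<in> LF G"
  using LF_add[OF assms(1) LF_scale[OF assms(2), of "-1"]] by simp

text \<open>Split f g - f' g' as (f - f') g + f' (g - g') and bound \<open>f'\<close> by
  \<open>C + d\<close>.\<close>

lemma conv_diff_bound:
  assumes "fibre_bounded G f C" "fibre_bounded G g D"
    and f': "fibre_bounded G (\<lambda>x. f x - f' x) d" and g': "fibre_bounded G (\<lambda>x. g x - g' x) d"
  shows "fibre_bounded G (\<lambda>x. gconvolution G f g x - gconvolution G f' g' x) (d * (C + D + d))"
proof -
  have bf': "fibre_bounded G f' (C + d)"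
    using fibre_bounded_diff[OF assms(1) f'] by simp
  have bg': "fibre_bounded G g' (D + d)"
    using fibre_bounded_diff[OF assms(2) g'] by simp
  have "gconvolution G f g x - gconvolution G f' g' x =
      gconvolution G (\<lambda>x. f x - f' x) g x + gconvolution G f' (\<lambda>x. g x - g' x) x" for x
    using conv_diff_left[OF assms(1) bf' assms(2)] conv_diff_right[OF assms(2) bg' bf'] by simp
  moreover have "fibre_bounded G (\<lambda>x. gconvolution G (\<lambda>x. f x - f' x) g x +
      gconvolution G f' (\<lambda>x. g x - g' x) x) (d * D + (C + d) * d)"
    using f' g' assms(2) bf' by (intro fibre_bounded_add fibre_bounded_conv)
  ultimately show ?thesis by (simp add: algebra_simps)
qed

lemma small_conv_bound:
  assumes "0 < (e::real)" "0 \<le> C" obtains d where "0 < d" "d * (C + d) \<le> e"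
proof
  \<comment> \<open>Keeping the witness at most 1 replaces the factor \<open>C + d\<close> by the
    constant \<open>C + 1\<close>, after which the bound is linear.\<close>
  let ?d = "min 1 (e / (C + 1))"
  show "0 < ?d" using assms by simp
  have "?d * (C + ?d) \<le> ?d * (C + 1)" using assms by (intro mult_left_mono) auto
  also have "\<dots> \<le> (e / (C + 1)) * (C + 1)" using assms by (intro mult_right_mono) auto
  also have "\<dots> = e" using assms by simp
  finally show "?d * (C + ?d) \<le> e" .
qed

lemma LF_conv:
  assumes "f \<in> LF G" "g \<in> LF G" shows "gconvolution G f g \<in> LF G"
  unfolding LF_def mem_Collect_eq
proof (intro conjI allI impI)
  fix e :: real assume e: "0 < e"
  obtain C where C: "fibre_bounded G f C" using LF_fibre_bounded[OF assms(1)] by blast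
  obtain D where D: "fibre_bounded G g D" using LF_fibre_bounded[OF assms(2)] by blast
  have "0 \<le> C + D" using fibre_bounded_nonneg[OF C] fibre_bounded_nonneg[OF D] by simp
  then obtain d where d: "0 < d" "d * (C + D + d) \<le> e" using small_conv_bound[OF e] by blast
  obtain f' where f': "f' \<in> Cc_funs G" "fibre_bounded G (\<lambda>x. f x - f' x) d"
    using LF_approx[OF assms(1) d(1)] by blast
  obtain g' where g': "g' \<in> Cc_funs G" "fibre_bounded G (\<lambda>x. g x - g' x) d"
    using LF_approx[OF assms(2) d(1)] by blast
  show "\<exists>h\<in>Cc_funs G. fibre_bounded G (\<lambda>x. gconvolution G f g x - h x) e"
    using fibre_bounded_mono[OF conv_diff_bound[OF C D f'(2) g'(2)] d(2)] Cc_conv[OF f'(1) g'(1)]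
    by (intro bexI)
qed (simp add: gconvolution_def)

lemma alg_closed_LF: "alg_closed (LF_alg G)"
  by (simp add: alg_closed_def LF_add LF_scale LF_conv)

lemma Cc_dist_bounded:
  assumes "f \<in> Cc_funs G" "g \<in> Cc_funs G"
  shows "fibre_bounded G (\<lambda>x. f x - g x) (adist (Cc G) f g)"
  unfolding adist_Cc by (intro LF_I_norm LF_Cc Cc_diff assms)

lemma approximants_cauchy:
  assumes "t \<in> approximants G f" shows "t \<in> cauchy_seqs (Cc G)"
  unfolding cauchy_seqs_def mem_Collect_eq
proof (intro conjI allI impI)
  show "t n \<in> acarrier (Cc G)" for n using approximantsD(1)[OF assms] by (simp add: Cc_def)
  fix e :: real assume "0 < e"
  then have "0 < e / 3" by simp
  then obtain N where N: "\<And>n. N \<le> n \<Longrightarrow> fibre_bounded G (\<lambda>x. f x - t n x) (e / 3)"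
    using approximantsD(2)[OF assms] by blast
  have "adist (Cc G) (t m) (t n) < e" if "N \<le> m" "N \<le> n" for m n
  proof -
    have "fibre_bounded G (\<lambda>x. t m x - f x) (e / 3)"
      using N[OF that(1)] by (simp add: fibre_bounded_diff_commute)
    from fibre_bounded_diff_trans[OF this N[OF that(2)]]
    have "adist (Cc G) (t m) (t n) \<le> e / 3 + e / 3" unfolding adist_Cc by (rule I_norm_le)
    then show ?thesis using \<open>0 < e\<close> by simp
  qed
  then show "\<exists>N. \<forall>m\<ge>N. \<forall>n\<ge>N. adist (Cc G) (t m) (t n) < e" by blast
qed

text \<open>Domination of point values gives a pointwise limit. It is also a limit in norm: fix
  \<open>n\<close> and let \<open>m\<close> tend to infinity in the Cauchy bound, using
  \<open>fibre_bounded_limit\<close>.\<close>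

lemma cauchy_limit:
  assumes t: "t \<in> cauchy_seqs (Cc G)"
  obtains f where "f \<in> LF G" "t \<in> approximants G f"
proof -
  have Cc: "t n \<in> Cc_funs G" for n using t by (simp add: cauchy_seqs_def Cc_def)
  have cau: "\<exists>N. \<forall>m\<ge>N. \<forall>n\<ge>N. fibre_bounded G (\<lambda>x. t m x - t n x) e" if e: "0 < e" for e
  proof -
    obtain N where "\<And>m n. N \<le> m \<Longrightarrow> N \<le> n \<Longrightarrow> adist (Cc G) (t m) (t n) < e"
      using t e unfolding cauchy_seqs_def mem_Collect_eq by blast
    then have "fibre_bounded G (\<lambda>x. t m x - t n x) e" if "N \<le> m" "N \<le> n" for m n
      using fibre_bounded_mono[OF Cc_dist_bounded[OF Cc Cc]] that less_imp_le by metis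
    then show ?thesis by blast
  qed
  define f where "f = (\<lambda>x. lim (\<lambda>n. t n x))"
  have lim: "(\<lambda>n. t n x) \<longlonglongrightarrow> f x" for x
  proof -
    have "Cauchy (\<lambda>n. t n x)"
    proof (cases "x \<in> A")
      case True
      show ?thesis
      proof (rule metric_CauchyI)
        fix e :: real assume "0 < e"
        then have "0 < e / 2" by simp
        then obtain N where N: "\<And>m n. N \<le> m \<Longrightarrow> N \<le> n \<Longrightarrow> fibre_bounded G (\<lambda>x. t m x - t n x) (e / 2)"
          using cau by blast
        have "dist (t m x) (t n x) < e" if "N \<le> m" "N \<le> n" for m n
          using fibre_bounded_pointwise[OF N[OF that] True] \<open>0 < e\<close> by (simp add: dist_norm)
        then show "\<exists>M. \<forall>m\<ge>M. \<forall>n\<ge>M. dist (t m x) (t n x) < e" by blast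
      qed
    next
      case False
      then have "(\<lambda>n. t n x) = (\<lambda>n. 0)" using Cc_outside[OF Cc] by simp
      then show ?thesis by (simp add: Cauchy_def)
    qed
    then show ?thesis
      unfolding f_def by (simp add: Cauchy_convergent_iff convergent_LIMSEQ_iff)
  qed
  have app: "\<exists>N. \<forall>n\<ge>N. fibre_bounded G (\<lambda>x. f x - t n x) e" if e: "0 < e" for e
  proof -
    obtain N where N: "\<And>m n. N \<le> m \<Longrightarrow> N \<le> n \<Longrightarrow> fibre_bounded G (\<lambda>x. t m x - t n x) e"
      using cau[OF e] by blast
    have "fibre_bounded G (\<lambda>x. f x - t n x) e" if "N \<le> n" for n
      by (rule fibre_bounded_limit[where N = N and f = "\<lambda>m x. t m x - t n x"])
        (use N that lim in \<open>auto intro: tendsto_diff\<close>)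
    then show ?thesis by blast
  qed
  have "f x = 0" if "x \<notin> A" for x
  proof -
    have "(\<lambda>n. t n x) = (\<lambda>n. 0)" using Cc_outside[OF Cc that] by simp
    then show ?thesis using lim[of x] LIMSEQ_unique by (metis tendsto_const)
  qed
  moreover have "\<exists>g\<in>Cc_funs G. fibre_bounded G (\<lambda>x. f x - g x) e" if "0 < e" for e
    using app[OF that] Cc by blast
  ultimately have "f \<in> LF G" unfolding LF_def by blast
  moreover have "t \<in> approximants G f" using app Cc by (simp add: approximants_def)
  ultimately show ?thesis by (rule that)
qed

text \<open>Both inclusions are the triangle inequality through \<open>f\<close>. The class depends
  on \<open>t\<close> only through its limit, which is why the representative chosen by
  \<open>class_rep\<close> does not matter.\<close>

lemma cauchy_class:
  assumes t: "t \<in> approximants G f"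
  shows "cauchy_rel (Cc G) `` {t} = approximants G f"
proof (intro equalityI subsetI)
  fix t' assume "t' \<in> cauchy_rel (Cc G) `` {t}"
  then have t': "t' \<in> cauchy_seqs (Cc G)" and lim: "(\<lambda>n. adist (Cc G) (t n) (t' n)) \<longlonglongrightarrow> 0"
    by (auto simp: cauchy_rel_def)
  have Cc: "t' n \<in> Cc_funs G" for n using t' by (simp add: cauchy_seqs_def Cc_def)
  have "\<exists>N. \<forall>n\<ge>N. fibre_bounded G (\<lambda>x. f x - t' n x) e" if e0: "0 < e" for e
  proof -
    have e: "0 < e / 2" using e0 by simp
    obtain N where N: "\<And>n. N \<le> n \<Longrightarrow> fibre_bounded G (\<lambda>x. f x - t n x) (e / 2)"
      using approximantsD(2)[OF t e] by blast
    obtain M where M: "\<And>n. M \<le> n \<Longrightarrow> adist (Cc G) (t n) (t' n) < e / 2"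
      using order_tendstoD(2)[OF lim e] unfolding eventually_sequentially by blast
    have "fibre_bounded G (\<lambda>x. f x - t' n x) e" if n: "max M N \<le> n" for n
    proof -
      have "fibre_bounded G (\<lambda>x. t n x - t' n x) (e / 2)"
        using fibre_bounded_mono[OF Cc_dist_bounded[OF approximantsD(1)[OF t] Cc]] M[of n] n by simp
      from fibre_bounded_diff_trans[OF N this] n show ?thesis by simp
    qed
    then show ?thesis by blast
  qed
  then show "t' \<in> approximants G f" using Cc by (simp add: approximants_def)
next
  fix t' assume t': "t' \<in> approximants G f"
  have "(\<lambda>n. adist (Cc G) (t n) (t' n)) \<longlonglongrightarrow> 0"
  proof (rule LIMSEQ_I)
    fix e :: real assume "0 < e"
    then have e: "0 < e / 3" by simp
    obtain N where N: "\<And>n. N \<le> n \<Longrightarrow> fibre_bounded G (\<lambda>x. f x - t n x) (e / 3)"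
      using approximantsD(2)[OF t e] by blast
    obtain M where M: "\<And>n. M \<le> n \<Longrightarrow> fibre_bounded G (\<lambda>x. f x - t' n x) (e / 3)"
      using approximantsD(2)[OF t' e] by blast
    have "norm (adist (Cc G) (t n) (t' n) - 0) < e" if n: "max M N \<le> n" for n
    proof -
      have "fibre_bounded G (\<lambda>x. t n x - f x) (e / 3)"
        using N n by (simp add: fibre_bounded_diff_commute)
      from fibre_bounded_diff_trans[OF this M] n
      have "adist (Cc G) (t n) (t' n) \<le> e / 3 + e / 3" unfolding adist_Cc by (intro I_norm_le) auto
      then show ?thesis using \<open>0 < e\<close> I_norm_nonneg by (simp add: adist_Cc)
    qed
    then show "\<exists>no. \<forall>n\<ge>no. norm (adist (Cc G) (t n) (t' n) - 0) < e" by blast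
  qed
  then show "t' \<in> cauchy_rel (Cc G) `` {t}"
    using approximants_cauchy t t' by (simp add: cauchy_rel_def)
qed

lemma approximants_add:
  assumes "t \<in> approximants G f" "t' \<in> approximants G g"
  shows "(\<lambda>n x. t n x + t' n x) \<in> approximants G (\<lambda>x. f x + g x)"
  unfolding approximants_def mem_Collect_eq
proof (intro conjI allI impI)
  show "(\<lambda>x. t n x + t' n x) \<in> Cc_funs G" for n
    using assms approximantsD(1) by (intro Cc_add) blast+
  fix e :: real assume "0 < e"
  then have e: "0 < e / 2" by simp
  obtain N where N: "\<And>n. N \<le> n \<Longrightarrow> fibre_bounded G (\<lambda>x. f x - t n x) (e / 2)"
    using approximantsD(2)[OF assms(1) e] by blast
  obtain M where M: "\<And>n. M \<le> n \<Longrightarrow> fibre_bounded G (\<lambda>x. g x - t' n x) (e / 2)"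
    using approximantsD(2)[OF assms(2) e] by blast
  have "fibre_bounded G (\<lambda>x. f x + g x - (t n x + t' n x)) e" if n: "max M N \<le> n" for n
    using fibre_bounded_add[OF N M, of n n] n by (simp add: algebra_simps)
  then show "\<exists>N. \<forall>n\<ge>N. fibre_bounded G (\<lambda>x. f x + g x - (t n x + t' n x)) e" by blast
qed

lemma approximants_scale:
  assumes "t \<in> approximants G f"
  shows "(\<lambda>n x. c * t n x) \<in> approximants G (\<lambda>x. c * f x)"
  unfolding approximants_def mem_Collect_eq
proof (intro conjI allI impI)
  show "(\<lambda>x. c * t n x) \<in> Cc_funs G" for n
    using assms approximantsD(1) by (intro Cc_scale) blast
  fix e :: real assume "0 < e"
  then obtain d where d: "0 < d" "cmod c * d \<le> e" using small_scale_bound norm_ge_zero by blast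
  obtain N where N: "\<And>n. N \<le> n \<Longrightarrow> fibre_bounded G (\<lambda>x. f x - t n x) d"
    using approximantsD(2)[OF assms d(1)] by blast
  have "fibre_bounded G (\<lambda>x. c * f x - c * t n x) e" if "N \<le> n" for n
    using fibre_bounded_mono[OF fibre_bounded_scale[OF N[OF that], of c] d(2)]
    by (simp add: right_diff_distrib)
  then show "\<exists>N. \<forall>n\<ge>N. fibre_bounded G (\<lambda>x. c * f x - c * t n x) e" by blast
qed

lemma approximants_conv:
  assumes t: "t \<in> approximants G f" "t' \<in> approximants G g" and fg: "f \<in> LF G" "g \<in> LF G"
  shows "(\<lambda>n. gconvolution G (t n) (t' n)) \<in> approximants G (gconvolution G f g)"
  unfolding approximants_def mem_Collect_eq
proof (intro conjI allI impI)
  show "gconvolution G (t n) (t' n) \<in> Cc_funs G" for n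
    using t approximantsD(1) by (intro Cc_conv) blast+
  fix e :: real assume e: "0 < e"
  obtain C where C: "fibre_bounded G f C" using LF_fibre_bounded[OF fg(1)] by blast
  obtain D where D: "fibre_bounded G g D" using LF_fibre_bounded[OF fg(2)] by blast
  have "0 \<le> C + D" using fibre_bounded_nonneg[OF C] fibre_bounded_nonneg[OF D] by simp
  then obtain d where d: "0 < d" "d * (C + D + d) \<le> e" using small_conv_bound[OF e] by blast
  obtain N where N: "\<And>n. N \<le> n \<Longrightarrow> fibre_bounded G (\<lambda>x. f x - t n x) d"
    using approximantsD(2)[OF t(1) d(1)] by blast
  obtain M where M: "\<And>n. M \<le> n \<Longrightarrow> fibre_bounded G (\<lambda>x. g x - t' n x) d"
    using approximantsD(2)[OF t(2) d(1)] by blast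
  have "fibre_bounded G (\<lambda>x. gconvolution G f g x - gconvolution G (t n) (t' n) x) e"
    if n: "max M N \<le> n" for n
    using fibre_bounded_mono[OF conv_diff_bound[OF C D N M] d(2)] n by simp
  then show "\<exists>N. \<forall>n\<ge>N. fibre_bounded G (\<lambda>x. gconvolution G f g x - gconvolution G (t n) (t' n) x) e"
    by blast
qed

lemma approximants_norm:
  assumes t: "t \<in> approximants G f" and f: "f \<in> LF G"
  shows "(\<lambda>n. I_norm G (t n)) \<longlonglongrightarrow> I_norm G f"
proof (rule LIMSEQ_I)
  fix e :: real assume "0 < e"
  then have e: "0 < e / 2" by simp
  obtain N where N: "\<And>n. N \<le> n \<Longrightarrow> fibre_bounded G (\<lambda>x. f x - t n x) (e / 2)"
    using approximantsD(2)[OF t e] by blast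
  have "norm (I_norm G (t n) - I_norm G f) < e" if n: "N \<le> n" for n
  proof -
    have tn: "fibre_bounded G (t n) (I_norm G (t n))"
      using LF_I_norm[OF LF_Cc[OF approximantsD(1)[OF t]]] .
    have "I_norm G (t n) \<le> I_norm G f + e / 2"
      using I_norm_le[OF fibre_bounded_diff[OF LF_I_norm[OF f] N[OF n]]] by simp
    moreover have "I_norm G f \<le> e / 2 + I_norm G (t n)"
      using I_norm_le[OF fibre_bounded_add[OF N[OF n] tn]] by simp
    ultimately show ?thesis using \<open>0 < e\<close> by (simp add: abs_less_iff)
  qed
  then show "\<exists>no. \<forall>n\<ge>no. norm (I_norm G (t n) - I_norm G f) < e" by blast
qed

text \<open>The operations of \<open>LI\<close> are computed termwise on chosen representatives. By
  \<open>cauchy_class\<close> it is enough that the termwise result approximates the expected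
  function.\<close>

lemma LI_iso: "isometric_alg_iso (LF_alg G) (LI G) (approximants G)"
  unfolding isometric_alg_iso_def
proof (intro conjI ballI allI)
  have "approximants G ` LF G = cauchy_seqs (Cc G) // cauchy_rel (Cc G)"
  proof (intro equalityI subsetI)
    fix S assume "S \<in> approximants G ` LF G"
    then obtain f where f: "f \<in> LF G" "S = approximants G f" by blast
    then obtain t where t: "t \<in> approximants G f" using approximants_nonempty[OF f(1)] by blast
    show "S \<in> cauchy_seqs (Cc G) // cauchy_rel (Cc G)"
      using quotientI[OF approximants_cauchy[OF t], of "cauchy_rel (Cc G)"]
      unfolding f(2) cauchy_class[OF t] .
  next
    fix S assume "S \<in> cauchy_seqs (Cc G) // cauchy_rel (Cc G)"
    then obtain t where t: "t \<in> cauchy_seqs (Cc G)" "S = cauchy_rel (Cc G) `` {t}"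
      unfolding quotient_def by blast
    obtain f where f: "f \<in> LF G" "t \<in> approximants G f" using cauchy_limit[OF t(1)] by blast
    show "S \<in> approximants G ` LF G" unfolding t(2) cauchy_class[OF f(2)] using f(1) by (rule imageI)
  qed
  moreover have "inj_on (approximants G) (LF G)"
  proof (rule inj_onI)
    fix f g assume fg: "f \<in> LF G" "g \<in> LF G" "approximants G f = approximants G g"
    then show "f = g"
      using approximants_inj[OF fg(1,2)] class_rep_approximants[OF fg(1)] by simp
  qed
  ultimately show "bij_betw (approximants G) (acarrier (LF_alg G)) (acarrier (LI G))"
    by (simp add: bij_betw_def LI_def alg_completion_def)
next
  fix f g assume "f \<in> acarrier (LF_alg G)" "g \<in> acarrier (LF_alg G)"
  then have fg: "f \<in> LF G" "g \<in> LF G" by simp_all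
  note rep = class_rep_approximants[OF fg(1)] class_rep_approximants[OF fg(2)]
  show "approximants G (aadd (LF_alg G) f g) = aadd (LI G) (approximants G f) (approximants G g)"
    using cauchy_class[OF approximants_add[OF rep]]
    by (simp add: LI_def alg_completion_def Cc_def)
  show "approximants G (amult (LF_alg G) f g) = amult (LI G) (approximants G f) (approximants G g)"
    using cauchy_class[OF approximants_conv[OF rep fg]]
    by (simp add: LI_def alg_completion_def Cc_def)
next
  fix c f assume "f \<in> acarrier (LF_alg G)"
  then have f: "f \<in> LF G" by simp
  note rep = class_rep_approximants[OF f]
  show "approximants G (ascale (LF_alg G) c f) = ascale (LI G) c (approximants G f)"
    using cauchy_class[OF approximants_scale[OF rep]]
    by (simp add: LI_def alg_completion_def Cc_def)
next
  fix f assume "f \<in> acarrier (LF_alg G)"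
  then have f: "f \<in> LF G" by simp
  show "anorm (LI G) (approximants G f) = anorm (LF_alg G) f"
    using limI[OF approximants_norm[OF class_rep_approximants[OF f] f]]
    by (simp add: LI_def alg_completion_def Cc_def)
qed

end

subsection \<open>Hermitian elements and normalizing pairs\<close>

text \<open>
  A second-order replacement for the classical condition \<open>\<parallel>exp(i t d)\<parallel> = 1\<close> that needs neither a
  unit nor the exponential series.
\<close>

definition hermitian :: "'v normed_alg \<Rightarrow> 'v \<Rightarrow> bool" where
  "hermitian A d \<longleftrightarrow> d \<in> acarrier A \<and> (\<exists>C\<ge>0. \<forall>a\<in>acarrier A. \<forall>t::real.
     anorm A (aadd A a (ascale A (\<i> * of_real t) (amult A d a))) \<le> (1 + C * t\<^sup>2) * anorm A a)"

text \<open>The abstract form of the diagonal subalgebra: in \<open>LF_alg G\<close> it consists of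
  the elements supported on the units.\<close>

definition hermitian_span :: "'v normed_alg \<Rightarrow> 'v set" where
  "hermitian_span A = {aadd A h (ascale A \<i> k) | h k. hermitian A h \<and> hermitian A k}"

definition normalizing_pair :: "'v normed_alg \<Rightarrow> 'v \<Rightarrow> 'v \<Rightarrow> bool" where
  "normalizing_pair A a b \<longleftrightarrow> a \<in> acarrier A \<and> b \<in> acarrier A \<and> anorm A a \<le> 1 \<and> anorm A b \<le> 1 \<and>
     (let e = amult A a b; f = amult A b a in
       hermitian A e \<and> hermitian A f \<and> amult A e e = e \<and> amult A f f = f \<and>
       amult A e a = a \<and> amult A f b = b)"

context
  fixes A :: "'v normed_alg" and B :: "'w normed_alg" and \<Phi> :: "'v \<Rightarrow> 'w"
  assumes \<Phi>: "isometric_alg_iso A B \<Phi>" and closed: "alg_closed A"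
begin

lemma iso_hom:
  assumes "a \<in> acarrier A" "b \<in> acarrier A"
  shows "\<Phi> (aadd A a b) = aadd B (\<Phi> a) (\<Phi> b)" "\<Phi> (amult A a b) = amult B (\<Phi> a) (\<Phi> b)"
    "\<Phi> (ascale A c a) = ascale B c (\<Phi> a)" "anorm B (\<Phi> a) = anorm A a" "\<Phi> a \<in> acarrier B"
  using \<Phi> assms unfolding isometric_alg_iso_def bij_betw_def by blast+

lemma iso_closed:
  assumes "a \<in> acarrier A" "b \<in> acarrier A"
  shows "aadd A a b \<in> acarrier A" "amult A a b \<in> acarrier A" "ascale A c a \<in> acarrier A"
  using closed assms unfolding alg_closed_def by blast+

text \<open>The same constant \<open>C\<close> works: every test element of the target is \<Phi> of
  a test element, and the condition involves only the operations and the norm.\<close>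

lemma hermitian_iso:
  assumes "hermitian A d" shows "hermitian B (\<Phi> d)"
proof -
  obtain C where d: "d \<in> acarrier A" and C: "0 \<le> C" "\<And>a t. a \<in> acarrier A \<Longrightarrow>
      anorm A (aadd A a (ascale A (\<i> * of_real t) (amult A d a))) \<le> (1 + C * t\<^sup>2) * anorm A a"
    using assms unfolding hermitian_def by blast
  have "anorm B (aadd B b (ascale B (\<i> * of_real t) (amult B (\<Phi> d) b))) \<le> (1 + C * t\<^sup>2) * anorm B b"
    if b: "b \<in> acarrier B" for b t
  proof -
    obtain a where a: "a \<in> acarrier A" "b = \<Phi> a"
      using \<Phi> b unfolding isometric_alg_iso_def bij_betw_def by blast
    have da: "amult A d a \<in> acarrier A" using iso_closed(2)[OF d a(1)] .
    have sc: "ascale A (\<i> * of_real t) (amult A d a) \<in> acarrier A" using iso_closed(3)[OF da da] .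
    have "aadd B b (ascale B (\<i> * of_real t) (amult B (\<Phi> d) b)) =
        \<Phi> (aadd A a (ascale A (\<i> * of_real t) (amult A d a)))"
      unfolding a(2) iso_hom(1)[OF a(1) sc] iso_hom(3)[OF da da] iso_hom(2)[OF d a(1)] ..
    then show ?thesis
      using C(2)[OF a(1), of t] iso_hom(4)[OF iso_closed(1)[OF a(1) sc] a(1)]
        iso_hom(4)[OF a(1) a(1)] a(2) by simp
  qed
  then show ?thesis unfolding hermitian_def using C(1) iso_hom(5)[OF d d] by blast
qed

lemma hermitian_span_iso:
  assumes "d \<in> hermitian_span A" shows "\<Phi> d \<in> hermitian_span B"
proof -
  obtain h k where hk: "hermitian A h" "hermitian A k" "d = aadd A h (ascale A \<i> k)"
    using assms unfolding hermitian_span_def by blast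
  then have c: "h \<in> acarrier A" "k \<in> acarrier A" by (auto simp: hermitian_def)
  have "\<Phi> d = aadd B (\<Phi> h) (ascale B \<i> (\<Phi> k))"
    using iso_hom(1)[OF c(1) iso_closed(3)[OF c(2) c(2)]] iso_hom(3)[OF c(2) c(2)] hk(3) by simp
  then show ?thesis
    unfolding hermitian_span_def using hermitian_iso hk(1,2) by blast
qed

lemma normalizing_pair_iso:
  assumes "normalizing_pair A a b" shows "normalizing_pair B (\<Phi> a) (\<Phi> b)"
proof -
  have ab: "a \<in> acarrier A" "b \<in> acarrier A"
    using assms by (auto simp: normalizing_pair_def)
  define e f where "e = amult A a b" and "f = amult A b a"
  have c: "e \<in> acarrier A" "f \<in> acarrier A" unfolding e_def f_def using ab iso_closed(2) by blast+
  have *: "anorm A a \<le> 1" "anorm A b \<le> 1" "hermitian A e" "hermitian A f"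
    "amult A e e = e" "amult A f f = f" "amult A e a = a" "amult A f b = b"
    using assms by (auto simp: normalizing_pair_def e_def f_def Let_def)
  have "amult B (\<Phi> a) (\<Phi> b) = \<Phi> e" "amult B (\<Phi> b) (\<Phi> a) = \<Phi> f"
    "amult B (\<Phi> e) (\<Phi> e) = \<Phi> e" "amult B (\<Phi> f) (\<Phi> f) = \<Phi> f"
    "amult B (\<Phi> e) (\<Phi> a) = \<Phi> a" "amult B (\<Phi> f) (\<Phi> b) = \<Phi> b"
    using iso_hom(2)[OF ab] iso_hom(2)[OF ab(2,1)] iso_hom(2)[OF c(1) c(1)] iso_hom(2)[OF c(2) c(2)]
      iso_hom(2)[OF c(1) ab(1)] iso_hom(2)[OF c(2) ab(2)] * unfolding e_def f_def by metis+
  then show ?thesis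
    using *(1,2) hermitian_iso[OF *(3)] hermitian_iso[OF *(4)] iso_hom(4,5)[OF ab(1) ab(1)]
      iso_hom(4,5)[OF ab(2) ab(2)]
    by (simp add: normalizing_pair_def Let_def)
qed

end

definition supp :: "('a \<Rightarrow> complex) \<Rightarrow> 'a set" where
  "supp f = {x. f x \<noteq> 0}"

lemma supp_iff: "x \<in> supp f \<longleftrightarrow> f x \<noteq> 0"
  by (simp add: supp_def)

lemma supp_indicator [simp]: "supp (indicator U) = U"
  by (auto simp: supp_def indicator_def)

text \<open>
  Equality in \<open>1 = \<Sum> p\<^sub>i q\<^sub>i \<le> \<Sum> \<bar>p\<^sub>i\<bar> \<bar>q\<^sub>i\<bar> \<le> \<Sum> \<bar>p\<^sub>i\<bar> \<le> 1\<close> forces a point mass.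
\<close>

lemma dual_point_mass:
  fixes p q :: "'i \<Rightarrow> complex"
  assumes p: "\<And>F. finite F \<Longrightarrow> F \<subseteq> S \<Longrightarrow> (\<Sum>z\<in>F. cmod (p z)) \<le> 1"
    and q: "\<And>F. finite F \<Longrightarrow> F \<subseteq> S \<Longrightarrow> (\<Sum>z\<in>F. cmod (q z)) \<le> 1"
    and one: "(\<Sum>\<^sub>\<infinity>z\<in>S. p z * q z) = 1"
  obtains z where "z \<in> S" "cmod (p z) = 1" "p z * q z = 1"
    "\<And>w. w \<in> S \<Longrightarrow> w \<noteq> z \<Longrightarrow> p w = 0 \<and> q w = 0"
proof -
  have q1: "cmod (q z) \<le> 1" if "z \<in> S" for z using q[of "{z}"] that by simp
  have sp: "(\<lambda>z. cmod (p z)) summable_on S"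
    using p by (rule abs_summable_if_sums_bounded)
  have le: "cmod (p z) * cmod (q z) \<le> cmod (p z)" if "z \<in> S" for z
    using q1[OF that] by (simp add: mult_left_le)
  have spq: "(\<lambda>z. cmod (p z * q z)) summable_on S"
    using le by (intro summable_on_comparison_test[OF sp]) (auto simp: norm_mult)
  have "1 \<le> (\<Sum>\<^sub>\<infinity>z\<in>S. cmod (p z * q z))"
    using norm_infsum_bound[OF spq] one by simp
  moreover have "(\<Sum>\<^sub>\<infinity>z\<in>S. cmod (p z)) \<le> 1" using sp p by (rule infsum_le_finite_sums)
  moreover have "((\<lambda>z. cmod (p z) + - cmod (p z * q z)) has_sum
      ((\<Sum>\<^sub>\<infinity>z\<in>S. cmod (p z)) + - (\<Sum>\<^sub>\<infinity>z\<in>S. cmod (p z * q z)))) S"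
    using sp spq by (intro has_sum_add) (auto simp: has_sum_uminus)
  \<comment> \<open>Here \<open>c\<close> is the sum of |p| minus the sum of |pq|, at most 1 - 1 =
    0. The terms are nonnegative because |q| \<le> 1, so each of them vanishes.\<close>
  ultimately obtain c where c: "((\<lambda>z. cmod (p z) - cmod (p z * q z)) has_sum c) S" "c \<le> 0"
    by fastforce
  have eq: "cmod (p z) = cmod (p z) * cmod (q z)" if "z \<in> S" for z
  proof -
    have "cmod (p z) - cmod (p z * q z) = 0"
      using c le that by (intro nonneg_has_sum_le_0D[OF c(1)]) (auto simp: norm_mult)
    then show ?thesis by (simp add: norm_mult)
  qed
  obtain z where z: "z \<in> S" "p z \<noteq> 0"
  proof -
    have "\<exists>z\<in>S. p z \<noteq> 0"
    proof (rule ccontr)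
      assume "\<not> ?thesis"
      then have "(\<Sum>\<^sub>\<infinity>z\<in>S. p z * q z) = 0" by (intro infsum_0) auto
      then show False using one by simp
    qed
    then show ?thesis using that by blast
  qed
  have qz: "cmod (q z) = 1" using eq[OF z(1)] z(2) by simp
  \<comment> \<open>The point \<open>z\<close> already uses up the whole mass of \<open>q\<close>,
    so \<open>q\<close> vanishes elsewhere, and by \<open>eq\<close> so does
    \<open>p\<close>.\<close>
  have zero: "p w = 0 \<and> q w = 0" if w: "w \<in> S" "w \<noteq> z" for w
  proof -
    have "cmod (q w) + cmod (q z) \<le> 1" using q[of "{w, z}"] w z by simp
    then have "q w = 0" using qz by simp
    then show ?thesis using eq[OF w(1)] by simp
  qed
  have "(\<Sum>\<^sub>\<infinity>z\<in>S. p z * q z) = (\<Sum>\<^sub>\<infinity>w\<in>{z}. p w * q w)"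
    using zero z(1) by (intro infsum_cong_neutral) auto
  then have pq: "p z * q z = 1" using one by simp
  then have "cmod (p z) * cmod (q z) = 1" by (metis norm_mult norm_one)
  then have "cmod (p z) = 1" using qz by simp
  then show ?thesis using that z(1) pq zero by blast
qed

lemma fibre_bounded_cnj: "fibre_bounded G (\<lambda>x. cnj (f x)) C \<longleftrightarrow> fibre_bounded G f C"
  by (simp add: fibre_bounded_def)

section \<open>Elements supported on the units and on compact open bisections\<close>

context hausdorff_ample_groupoid
begin

lemma LF_cnj:
  assumes "f \<in> LF G" shows "(\<lambda>x. cnj (f x)) \<in> LF G"
  unfolding LF_def mem_Collect_eq
proof (intro conjI allI impI)
  fix e :: real assume "0 < e"
  then obtain g where g: "g \<in> Cc_funs G" "fibre_bounded G (\<lambda>x. f x - g x) e"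
    using LF_approx[OF assms] by blast
  obtain K where K: "continuous_map X euclidean g" "compactin X K" "\<And>x. g x \<noteq> 0 \<Longrightarrow> x \<in> K"
    using CcD[OF g(1)] by blast
  have "(\<lambda>x. cnj (g x)) \<in> Cc_funs G"
  proof (rule CcI[OF _ K(2)])
    show "continuous_map X euclidean (\<lambda>x. cnj (g x))"
      using K(1) by (simp add: continuous_map_atin tendsto_cnj)
  qed (use K(3) in auto)
  moreover have "fibre_bounded G (\<lambda>x. cnj (f x) - cnj (g x)) e"
    using g(2) fibre_bounded_cnj[of G "\<lambda>x. f x - g x" e] by simp
  ultimately show "\<exists>g\<in>Cc_funs G. fibre_bounded G (\<lambda>x. cnj (f x) - g x) e"
    by (intro bexI[of _ "\<lambda>x. cnj (g x)"])
qed (use LF_outside[OF assms] in simp)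

lemma LF_indicator: "U \<in> cobs G \<Longrightarrow> indicator U \<in> LF G"
  by (intro LF_Cc Cc_indicator)

lemma fibre_bounded_indicator: "U \<in> cobs G \<Longrightarrow> fibre_bounded G (indicator U) 1"
  by (rule fibre_bounded_bisection[OF cob_bisection]) (auto simp: indicator_def)

lemma unit_cob:
  assumes "openin X W" "u \<in> W" "u \<in> E"
  obtains K where "K \<in> cobs G" "u \<in> K" "K \<subseteq> W" "K \<subseteq> E"
proof -
  have "openin X (W \<inter> E)" "u \<in> W \<inter> E" using assms open_units by auto
  then obtain K where K: "K \<in> cobs G" "u \<in> K" "K \<subseteq> W \<inter> E"
    by (rule cob_basis)
  then have "K \<subseteq> W" "K \<subseteq> E" by simp_all
  with K(1,2) show ?thesis by (rule that)
qed

text \<open>Comparison of orders as t tends to 0, made explicit at t = m / (C + 1); adding 1 covers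
  the case C = 0.\<close>

lemma linear_le_quadratic:
  fixes m :: real assumes "0 \<le> C" "\<And>t. 0 < t \<Longrightarrow> t * m \<le> C * t\<^sup>2" shows "m \<le> 0"
proof (rule ccontr)
  assume "\<not> m \<le> 0"
  then have m: "0 < m" by simp
  define t where "t = m / (C + 1)"
  have t: "0 < t" using m assms(1) by (simp add: t_def)
  have "t * m \<le> t * (C * t)" using assms(2)[OF t] by (simp add: power2_eq_square mult_ac)
  then have "m \<le> C * t" using t by simp
  also have "\<dots> = C * m / (C + 1)" by (simp add: t_def)
  also have "\<dots> < m" using m assms(1) by (simp add: divide_simps algebra_simps)
  finally show False by simp
qed

text \<open>
  Testing on the indicator of a compact open set of units reads off the fibre of \<open>d\<close>; taking
  the real part at the unit gives \<open>- t Im d(u) + \<bar>t\<bar> \<bar>d(x)\<bar> \<le> C t\<^sup>2\<close> for both signs of \<open>t\<close>.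
\<close>

lemma hermitian_unit_supported:
  assumes "hermitian (LF_alg G) d" "x \<notin> E" shows "d x = 0"
proof (cases "x \<in> A")
  case False
  then show ?thesis using assms(1) LF_outside by (auto simp: hermitian_def)
next
  case x: True
  obtain C where d: "d \<in> LF G" and C: "0 \<le> C" "\<And>a t. a \<in> LF G \<Longrightarrow>
      I_norm G (\<lambda>x. a x + \<i> * of_real t * gconvolution G d a x) \<le> (1 + C * t\<^sup>2) * I_norm G a"
    using assms(1) by (auto simp: hermitian_def)
  define u where "u = s x"
  have u: "u \<in> E" "u \<in> A" using x by (auto simp: u_def source_unit)
  obtain K where K: "K \<in> cobs G" "u \<in> K" "K \<subseteq> A" "K \<subseteq> E"
    by (rule unit_cob[OF openin_topspace u(2,1)])
  define a where "a = (indicator K :: 'a \<Rightarrow> complex)"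
  have a: "a \<in> LF G" "fibre_bounded G a 1"
    using LF_indicator[OF K(1)] fibre_bounded_indicator[OF K(1)] by (simp_all add: a_def)
  have aE: "a z = 0" if "z \<notin> E" for z using that K(4) by (auto simp: a_def indicator_def)
  have main: "- (t * Im (d u)) + \<bar>t\<bar> * cmod (d x) \<le> C * t\<^sup>2" for t :: real
  proof -
    define g where "g = (\<lambda>x. a x + \<i> * of_real t * gconvolution G d a x)"
    have g: "g \<in> LF G" unfolding g_def by (intro LF_add LF_scale LF_conv a d)
    have "I_norm G g \<le> (1 + C * t\<^sup>2) * I_norm G a" using C(2)[OF a(1)] by (simp add: g_def)
    also have "\<dots> \<le> (1 + C * t\<^sup>2) * 1"
      using C(1) I_norm_le[OF a(2)] by (intro mult_left_mono) auto
    finally have gb: "fibre_bounded G g (1 + C * t\<^sup>2)"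
      using fibre_bounded_mono[OF LF_I_norm[OF g]] by simp
    \<comment> \<open>Being distinct, \<open>u\<close> and \<open>x\<close> contribute separate
      terms to one source fibre sum: about 1 at \<open>u\<close>, where the test function is 1, and
      |t| |d(x)| at \<open>x\<close>, where it is 0.\<close>
    have "x \<noteq> u" using assms(2) u(1) by metis
    then have sum: "cmod (g u) + cmod (g x) \<le> 1 + C * t\<^sup>2"
      using fibre_bounded_source[OF gb, of "{u, x}" u] x u unit_source[OF u(1)]
      by (simp add: source_fibre_iff u_def)
    have "a u = 1" using K(2) by (simp add: a_def)
    have "gconvolution G d a u = d u * a (s u)" "gconvolution G d a x = d x * a (s x)"
      using conv_unit_right[OF u(2), of a d] conv_unit_right[OF x, of a d] aE by blast+
    then have g_at: "g u = 1 + \<i> * of_real t * d u" "g x = \<i> * of_real t * d x"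
      using \<open>a u = 1\<close> aE[OF assms(2)] unit_source[OF u(1)] u_def by (simp_all add: g_def)
    have "1 - t * Im (d u) \<le> cmod (1 + \<i> * of_real t * d u)"
      using complex_Re_le_cmod[of "1 + \<i> * of_real t * d u"] by simp
    with sum show ?thesis unfolding g_at by (simp add: norm_mult)
  qed
  have "cmod (d x) \<le> 0"
  proof (rule linear_le_quadratic[OF C(1)])
    fix t :: real assume "0 < t"
    then show "t * cmod (d x) \<le> C * t\<^sup>2" using main[of t] main[of "-t"] by simp
  qed
  then show ?thesis by simp
qed

text \<open>The perturbation multiplies values by 1 + i t h(r x), whose squared modulus is 1 + t^2
  h^2 since h is real. With |h| \<le> M, comparison of squares through 1 + y \<le> (1 + y)^2 gives
  the constant M^2.\<close>

lemma real_unit_supported_hermitian: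
  assumes h: "h \<in> LF G" and E: "\<And>x. x \<notin> E \<Longrightarrow> h x = 0" and real: "\<And>x. Im (h x) = 0"
  shows "hermitian (LF_alg G) h"
proof -
  obtain M where M: "fibre_bounded G h M" using LF_fibre_bounded[OF h] by blast
  have "I_norm G (\<lambda>x. a x + \<i> * of_real t * gconvolution G h a x) \<le> (1 + M\<^sup>2 * t\<^sup>2) * I_norm G a"
    if a: "a \<in> LF G" for a t
  proof (intro I_norm_le fibre_bounded_dominated[OF LF_I_norm[OF a]])
    fix x assume x: "x \<in> A"
    have hM: "\<bar>Re (h (r x))\<bar> \<le> M"
      using fibre_bounded_pointwise[OF M range_closed[OF x]] abs_Re_le_cmod order_trans by blast
    have "a x + \<i> * of_real t * gconvolution G h a x = (1 + \<i> * of_real t * h (r x)) * a x"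
      using conv_unit_left[OF x, of h a] E by (simp add: algebra_simps)
    moreover have "cmod (1 + \<i> * of_real t * h (r x)) \<le> 1 + M\<^sup>2 * t\<^sup>2"
    proof -
      have "(Re (h (r x)))\<^sup>2 \<le> M\<^sup>2" using hM by (simp add: abs_le_square_iff[symmetric])
      then have sq: "(t * Re (h (r x)))\<^sup>2 \<le> M\<^sup>2 * t\<^sup>2"
        by (simp add: power_mult_distrib mult.commute[of "M\<^sup>2"] mult_left_mono)
      have "(cmod (1 + \<i> * of_real t * h (r x)))\<^sup>2 = 1 + (t * Re (h (r x)))\<^sup>2"
        using real[of "r x"] by (simp add: cmod_power2)
      also have "\<dots> \<le> (1 + M\<^sup>2 * t\<^sup>2)\<^sup>2"
      proof -
        have "1 + y \<le> (1 + y)\<^sup>2" if "0 \<le> y" for y :: real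
          using that by (simp add: power2_eq_square algebra_simps)
        from this[of "M\<^sup>2 * t\<^sup>2"] show ?thesis using sq by simp
      qed
      finally show ?thesis by (rule power2_le_imp_le) simp
    qed
    ultimately show "cmod (a x + \<i> * of_real t * gconvolution G h a x) \<le> (1 + M\<^sup>2 * t\<^sup>2) * cmod (a x)"
      by (simp add: norm_mult mult_right_mono)
  qed simp
  then show ?thesis
    unfolding hermitian_def using h by (intro conjI exI[of _ "M\<^sup>2"]) auto
qed

text \<open>Since \<open>LF\<close> is closed under pointwise conjugation, the real and imaginary
  parts \<open>h\<close> and \<open>k\<close> of \<open>d\<close> belong to it, and they are real
  and supported on the units.\<close>

lemma hermitian_span_iff:
  "d \<in> hermitian_span (LF_alg G) \<longleftrightarrow> d \<in> LF G \<and> (\<forall>x. x \<notin> E \<longrightarrow> d x = 0)"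
proof
  assume "d \<in> hermitian_span (LF_alg G)"
  then obtain h k where hk: "hermitian (LF_alg G) h" "hermitian (LF_alg G) k" "d = (\<lambda>x. h x + \<i> * k x)"
    unfolding hermitian_span_def by auto
  then have "h \<in> LF G" "k \<in> LF G" by (auto simp: hermitian_def)
  then have "d \<in> LF G" unfolding hk(3) by (intro LF_add LF_scale)
  then show "d \<in> LF G \<and> (\<forall>x. x \<notin> E \<longrightarrow> d x = 0)"
    using hermitian_unit_supported[OF hk(1)] hermitian_unit_supported[OF hk(2)] hk(3) by simp
next
  assume d: "d \<in> LF G \<and> (\<forall>x. x \<notin> E \<longrightarrow> d x = 0)"
  define h k where "h = (\<lambda>x. 1/2 * (d x + cnj (d x)))" and "k = (\<lambda>x. (-\<i>/2) * (d x - cnj (d x)))"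
  have dL: "d \<in> LF G" and dE: "\<And>x. x \<notin> E \<Longrightarrow> d x = 0" using d by simp_all
  have "h \<in> LF G" "k \<in> LF G"
    unfolding h_def k_def by (intro LF_scale LF_add LF_diff LF_cnj dL)+
  from this[THEN real_unit_supported_hermitian]
  have "hermitian (LF_alg G) h" "hermitian (LF_alg G) k"
    by (simp_all add: h_def k_def dE)
  moreover have "d = aadd (LF_alg G) h (ascale (LF_alg G) \<i> k)"
    unfolding LF_alg_simps
  proof
    show "d x = h x + \<i> * k x" for x by (simp add: h_def k_def complex_eq_iff)
  qed
  ultimately show "d \<in> hermitian_span (LF_alg G)" unfolding hermitian_span_def by blast
qed

text \<open>At a unit, convolution pairs the values of \<open>a\<close> on the range fibre with the
  values of \<open>b\<close> on the source fibre, matched by inversion. The range half of the norm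
  bounds the first family and the source half the second, as \<open>dual_point_mass\<close>
  requires.\<close>

lemma conv_point_mass:
  assumes a: "fibre_bounded G a 1" and b: "fibre_bounded G b 1" and u: "u \<in> E"
    and one: "gconvolution G a b u = 1"
  obtains z where "z \<in> A" "r z = u" "cmod (a z) = 1" "a z * b (inv z) = 1"
    "\<forall>w\<in>A. r w = u \<longrightarrow> w \<noteq> z \<longrightarrow> a w = 0 \<and> b (inv w) = 0"
proof -
  have q: "(\<Sum>z\<in>F. cmod (b (inv z))) \<le> 1" if F: "finite F" "F \<subseteq> range_fibre G u" for F
  proof -
    have "(\<Sum>z\<in>F. cmod (b (inv z))) = (\<Sum>y\<in>inv ` F. cmod (b y))"
      using bij_betw_inv_fibre[of u] F(2)
      by (subst sum.reindex) (auto simp: bij_betw_def intro: inj_on_subset)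
    also have "\<dots> \<le> 1"
      using bij_betw_inv_fibre[of u] F
      by (intro fibre_bounded_source[OF b, of _ u]) (auto simp: bij_betw_def)
    finally show ?thesis .
  qed
  have sum1: "(\<Sum>\<^sub>\<infinity>z\<in>range_fibre G u. a z * b (inv z)) = 1"
  proof -
    have "(\<Sum>\<^sub>\<infinity>z\<in>range_fibre G u. a z * b (inv z)) =
        (\<Sum>\<^sub>\<infinity>z\<in>range_fibre G u. a z * b (inv z \<cdot> u))"
    proof (rule infsum_cong)
      fix z assume "z \<in> range_fibre G u"
      then have z: "z \<in> A" "r z = u" by (auto simp: range_fibre_iff)
      then have "inv z \<cdot> u = inv z" using mult_source[of "inv z"] by simp
      then show "a z * b (inv z) = a z * b (inv z \<cdot> u)" by simp
    qed
    also have "\<dots> = 1" using one conv_eq[OF unit_arrow[OF u], of a b] unit_range[OF u] by simp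
    finally show ?thesis .
  qed
  show ?thesis
  proof (rule dual_point_mass[of "range_fibre G u" a "\<lambda>z. b (inv z)", OF _ q sum1])
    show "(\<Sum>z\<in>F. cmod (a z)) \<le> 1" if "finite F" "F \<subseteq> range_fibre G u" for F
      using that by (rule fibre_bounded_range[OF a])
    fix z assume z: "z \<in> range_fibre G u" "cmod (a z) = 1" "a z * b (inv z) = 1"
      "\<And>w. w \<in> range_fibre G u \<Longrightarrow> w \<noteq> z \<Longrightarrow> a w = 0 \<and> b (inv w) = 0"
    show ?thesis
    proof (rule that)
      show "z \<in> A" "r z = u" using z(1) by (simp_all add: range_fibre_iff)
      show "\<forall>w\<in>A. r w = u \<longrightarrow> w \<noteq> z \<longrightarrow> a w = 0 \<and> b (inv w) = 0"
        using z(4) by (simp add: range_fibre_iff)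
    qed (rule z)+
  qed
qed

text \<open>Point masses at the units where the idempotents are 1 make \<open>a\<close> nonzero at
  most once on each range fibre; the pair taken in the other order does the same for source fibres.
  The modulus of \<open>a\<close> then takes only the values 0 and 1, and a uniform approximation by
  a continuous compactly supported function makes the support compact and open.\<close>

lemma normalizing_pair_support:
  assumes "normalizing_pair (LF_alg G) a b"
  shows "supp a \<in> cobs G" "\<And>x. a x \<noteq> 0 \<Longrightarrow> a x * b (inv x) = 1"
    "\<And>x. a x \<noteq> 0 \<Longrightarrow> cmod (a x) = 1"
proof -
  define e f where "e = gconvolution G a b" and "f = gconvolution G b a"
  have ab: "a \<in> LF G" "b \<in> LF G" "I_norm G a \<le> 1" "I_norm G b \<le> 1"
    and herm: "hermitian (LF_alg G) e" "hermitian (LF_alg G) f"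
    and idem: "gconvolution G e e = e" "gconvolution G f f = f"
    and act: "gconvolution G e a = a" "gconvolution G f b = b"
    using assms by (auto simp: normalizing_pair_def e_def f_def Let_def)
  have bd: "fibre_bounded G a 1" "fibre_bounded G b 1"
    using fibre_bounded_mono[OF LF_I_norm] ab by blast+
  have A: "x \<in> A" if "a x \<noteq> 0 \<or> b x \<noteq> 0" for x
    using that LF_outside[OF ab(1)] LF_outside[OF ab(2)] by blast
  \<comment> \<open>A hermitian element lives on the units, so convolving it with itself squares its
    values there.\<close>
  have val: "k u = 1" if "hermitian (LF_alg G) k" "gconvolution G k k = k" "u \<in> E" "k u \<noteq> 0" for k u
  proof -
    have "k u = k u * k u"
      using conv_unit_left[OF unit_arrow[OF that(3)], of k k] hermitian_unit_supported[OF that(1)]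
        that(2) unit_range[OF that(3)] by metis
    then show ?thesis using that(4) by simp
  qed
  have e1: "e (r x) = 1" if "a x \<noteq> 0" for x
  proof (rule val[OF herm(1) idem(1)])
    have x: "x \<in> A" using A that by blast
    then show "r x \<in> E" by (rule range_unit)
    have "a x = e (r x) * a x"
      using conv_unit_left[OF x, of e a] hermitian_unit_supported[OF herm(1)] act(1) by metis
    then show "e (r x) \<noteq> 0" using that by auto
  qed
  have f1: "f (r x) = 1" if "b x \<noteq> 0" for x
  proof (rule val[OF herm(2) idem(2)])
    have x: "x \<in> A" using A that by blast
    then show "r x \<in> E" by (rule range_unit)
    have "b x = f (r x) * b x"
      using conv_unit_left[OF x, of f b] hermitian_unit_supported[OF herm(2)] act(2) by metis
    then show "f (r x) \<noteq> 0" using that by auto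
  qed
  \<comment> \<open>The value 1 of \<open>e\<close> at \<open>r x\<close> concentrates
    \<open>a\<close> in one point of the range fibre; as \<open>a x\<close> is nonzero, that point
    is \<open>x\<close>.\<close>
  have mass: "cmod (a x) = 1 \<and> a x * b (inv x) = 1 \<and> (\<forall>y\<in>A. r y = r x \<longrightarrow> y \<noteq> x \<longrightarrow> a y = 0)"
    if nz: "a x \<noteq> 0" for x
  proof -
    have x: "x \<in> A" using A nz by blast
    obtain z where z: "z \<in> A" "r z = r x" "cmod (a z) = 1" "a z * b (inv z) = 1"
      "\<forall>w\<in>A. r w = r x \<longrightarrow> w \<noteq> z \<longrightarrow> a w = 0 \<and> b (inv w) = 0"
      by (rule conv_point_mass[OF bd range_unit[OF x] e1[OF nz, unfolded e_def]])
    then have "x = z" using nz x by blast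
    then show ?thesis using z(3-5) by blast
  qed
  then show "\<And>x. a x \<noteq> 0 \<Longrightarrow> a x * b (inv x) = 1" "\<And>x. a x \<noteq> 0 \<Longrightarrow> cmod (a x) = 1"
    by blast+
  have "inj_on r (supp a)"
    using mass A by (intro inj_onI) (metis supp_iff)
  moreover have "inj_on s (supp a)"
  proof (rule inj_onI)
    fix x y assume xy: "x \<in> supp a" "y \<in> supp a" "s x = s y"
    have nz: "a x \<noteq> 0" "a y \<noteq> 0" using xy by (simp_all add: supp_iff)
    have x: "x \<in> A" "y \<in> A" "b (inv x) \<noteq> 0" "b (inv y) \<noteq> 0"
      using A[of x] A[of y] mass[OF nz(1)] mass[OF nz(2)] nz by auto
    \<comment> \<open>The same argument with \<open>b\<close> and \<open>a\<close> exchanged, at the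
      common source of \<open>x\<close> and \<open>y\<close>: both inverses have this unit as range
      and \<open>b\<close> is nonzero at both, so they coincide.\<close>
    have "f (r (inv x)) = 1" using f1[OF x(3)] .
    then obtain z where z: "z \<in> A" "r z = r (inv x)" "cmod (b z) = 1" "b z * a (inv z) = 1"
      "\<forall>w\<in>A. r w = r (inv x) \<longrightarrow> w \<noteq> z \<longrightarrow> b w = 0 \<and> a (inv w) = 0"
      unfolding f_def by (rule conv_point_mass[OF bd(2,1) range_unit[OF inv_closed[OF x(1)]]])
    have "r (inv y) = r (inv x)" using x(1,2) xy(3) by simp
    then have "inv x = z" "inv y = z"
      using z(5) x(3,4) inv_closed[OF x(1)] inv_closed[OF x(2)] by blast+
    then have "inv (inv x) = inv (inv y)" by simp
    then show "x = y" using x(1,2) by simp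
  qed
  moreover have "supp a \<subseteq> A" using A by (auto simp: supp_iff)
  ultimately have bis: "bisection G (supp a)" by (simp add: bisection_def)
  \<comment> \<open>An error of 1/3 leaves |g| \<ge> 2/3 on the support and |g| \<le> 1/3 off it.
    The threshold 1/2 lies in the gap, so its strict and non-strict versions cut out the same set,
    which is open by the one and closed by the other.\<close>
  obtain g where g: "g \<in> Cc_funs G" "fibre_bounded G (\<lambda>x. a x - g x) (1/3)"
    using LF_approx[OF ab(1), of "1/3"] by auto
  obtain K where K: "continuous_map X euclidean g" "compactin X K" "\<And>x. g x \<noteq> 0 \<Longrightarrow> x \<in> K"
    using CcD[OF g(1)] by blast
  have close: "cmod (a x - g x) \<le> 1/3" if "x \<in> A" for x
    using fibre_bounded_pointwise[OF g(2) that] .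
  have big: "2/3 \<le> cmod (g x)" if "x \<in> A" "a x \<noteq> 0" for x
    using close[OF that(1)] mass[OF that(2)] norm_triangle_ineq2[of "a x" "g x"] by simp
  have small: "cmod (g x) \<le> 1/3" if "x \<in> A" "a x = 0" for x
    using close[OF that(1)] that(2) by simp
  have gap: "x \<in> supp a \<longleftrightarrow> 1/2 < cmod (g x)" "x \<in> supp a \<longleftrightarrow> 1/2 \<le> cmod (g x)"
    if "x \<in> A" for x
    using big[OF that] small[OF that] by (cases "a x = 0"; simp add: supp_def)+
  have supp_eq: "supp a = {x \<in> A. g x \<in> {z. 1/2 < cmod z}}" "supp a = {x \<in> A. g x \<in> {z. 1/2 \<le> cmod z}}"
    using gap \<open>supp a \<subseteq> A\<close> by (simp_all only: mem_Collect_eq set_eq_iff) blast+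
  have "openin X {x \<in> A. g x \<in> {z. 1/2 < cmod z}}"
    by (rule openin_continuous_map_preimage[OF K(1)])
      (simp add: open_Collect_less continuous_intros)
  then have op: "openin X (supp a)" by (simp only: supp_eq(1))
  have "closedin X {x \<in> A. g x \<in> {z. 1/2 \<le> cmod z}}"
    by (rule closedin_continuous_map_preimage[OF K(1)])
      (simp add: closed_Collect_le continuous_intros)
  then have cl: "closedin X (supp a)" by (simp only: supp_eq(2))
  have "supp a \<subseteq> K"
  proof
    fix x assume "x \<in> supp a"
    then have "1/2 < cmod (g x)" using gap(1) \<open>supp a \<subseteq> A\<close> by blast
    then have "g x \<noteq> 0" by (cases "g x = 0") auto
    then show "x \<in> K" by (rule K(3))
  qed
  then have "compactin X (supp a)" using cl by (rule closed_compactin[OF K(2)])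
  then show "supp a \<in> cobs G" using bis op by (simp add: cobs_def)
qed

text \<open>No cancellation can occur: the range of a product determines its left factor in the
  bisection, so the convolution sum has a single term.\<close>

lemma supp_conv:
  assumes U: "supp f \<in> cobs G" and g: "supp g \<subseteq> A"
  shows "supp (gconvolution G f g) = set_mult (supp f) (supp g)"
proof (intro set_eqI iffI)
  note iff = set_mult_iff[OF cob_subset[OF U] g]
  have f0: "\<And>x. x \<notin> supp f \<Longrightarrow> f x = 0" by (simp add: supp_def)
  {
    fix x assume "x \<in> supp (gconvolution G f g)"
    then have nz: "gconvolution G f g x \<noteq> 0" by (simp add: supp_def)
    then have x: "x \<in> A" using conv_outside[of x f g] by metis
    define y where "y = sect (supp f) (r x)"
    have rx: "r x \<in> r ` supp f" and fg: "f y * g (inv y \<cdot> x) \<noteq> 0"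
      using nz conv_bisection[of "supp f" f x g, OF U f0 x] unfolding y_def
      by (auto split: if_splits)
    have y: "y \<in> supp f" "r y = r x"
      unfolding y_def using sect_in[OF U rx] range_sect[OF U rx] .
    have gy: "inv y \<cdot> x \<in> supp g" using fg by (simp add: supp_def)
    have "y \<in> A" using cob_arrow[OF U y(1)] .
    then have "s y = r (inv y \<cdot> x)" "x = y \<cdot> (inv y \<cdot> x)" using x y(2) by simp_all
    then show "x \<in> set_mult (supp f) (supp g)"
      unfolding iff using y(1) gy by blast
  next
    fix x assume "x \<in> set_mult (supp f) (supp g)"
    then obtain y z where yz: "y \<in> supp f" "z \<in> supp g" "s y = r z" "x = y \<cdot> z"
      unfolding iff by blast
    have A: "y \<in> A" "z \<in> A" using cob_arrow[OF U yz(1)] g yz(2) by blast+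
    have x: "x \<in> A" "r x = r y" "inv y \<cdot> x = z" using A yz(3,4) mult_closed[of y z] by simp_all
    have "gconvolution G f g x = f y * g z"
      using conv_bisection[of "supp f" f x g, OF U f0 x(1)] sect_range[OF U yz(1)] x(2,3) yz(1)
      by simp
    then show "x \<in> supp (gconvolution G f g)" using yz(1,2) by (simp add: supp_def)
  }
qed

text \<open>With at most one term per sum and factors 0 or 1, the convolution takes only these two
  values and is determined by its support.\<close>

lemma conv_indicator:
  assumes U: "U \<in> cobs G" and V: "V \<in> cobs G"
  shows "gconvolution G (indicator U) (indicator V) = indicator (set_mult U V)"
proof
  fix x
  have "gconvolution G (indicator U) (indicator V) x \<in> {0, 1}"
  proof (cases "x \<in> A")
    case True
    then show ?thesis
      using conv_bisection[OF U _ True, of "indicator U" "indicator V"] by (auto simp: indicator_def)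
  qed (simp add: conv_outside)
  moreover have "gconvolution G (indicator U) (indicator V) x \<noteq> 0 \<longleftrightarrow> x \<in> set_mult U V"
    using supp_conv[of "indicator U" "indicator V"] U cob_subset[OF V]
    unfolding supp_iff[symmetric] by simp
  ultimately show "gconvolution G (indicator U) (indicator V) x = indicator (set_mult U V) x"
    by (auto simp: indicator_def)
qed

text \<open>Openness is read off from the algebra: the indicator of the product is a convolution of
  functions in \<open>Cc_funs G\<close>, hence continuous.\<close>

lemma cob_set_mult:
  assumes U: "U \<in> cobs G" and V: "V \<in> cobs G"
  shows "set_mult U V \<in> cobs G"
proof -
  note iff = set_mult_iff[OF cob_subset[OF U] cob_subset[OF V]]
  have "indicator (set_mult U V) \<in> Cc_funs G"
    using Cc_conv[OF Cc_indicator[OF U] Cc_indicator[OF V]] conv_indicator[OF U V] by simp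
  then have "continuous_map X euclidean (indicator (set_mult U V) :: 'a \<Rightarrow> complex)"
    using CcD by blast
  then have "openin X {x \<in> A. (indicator (set_mult U V) x :: complex) \<in> - {0}}"
    by (rule openin_continuous_map_preimage) auto
  moreover have sub: "set_mult U V \<subseteq> A"
    using compactin_subset_topspace[OF compact_set_mult[OF cob_compact[OF U] cob_compact[OF V]]] .
  then have "{x \<in> A. (indicator (set_mult U V) x :: complex) \<in> - {0}} = set_mult U V"
    by (auto simp: indicator_def)
  ultimately have "openin X (set_mult U V)" by simp
  moreover have "bisection G (set_mult U V)"
    unfolding bisection_def
  proof (intro conjI inj_onI sub)
    fix z z' assume "z \<in> set_mult U V" "z' \<in> set_mult U V"
    then obtain x y x' y' where *: "x \<in> U" "y \<in> V" "s x = r y" "z = x \<cdot> y"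
      "x' \<in> U" "y' \<in> V" "s x' = r y'" "z' = x' \<cdot> y'"
      unfolding iff by blast
    have A: "x \<in> A" "x' \<in> A" "y \<in> A" "y' \<in> A"
      using * cob_subset[OF U] cob_subset[OF V] by blast+
    show "z = z'" if "s z = s z'"
    proof -
      have "s y = s y'" using that A *(3,4,7,8) by simp
      then have "y = y'" using inj_onD[OF cob_inj_source[OF V]] *(2,6) by blast
      then have "x = x'" using inj_onD[OF cob_inj_source[OF U]] *(1,3,5,7) by metis
      then show ?thesis using \<open>y = y'\<close> * by simp
    qed
    show "z = z'" if "r z = r z'"
    proof -
      have "r x = r x'" using that A *(3,4,7,8) by simp
      then have "x = x'" using inj_onD[OF cob_inj_range[OF U]] *(1,5) by blast
      then have "y = y'" using inj_onD[OF cob_inj_range[OF V]] *(2,3,6,7) by metis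
      then show ?thesis using \<open>x = x'\<close> * by simp
    qed
  qed
  ultimately show ?thesis
    using compact_set_mult[OF cob_compact[OF U] cob_compact[OF V]] by (simp add: cobs_def)
qed

lemma conv_indicator_units:
  assumes "K \<subseteq> E" "U \<subseteq> A" "r ` U \<subseteq> K"
  shows "gconvolution G (indicator K) (indicator U) = indicator U"
proof
  fix x show "gconvolution G (indicator K) (indicator U) x = indicator U x"
  proof (cases "x \<in> A")
    case True
    have "gconvolution G (indicator K) (indicator U) x = indicator K (r x) * indicator U x"
      using assms(1) by (intro conv_unit_left[OF True]) (auto simp: indicator_def)
    then show ?thesis using assms(3) by (auto simp: indicator_def)
  next
    case False
    then show ?thesis using assms(2) by (auto simp: conv_outside indicator_def)
  qed
qed

lemma set_mult_inv:
  assumes U: "U \<in> cobs G" shows "set_mult U (inv ` U) = r ` U"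
proof (intro set_eqI iffI)
  note iff = set_mult_iff[OF cob_subset[OF U] cob_subset[OF cob_inv_image[OF U]]]
  {
    fix z assume "z \<in> set_mult U (inv ` U)"
    then obtain x y where *: "x \<in> U" "y \<in> U" "s x = r (inv y)" "z = x \<cdot> inv y"
      unfolding iff by blast
    have A: "x \<in> A" "y \<in> A" using * cob_subset[OF U] by blast+
    then have "x = y" using inj_onD[OF cob_inj_source[OF U]] *(1-3) by simp
    then show "z \<in> r ` U" using * A by simp
  next
    fix z assume "z \<in> r ` U"
    then obtain x where x: "x \<in> U" "z = r x" by blast
    have "x \<in> A" using x(1) cob_subset[OF U] by blast
    then have "s x = r (inv x)" "z = x \<cdot> inv x" using x(2) by simp_all
    then show "z \<in> set_mult U (inv ` U)" unfolding iff using x(1) by blast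
  }
qed

lemma inv_image_inv_image:
  assumes "U \<subseteq> A" shows "inv ` inv ` U = U"
proof -
  have "inv (inv x) = x" if "x \<in> U" for x using assms that by auto
  then show ?thesis by (simp add: image_image)
qed

lemma hermitian_indicator:
  assumes "K \<in> cobs G" "K \<subseteq> E" shows "hermitian (LF_alg G) (indicator K)"
  by (rule real_unit_supported_hermitian[OF LF_indicator[OF assms(1)]])
    (use assms(2) in \<open>auto simp: indicator_def\<close>)

text \<open>The idempotents of this pair are the indicators of the sets of ranges and of sources of
  \<open>U\<close>. Thus every compact open bisection occurs as the support of a normalizing
  pair.\<close>

lemma normalizing_pair_indicator:
  assumes U: "U \<in> cobs G"
  shows "normalizing_pair (LF_alg G) (indicator U) (indicator (inv ` U))"
proof -
  let ?V = "inv ` U"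
  have V: "?V \<in> cobs G" by (rule cob_inv_image[OF U])
  have e: "gconvolution G (indicator U) (indicator ?V) = indicator (r ` U)"
    unfolding conv_indicator[OF U V] set_mult_inv[OF U] ..
  have f: "gconvolution G (indicator ?V) (indicator U) = indicator (r ` ?V)"
    using conv_indicator[OF V U] set_mult_inv[OF V] inv_image_inv_image[OF cob_subset[OF U]] by simp
  have idem: "gconvolution G (indicator (r ` W)) (indicator (r ` W)) = indicator (r ` W)"
    "gconvolution G (indicator (r ` W)) (indicator W) = indicator W"
    "hermitian (LF_alg G) (indicator (r ` W))" "I_norm G (indicator W) \<le> 1" if W: "W \<in> cobs G" for W
  proof -
    have E: "r ` W \<subseteq> E" by (rule cob_range_image_units[OF W])
    then have "r ` r ` W \<subseteq> r ` W" using unit_range by fastforce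
    then show "gconvolution G (indicator (r ` W)) (indicator (r ` W)) = indicator (r ` W)"
      using E units_subset by (intro conv_indicator_units) auto
    show "gconvolution G (indicator (r ` W)) (indicator W) = indicator W"
      using E cob_subset[OF W] by (intro conv_indicator_units) auto
    show "hermitian (LF_alg G) (indicator (r ` W))"
      by (rule hermitian_indicator[OF cob_range_image[OF W] E])
    show "I_norm G (indicator W) \<le> 1" by (rule I_norm_le[OF fibre_bounded_indicator[OF W]])
  qed
  show ?thesis
    using idem[OF U] idem[OF V] LF_indicator[OF U] LF_indicator[OF V]
    by (simp add: normalizing_pair_def e f Let_def)
qed

end

subsection \<open>Homeomorphisms from isomorphisms of compact open bases\<close>

locale compact_open_base =
  fixes X :: "'a topology" and B :: "'a set set"
  assumes base_hausdorff: "Hausdorff_space X"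
    and base_open: "\<And>U. U \<in> B \<Longrightarrow> openin X U"
    and base_compact: "\<And>U. U \<in> B \<Longrightarrow> compactin X U"
    and base_Int: "\<And>U V. U \<in> B \<Longrightarrow> V \<in> B \<Longrightarrow> U \<inter> V \<in> B"
    and base_Diff: "\<And>U V. U \<in> B \<Longrightarrow> V \<in> B \<Longrightarrow> U - V \<in> B"
    and base_basis: "\<And>W x. openin X W \<Longrightarrow> x \<in> W \<Longrightarrow> \<exists>U\<in>B. x \<in> U \<and> U \<subseteq> W"
begin

lemma base_cover: "x \<in> topspace X \<Longrightarrow> \<exists>U\<in>B. x \<in> U"
  using base_basis[OF openin_topspace] by blast

lemma base_separates:
  assumes "x \<in> topspace X" "y \<in> topspace X" "x \<noteq> y"
  shows "\<exists>U\<in>B. x \<in> U \<and> y \<notin> U"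
proof -
  obtain V W where "openin X V" "openin X W" "x \<in> V" "y \<in> W" "disjnt V W"
    using base_hausdorff assms unfolding Hausdorff_space_def by blast
  then show ?thesis using base_basis[of V x] by (auto simp: disjnt_def)
qed

lemma base_finite_Int:
  assumes "finite \<F>" "\<F> \<subseteq> B" "U \<in> B" shows "U \<inter> \<Inter>\<F> \<in> B"
  using assms
proof (induction \<F> rule: finite_induct)
  case (insert V \<F>)
  then have "V \<in> B" "U \<inter> \<Inter>\<F> \<in> B" by simp_all
  then have "V \<inter> (U \<inter> \<Inter>\<F>) \<in> B" by (rule base_Int)
  then show ?case by (simp add: Int_left_commute)
qed simp

end

locale base_iso = X: compact_open_base X B + Y: compact_open_base Y C
  for X :: "'a topology" and B and Y :: "'b topology" and C +
  fixes \<theta> :: "'a set \<Rightarrow> 'b set" and \<theta>' :: "'b set \<Rightarrow> 'a set"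
  assumes \<theta>: "\<And>U. U \<in> B \<Longrightarrow> \<theta> U \<in> C" and \<theta>': "\<And>V. V \<in> C \<Longrightarrow> \<theta>' V \<in> B"
    and \<theta>'\<theta>: "\<And>U. U \<in> B \<Longrightarrow> \<theta>' (\<theta> U) = U" and \<theta>\<theta>': "\<And>V. V \<in> C \<Longrightarrow> \<theta> (\<theta>' V) = V"
    and mono: "\<And>U V. U \<in> B \<Longrightarrow> V \<in> B \<Longrightarrow> U \<subseteq> V \<Longrightarrow> \<theta> U \<subseteq> \<theta> V"
    and mono': "\<And>U V. U \<in> C \<Longrightarrow> V \<in> C \<Longrightarrow> U \<subseteq> V \<Longrightarrow> \<theta>' U \<subseteq> \<theta>' V"
begin

lemma swap: "base_iso Y C X B \<theta>' \<theta>"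
  by unfold_locales (fact \<theta> \<theta>' \<theta>'\<theta> \<theta>\<theta>' mono mono')+

lemma image_empty:
  assumes "{} \<in> B" shows "\<theta> {} = {}"
proof -
  have "\<theta> {} - \<theta> {} \<in> C" using assms by (intro Y.base_Diff \<theta>)
  then have V: "{} \<in> C" by simp
  have "\<theta> {} \<subseteq> \<theta> (\<theta>' {})" using assms V by (intro mono \<theta>') auto
  then show ?thesis using \<theta>\<theta>'[OF V] by simp
qed

text \<open>Disjointness is order-theoretic: the common part of the images pulls back to a set below
  both \<open>U\<close> and \<open>V\<close>.\<close>

lemma disjoint:
  assumes "U \<in> B" "V \<in> B" "U \<inter> V = {}" shows "\<theta> U \<inter> \<theta> V = {}"
proof -
  let ?W = "\<theta> U \<inter> \<theta> V"
  have W: "?W \<in> C" by (intro Y.base_Int \<theta> assms)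
  have "\<theta>' ?W \<subseteq> \<theta>' (\<theta> U)" "\<theta>' ?W \<subseteq> \<theta>' (\<theta> V)"
    using mono'[OF W \<theta>[OF assms(1)]] mono'[OF W \<theta>[OF assms(2)]] by simp_all
  then have "\<theta>' ?W \<subseteq> U \<inter> V" unfolding \<theta>'\<theta>[OF assms(1)] \<theta>'\<theta>[OF assms(2)] by simp
  then have "\<theta>' ?W = {}" using assms(3) by simp
  then show ?thesis using image_empty \<theta>'[OF W] \<theta>\<theta>'[OF W] by simp
qed

text \<open>The images of the basic neighbourhoods of \<open>x\<close> are closed and, together with
  one compact image, have the finite intersection property. Any common point is the \<open>y\<close>
  sought.\<close>

lemma point_exists:
  assumes x: "x \<in> topspace X"
  shows "\<exists>y\<in>topspace Y. \<forall>U\<in>B. x \<in> U \<longleftrightarrow> y \<in> \<theta> U"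
proof -
  obtain U\<^sub>0 where U0: "U\<^sub>0 \<in> B" "x \<in> U\<^sub>0" using X.base_cover[OF x] by blast
  let ?N = "\<theta> ` {U \<in> B. x \<in> U}"
  have fip: "\<theta> U\<^sub>0 \<inter> \<Inter>\<F> \<noteq> {}" if F: "finite \<F>" "\<F> \<subseteq> ?N" for \<F>
  proof -
    obtain \<G> where G: "\<G> \<subseteq> {U \<in> B. x \<in> U}" "finite \<G>" "\<F> = \<theta> ` \<G>"
      using finite_subset_image[OF F] by blast
    let ?V = "U\<^sub>0 \<inter> \<Inter>\<G>"
    have V: "?V \<in> B" using X.base_finite_Int G U0 by blast
    have "x \<in> ?V" using G U0 by blast
    have e: "{} \<in> B" using X.base_Diff[OF V V] by simp
    have "\<theta> ?V \<noteq> {}"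
      using \<theta>'\<theta>[OF V] \<theta>'\<theta>[OF e] image_empty[OF e] \<open>x \<in> ?V\<close> by (metis empty_iff)
    moreover have "\<theta> ?V \<subseteq> \<theta> U" if "U \<in> insert U\<^sub>0 \<G>" for U
      using V G(1) U0 that by (intro mono) auto
    ultimately show ?thesis unfolding G(3) by blast
  qed
  have "\<forall>V\<in>?N. closedin Y V"
    using compactin_imp_closedin[OF Y.base_hausdorff Y.base_compact[OF \<theta>]] by blast
  then have "\<theta> U\<^sub>0 \<inter> \<Inter>?N \<noteq> {}"
    using Y.base_compact[OF \<theta>[OF U0(1)]] fip unfolding compactin_fip by simp
  then obtain y where y: "y \<in> \<theta> U\<^sub>0" "\<And>U. U \<in> B \<Longrightarrow> x \<in> U \<Longrightarrow> y \<in> \<theta> U" by blast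
  \<comment> \<open>If \<open>x\<close> were outside \<open>U\<close>, it would lie in the
    difference of \<open>U\<^sub>0\<close> and \<open>U\<close>, whose image contains
    \<open>y\<close> but is disjoint from that of \<open>U\<close>.\<close>
  have "x \<in> U" if U: "U \<in> B" "y \<in> \<theta> U" for U
  proof (rule ccontr)
    assume "x \<notin> U"
    then have "y \<in> \<theta> (U\<^sub>0 - U)" using y(2)[OF X.base_Diff[OF U0(1) U(1)]] U0(2) by blast
    moreover have "\<theta> (U\<^sub>0 - U) \<inter> \<theta> U = {}"
      by (rule disjoint[OF X.base_Diff[OF U0(1) U(1)] U(1)]) blast
    ultimately show False using U(2) by blast
  qed
  moreover have "y \<in> topspace Y"
    using y(1) openin_subset[OF Y.base_open[OF \<theta>[OF U0(1)]]] by blast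
  ultimately show ?thesis using y(2) by blast
qed

lemma point_unique:
  assumes y: "y \<in> topspace Y" "y' \<in> topspace Y"
    and mem: "\<And>U. U \<in> B \<Longrightarrow> y \<in> \<theta> U \<Longrightarrow> y' \<in> \<theta> U"
  shows "y = y'"
proof (rule ccontr)
  assume "y \<noteq> y'"
  then obtain V where V: "V \<in> C" "y \<in> V" "y' \<notin> V" using Y.base_separates[OF y] by blast
  then show False using mem[OF \<theta>'[OF V(1)]] \<theta>\<theta>'[OF V(1)] by simp
qed

lemma homeomorphism_exists:
  obtains \<phi> where "homeomorphic_map X Y \<phi>"
    "\<And>x U. x \<in> topspace X \<Longrightarrow> U \<in> B \<Longrightarrow> x \<in> U \<longleftrightarrow> \<phi> x \<in> \<theta> U"
proof -
  interpret inv: base_iso Y C X B \<theta>' \<theta> by (rule swap)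
  obtain \<phi> where \<phi>: "\<And>x. x \<in> topspace X \<Longrightarrow> \<phi> x \<in> topspace Y"
    "\<And>x U. x \<in> topspace X \<Longrightarrow> U \<in> B \<Longrightarrow> x \<in> U \<longleftrightarrow> \<phi> x \<in> \<theta> U"
    using point_exists by metis
  obtain \<psi> where \<psi>: "\<And>y. y \<in> topspace Y \<Longrightarrow> \<psi> y \<in> topspace X"
    "\<And>y V. y \<in> topspace Y \<Longrightarrow> V \<in> C \<Longrightarrow> y \<in> V \<longleftrightarrow> \<psi> y \<in> \<theta>' V"
    using inv.point_exists by metis
  have \<psi>\<phi>: "\<psi> (\<phi> x) = x" if x: "x \<in> topspace X" for x
  proof (rule inv.point_unique[OF \<psi>(1)[OF \<phi>(1)[OF x]] x])
    fix V assume V: "V \<in> C" "\<psi> (\<phi> x) \<in> \<theta>' V"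
    then have "\<phi> x \<in> \<theta> (\<theta>' V)" using \<psi>(2)[OF \<phi>(1)[OF x] V(1)] \<theta>\<theta>' by simp
    then show "x \<in> \<theta>' V" using \<phi>(2)[OF x \<theta>'[OF V(1)]] by simp
  qed
  have \<phi>\<psi>: "\<phi> (\<psi> y) = y" if y: "y \<in> topspace Y" for y
  proof (rule point_unique[OF \<phi>(1)[OF \<psi>(1)[OF y]] y])
    fix U assume U: "U \<in> B" "\<phi> (\<psi> y) \<in> \<theta> U"
    then have "\<psi> y \<in> \<theta>' (\<theta> U)" using \<phi>(2)[OF \<psi>(1)[OF y] U(1)] \<theta>'\<theta> by simp
    then show "y \<in> \<theta> U" using \<psi>(2)[OF y \<theta>[OF U(1)]] by simp
  qed
  have "openin X {x \<in> topspace X. \<phi> x \<in> W}" if W: "openin Y W" for W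
  proof (subst openin_subopen, intro ballI)
    fix x assume "x \<in> {x \<in> topspace X. \<phi> x \<in> W}"
    then obtain V where V: "V \<in> C" "\<phi> x \<in> V" "V \<subseteq> W" and x: "x \<in> topspace X"
      using Y.base_basis[OF W] by blast
    \<comment> \<open>The preimage of a basic set \<open>V\<close> is \<open>\<theta>' V\<close>,
      which is open; this is the whole of continuity.\<close>
    have mem: "z \<in> \<theta>' V \<longleftrightarrow> \<phi> z \<in> V" if "z \<in> topspace X" for z
      using \<phi>(2)[OF that \<theta>'[OF V(1)]] \<theta>\<theta>'[OF V(1)] by simp
    have op: "openin X (\<theta>' V)" by (rule X.base_open[OF \<theta>'[OF V(1)]])
    then have "\<theta>' V \<subseteq> {x \<in> topspace X. \<phi> x \<in> W}" using mem V(3) openin_subset[OF op] by blast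
    then show "\<exists>T. openin X T \<and> x \<in> T \<and> T \<subseteq> {x \<in> topspace X. \<phi> x \<in> W}"
      using op mem[OF x] V(2) by blast
  qed
  then have cont: "continuous_map X Y \<phi>" using \<phi>(1) by (auto simp: continuous_map_def)
  have "openin Y {y \<in> topspace Y. \<psi> y \<in> W}" if W: "openin X W" for W
  proof (subst openin_subopen, intro ballI)
    fix y assume "y \<in> {y \<in> topspace Y. \<psi> y \<in> W}"
    then obtain U where U: "U \<in> B" "\<psi> y \<in> U" "U \<subseteq> W" and y: "y \<in> topspace Y"
      using X.base_basis[OF W] by blast
    have mem: "z \<in> \<theta> U \<longleftrightarrow> \<psi> z \<in> U" if "z \<in> topspace Y" for z
      using \<psi>(2)[OF that \<theta>[OF U(1)]] \<theta>'\<theta>[OF U(1)] by simp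
    have op: "openin Y (\<theta> U)" by (rule Y.base_open[OF \<theta>[OF U(1)]])
    then have "\<theta> U \<subseteq> {y \<in> topspace Y. \<psi> y \<in> W}" using mem U(3) openin_subset[OF op] by blast
    then show "\<exists>T. openin Y T \<and> y \<in> T \<and> T \<subseteq> {y \<in> topspace Y. \<psi> y \<in> W}"
      using op mem[OF y] U(2) by blast
  qed
  then have "continuous_map Y X \<psi>" using \<psi>(1) by (auto simp: continuous_map_def)
  then have "homeomorphic_maps X Y \<phi> \<psi>"
    using cont \<psi>\<phi> \<phi>\<psi> by (simp add: homeomorphic_maps_def)
  then have "homeomorphic_map X Y \<phi>" using homeomorphic_map_maps by blast
  then show ?thesis using \<phi>(2) by (rule that)
qed

end

context hausdorff_ample_groupoid
begin

lemma compact_open_base_cobs: "compact_open_base X (cobs G)"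
proof
  show "\<exists>U\<in>cobs G. x \<in> U \<and> U \<subseteq> W" if W: "openin X W" "x \<in> W" for W x
    by (rule cob_basis[OF W]) (rule bexI, rule conjI)
qed (fact hausdorff cob_open cob_compact cob_Int cob_Diff)+

section \<open>Supports and phases of normalizing pairs\<close>

lemma normalizing_pair_sym: "normalizing_pair (LF_alg G) a b \<Longrightarrow> normalizing_pair (LF_alg G) b a"
  by (auto simp: normalizing_pair_def Let_def)

text \<open>Multiplication by \<open>d\<close> is pointwise multiplication by d(r x). Inclusion of
  supports can thus be witnessed by an element of the span, and such a witness is carried along by
  any isometric isomorphism.\<close>

lemma supp_hermitian_span_conv:
  assumes d: "d \<in> hermitian_span (LF_alg G)"
  shows "supp (gconvolution G d f) \<subseteq> supp f"
proof
  fix x assume x: "x \<in> supp (gconvolution G d f)"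
  then have "x \<in> A" using conv_outside[of x d f] by (auto simp: supp_iff)
  moreover have "\<And>z. z \<notin> E \<Longrightarrow> d z = 0" using d hermitian_span_iff by blast
  ultimately have "gconvolution G d f x = d (r x) * f x" by (rule conv_unit_left)
  then show "x \<in> supp f" using x by (auto simp: supp_iff)
qed

text \<open>
  So \<open>a\<close> and the indicator of its support differ by factors that any isometric isomorphism
  sends to functions supported on units, and therefore have images with the same support.
\<close>

lemma indicator_twist:
  assumes ab: "normalizing_pair (LF_alg G) a b"
  obtains g g' where "g \<in> hermitian_span (LF_alg G)" "g' \<in> hermitian_span (LF_alg G)"
    "gconvolution G g a = indicator (supp a)" "gconvolution G g' (indicator (supp a)) = a"
proof -
  let ?V = "supp a"
  have V: "?V \<in> cobs G" using normalizing_pair_support(1)[OF ab] .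
  note sub = cob_subset[OF V]
  have LF: "a \<in> LF G" "b \<in> LF G" using ab by (auto simp: normalizing_pair_def)
  have ind0: "\<And>x. x \<notin> ?V \<Longrightarrow> indicator ?V x = (0::complex)" by (simp add: indicator_def)
  \<comment> \<open>For \<open>x\<close> in the support, g(r x) = b(x^{-1}) = 1/a(x), so
    \<open>g\<close> cancels the phase of \<open>a\<close>. The conjugate of \<open>g\<close>
    restores it because |a| = 1 there.\<close>
  define g where "g = gconvolution G (indicator ?V) b"
  have gL: "g \<in> LF G" unfolding g_def by (intro LF_conv LF_indicator V LF)
  have gE: "g x = 0" if xE: "x \<notin> E" for x
  proof (rule ccontr)
    assume nz: "g x \<noteq> 0"
    then have x: "x \<in> A" using conv_outside unfolding g_def by metis
    define y where "y = sect ?V (r x)"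
    have rx: "r x \<in> r ` ?V" and bz: "b (inv y \<cdot> x) \<noteq> 0"
      using nz conv_bisection[of ?V "indicator ?V" x b, OF V ind0 x]
      unfolding g_def y_def by (auto split: if_splits)
    have y: "y \<in> ?V" "r y = r x"
      unfolding y_def using sect_in[OF V rx] range_sect[OF V rx] .
    have yA: "y \<in> A" using sub y(1) by blast
    have z: "inv y \<cdot> x \<in> A" using mult_closed[of "inv y" x] x y yA by simp
    have "b (inv y \<cdot> x) * a (inv (inv y \<cdot> x)) = 1"
      using normalizing_pair_support(2)[OF normalizing_pair_sym[OF ab] bz] .
    then have "a (inv (inv y \<cdot> x)) \<noteq> 0" by auto
    then have mem: "inv (inv y \<cdot> x) \<in> ?V" by (simp add: supp_iff)
    have eq: "inv (inv y \<cdot> x) = inv x \<cdot> y" using inv_mult[of "inv y" x] x y(2) yA by simp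
    \<comment> \<open>Both \<open>inv x \<cdot> y\<close> and \<open>y\<close> lie in the bisection
      and have the same source, hence agree. Cancelling \<open>y\<close> makes \<open>x\<close> a
      unit, a contradiction.\<close>
    have "s (inv x \<cdot> y) = s y" using x y(2) yA by simp
    then have "inv x \<cdot> y = y"
      using inj_onD[OF cob_inj_source[OF V]] mem y(1) unfolding eq by blast
    then have "inv x = y \<cdot> inv y"
      using mult_inv_cancel[of "inv x" y] x y(2) yA by simp
    then have "inv x = r x" using yA y(2) by simp
    then have "x = inv (r x)" using x by (metis inv_inv)
    then show False using xE range_unit[OF x] by simp
  qed
  have g_at: "g (r x) = b (inv x)" if x: "x \<in> ?V" for x
  proof -
    have xA: "x \<in> A" using sub x by blast
    have "inv x \<cdot> r x = inv x" using mult_source[of "inv x"] xA by simp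
    then show ?thesis
      using conv_bisection[of ?V "indicator ?V" "r x" b, OF V ind0 range_closed[OF xA]]
        sect_range[OF V x] x xA unfolding g_def by simp
  qed
  have g: "g \<in> hermitian_span (LF_alg G)" using hermitian_span_iff gL gE by blast
  define g' where "g' = (\<lambda>x. cnj (g x))"
  have g': "g' \<in> hermitian_span (LF_alg G)"
    using hermitian_span_iff[of g'] LF_cnj[OF gL] gE by (simp add: g'_def)
  have eq1: "gconvolution G g a x = indicator ?V x" for x
  proof (cases "x \<in> A")
    case True
    have "gconvolution G g a x = g (r x) * a x" using True gE by (rule conv_unit_left)
    then show ?thesis
      using g_at[of x] normalizing_pair_support(2)[OF ab, of x]
      by (cases "a x = 0") (simp_all add: supp_iff mult.commute indicator_def)
  next
    case False
    then show ?thesis using conv_outside[OF False] sub by (auto simp: indicator_def)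
  qed
  have eq2: "gconvolution G g' (indicator ?V) x = a x" for x
  proof (cases "x \<in> A")
    case True
    have g'E: "\<And>z. z \<notin> E \<Longrightarrow> g' z = 0" using gE by (simp add: g'_def)
    have "gconvolution G g' (indicator ?V) x = g' (r x) * indicator ?V x"
      using True g'E by (rule conv_unit_left)
    moreover have "cnj (b (inv x)) = a x" if nz: "a x \<noteq> 0"
    proof -
      have "a x * cnj (a x) = 1"
        using normalizing_pair_support(3)[OF ab nz] by (simp add: complex_norm_square[symmetric])
      then have "a x * b (inv x) = a x * cnj (a x)"
        using normalizing_pair_support(2)[OF ab nz] by simp
      then show ?thesis using nz by simp
    qed
    ultimately show ?thesis
      using g_at[of x] by (cases "a x = 0") (simp_all add: supp_iff indicator_def g'_def)
  next
    case False
    then show ?thesis using conv_outside[OF False] LF_outside[OF LF(1)] by simp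
  qed
  show ?thesis
    using g g' ext[of "gconvolution G g a", OF eq1] ext[of "gconvolution G g' (indicator ?V)", OF eq2]
    by (rule that)
qed

text \<open>Since \<open>r\<close> is injective on \<open>V\<close>, cutting down to the ranges of
  \<open>U\<close> leaves exactly \<open>U\<close>. This turns inclusion of bisections into an
  equation in the algebra.\<close>

lemma conv_indicator_range:
  assumes U: "U \<in> cobs G" and V: "V \<in> cobs G" and UV: "U \<subseteq> V"
  shows "gconvolution G (indicator (r ` U)) (indicator V) = indicator U"
proof
  fix x
  show "gconvolution G (indicator (r ` U)) (indicator V) x = indicator U x"
  proof (cases "x \<in> A")
    case True
    have "gconvolution G (indicator (r ` U)) (indicator V) x = indicator (r ` U) (r x) * indicator V x"
      using cob_range_image_units[OF U] by (intro conv_unit_left[OF True]) (auto simp: indicator_def)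
    moreover have "x \<in> U" if x: "x \<in> V" "r x \<in> r ` U"
    proof -
      obtain y where "y \<in> U" "r x = r y" using x(2) by blast
      then show ?thesis using inj_onD[OF cob_inj_range[OF V], of x y] x(1) UV by blast
    qed
    ultimately show ?thesis using UV by (auto simp: indicator_def)
  next
    case False
    then show ?thesis using cob_subset[OF U] by (auto simp: conv_outside indicator_def)
  qed
qed

end

subsection \<open>The groupoid isomorphism induced by an algebra isomorphism\<close>

locale ample_pair = G: hausdorff_ample_groupoid G + H: hausdorff_ample_groupoid H
  for G :: "('a, 'm) topgroupoid_scheme" and H :: "('b, 'n) topgroupoid_scheme"

text \<open>The inverse \<Psi> is a parameter, so that exchanging the groupoids is again an instance
  of the locale and every fact comes with its mirror image.\<close>

locale ample_alg_iso = ample_pair G H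
  for G :: "('a, 'm) topgroupoid_scheme" and H :: "('b, 'n) topgroupoid_scheme" +
  fixes \<Phi> \<Psi>
  assumes \<Phi>: "isometric_alg_iso (LF_alg G) (LF_alg H) \<Phi>"
    and \<Psi>: "isometric_alg_iso (LF_alg H) (LF_alg G) \<Psi>"
    and \<Psi>\<Phi>: "\<And>f. f \<in> LF G \<Longrightarrow> \<Psi> (\<Phi> f) = f"
    and \<Phi>\<Psi>: "\<And>f. f \<in> LF H \<Longrightarrow> \<Phi> (\<Psi> f) = f"
begin

lemma swap: "ample_alg_iso H G \<Psi> \<Phi>"
  by unfold_locales (fact \<Phi> \<Psi> \<Psi>\<Phi> \<Phi>\<Psi>)+

lemma \<Phi>_conv:
  assumes "f \<in> LF G" "g \<in> LF G"
  shows "\<Phi> (gconvolution G f g) = gconvolution H (\<Phi> f) (\<Phi> g)"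
  using iso_hom(2)[OF \<Phi> G.alg_closed_LF] assms by simp

lemma \<Phi>_LF: "f \<in> LF G \<Longrightarrow> \<Phi> f \<in> LF H"
  using iso_hom(5)[OF \<Phi> G.alg_closed_LF] by simp

text \<open>Taking the support discards the phases of the image of the indicator.\<close>

definition \<theta> :: "'a set \<Rightarrow> 'b set" where
  "\<theta> U = supp (\<Phi> (indicator U))"

lemma \<theta>_pair:
  "U \<in> cobs G \<Longrightarrow> normalizing_pair (LF_alg H) (\<Phi> (indicator U)) (\<Phi> (indicator (ginv G ` U)))"
  by (rule normalizing_pair_iso[OF \<Phi> G.alg_closed_LF G.normalizing_pair_indicator])

lemma \<theta>_cob: "U \<in> cobs G \<Longrightarrow> \<theta> U \<in> cobs H"
  unfolding \<theta>_def by (rule H.normalizing_pair_support(1)[OF \<theta>_pair])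

lemma \<theta>_mult:
  assumes U: "U \<in> cobs G" and V: "V \<in> cobs G"
  shows "\<theta> (G.set_mult U V) = H.set_mult (\<theta> U) (\<theta> V)"
proof -
  have "\<theta> (G.set_mult U V) = supp (gconvolution H (\<Phi> (indicator U)) (\<Phi> (indicator V)))"
    unfolding \<theta>_def G.conv_indicator[OF U V, symmetric]
      \<Phi>_conv[OF G.LF_indicator[OF U] G.LF_indicator[OF V]] ..
  also have "\<dots> = H.set_mult (\<theta> U) (\<theta> V)"
    using H.supp_conv[OF \<theta>_cob[OF U, unfolded \<theta>_def] H.cob_subset[OF \<theta>_cob[OF V, unfolded \<theta>_def]]]
    by (simp add: \<theta>_def)
  finally show ?thesis .
qed

lemma \<Phi>_span: "d \<in> hermitian_span (LF_alg G) \<Longrightarrow> \<Phi> d \<in> hermitian_span (LF_alg H)"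
  by (rule hermitian_span_iso[OF \<Phi> G.alg_closed_LF])

lemma indicator_span:
  assumes "K \<in> cobs G" "K \<subseteq> gunits G" shows "indicator K \<in> hermitian_span (LF_alg G)"
  unfolding G.hermitian_span_iff
  using G.LF_indicator[OF assms(1)] assms(2) by (auto simp: indicator_def)

lemma \<theta>_units:
  assumes "K \<in> cobs G" "K \<subseteq> gunits G" shows "\<theta> K \<subseteq> gunits H"
proof
  fix y assume "y \<in> \<theta> K"
  then have "\<Phi> (indicator K) y \<noteq> 0" by (simp add: \<theta>_def supp_iff)
  then show "y \<in> gunits H"
    using \<Phi>_span[OF indicator_span[OF assms]] unfolding H.hermitian_span_iff by blast
qed

text \<open>The indicator of \<open>U\<close> is that of \<open>V\<close> multiplied by an indicator
  on units. \<Phi> sends this multiplier to an element supported on the units of \<open>H\<close>,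
  which cannot enlarge the support.\<close>

lemma \<theta>_mono:
  assumes U: "U \<in> cobs G" and V: "V \<in> cobs G" and "U \<subseteq> V" shows "\<theta> U \<subseteq> \<theta> V"
proof -
  let ?K = "grange G ` U"
  have K: "?K \<in> cobs G" "?K \<subseteq> gunits G"
    using G.cob_range_image[OF U] G.cob_range_image_units[OF U] .
  have "\<Phi> (indicator U) = gconvolution H (\<Phi> (indicator ?K)) (\<Phi> (indicator V))"
    using \<Phi>_conv[OF G.LF_indicator[OF K(1)] G.LF_indicator[OF V]]
    unfolding G.conv_indicator_range[OF assms] .
  then show ?thesis
    unfolding \<theta>_def using H.supp_hermitian_span_conv[OF \<Phi>_span[OF indicator_span[OF K]]] by metis
qed

text \<open>\<Psi> is applied to an indicator, not to \<Phi> of one, so the phases are in the way.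
  The multipliers of \<open>indicator_twist\<close> convert one into the other in both directions;
  their images under \<Psi> are again supported on units, which gives the two inclusions of
  supports.\<close>

lemma \<theta>_inverse:
  assumes U: "U \<in> cobs G" shows "supp (\<Psi> (indicator (\<theta> U))) = U"
proof -
  interpret inv: ample_alg_iso H G \<Psi> \<Phi> by (rule swap)
  define a where "a = \<Phi> (indicator U)"
  have a: "a \<in> LF H" "\<Psi> a = indicator U"
    unfolding a_def using \<Phi>_LF \<Psi>\<Phi> G.LF_indicator[OF U] by simp_all
  have V: "indicator (\<theta> U) \<in> LF H" by (rule H.LF_indicator[OF \<theta>_cob[OF U]])
  obtain g g' where g: "g \<in> hermitian_span (LF_alg H)" "g' \<in> hermitian_span (LF_alg H)"
    "gconvolution H g a = indicator (\<theta> U)" "gconvolution H g' (indicator (\<theta> U)) = a"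
    unfolding a_def \<theta>_def by (rule H.indicator_twist[OF \<theta>_pair[OF U]])
  have gL: "g \<in> LF H" "g' \<in> LF H" using g(1,2) unfolding H.hermitian_span_iff by simp_all
  have "\<Psi> (indicator (\<theta> U)) = gconvolution G (\<Psi> g) (indicator U)"
    using inv.\<Phi>_conv[OF gL(1) a(1)] unfolding g(3) a(2) .
  moreover have "indicator U = gconvolution G (\<Psi> g') (\<Psi> (indicator (\<theta> U)))"
    using inv.\<Phi>_conv[OF gL(2) V] unfolding g(4) a(2) .
  ultimately show ?thesis
    using G.supp_hermitian_span_conv[OF inv.\<Phi>_span[OF g(1)], of "indicator U"]
      G.supp_hermitian_span_conv[OF inv.\<Phi>_span[OF g(2)], of "\<Psi> (indicator (\<theta> U))"]
    by (metis subset_antisym supp_indicator)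
qed

text \<open>A point lying in \<open>\<theta> U\<close> for every compact open bisection
  \<open>U\<close> around \<open>x\<close> must be \<open>\<phi> x\<close>. Each compatibility is
  therefore checked on neighbourhoods, by trapping the candidate in a product of images of
  bisections.\<close>

lemma topgroupoid_iso_exists: "\<exists>\<phi>. topgroupoid_iso G H \<phi>"
proof -
  interpret inv: ample_alg_iso H G \<Psi> \<Phi> by (rule swap)
  interpret X: compact_open_base "gtop G" "cobs G" by (rule G.compact_open_base_cobs)
  interpret Y: compact_open_base "gtop H" "cobs H" by (rule H.compact_open_base_cobs)
  have inv1: "inv.\<theta> (\<theta> U) = U" if "U \<in> cobs G" for U
    using \<theta>_inverse[OF that] by (simp add: inv.\<theta>_def)
  have inv2: "\<theta> (inv.\<theta> V) = V" if "V \<in> cobs H" for V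
    using inv.\<theta>_inverse[OF that] by (simp add: \<theta>_def)
  interpret base: base_iso "gtop G" "cobs G" "gtop H" "cobs H" \<theta> inv.\<theta>
    by unfold_locales (fact \<theta>_cob inv.\<theta>_cob inv1 inv2 \<theta>_mono inv.\<theta>_mono)+
  obtain \<phi> where hom: "homeomorphic_map (gtop G) (gtop H) \<phi>"
    and \<phi>: "\<And>x U. x \<in> arrows G \<Longrightarrow> U \<in> cobs G \<Longrightarrow> x \<in> U \<longleftrightarrow> \<phi> x \<in> \<theta> U"
    using base.homeomorphism_exists by blast
  have \<phi>A: "\<phi> x \<in> arrows H" if "x \<in> arrows G" for x
    using homeomorphic_imp_surjective_map[OF hom] that by blast
  have uniq: "\<phi> x = y"
    if "x \<in> arrows G" "y \<in> arrows H" "\<And>U. U \<in> cobs G \<Longrightarrow> x \<in> U \<Longrightarrow> y \<in> \<theta> U" for x y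
    using base.point_unique[OF \<phi>A[OF that(1)] that(2)] \<phi>[OF that(1)] that(3) by blast
  have source: "\<phi> (gsource G x) = gsource H (\<phi> x)" if x: "x \<in> arrows G" for x
  proof (rule uniq[OF G.source_closed[OF x] H.source_closed[OF \<phi>A[OF x]]])
    fix U assume U: "U \<in> cobs G" "gsource G x \<in> U"
    obtain K where K: "K \<in> cobs G" "gsource G x \<in> K" "K \<subseteq> U" "K \<subseteq> gunits G"
      by (rule G.unit_cob[OF G.cob_open[OF U(1)] U(2) G.source_unit[OF x]])
    obtain V where V: "V \<in> cobs G" "x \<in> V" using X.base_cover[OF x] by blast
    \<comment> \<open>Read x as x s(x), an element of \<open>V\<close> times \<open>K\<close>. Then
      \<open>\<phi> x\<close> is a product whose right factor lies in \<open>\<theta> K\<close>, a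
      set of units, and this factor is the source of \<open>\<phi> x\<close>.\<close>
    have "x \<in> G.set_mult V K"
      unfolding G.set_mult_iff[OF G.cob_subset[OF V(1)] G.cob_subset[OF K(1)]]
      using V(2) K(2) G.range_source[OF x] G.mult_source[OF x] by metis
    then have "\<phi> x \<in> H.set_mult (\<theta> V) (\<theta> K)"
      using \<phi>[OF x G.cob_set_mult[OF V(1) K(1)]] \<theta>_mult[OF V(1) K(1)] by simp
    then obtain y k where yk: "y \<in> \<theta> V" "k \<in> \<theta> K" "gsource H y = grange H k" "\<phi> x = gmult H y k"
      unfolding H.set_mult_iff[OF H.cob_subset[OF \<theta>_cob[OF V(1)]] H.cob_subset[OF \<theta>_cob[OF K(1)]]]
      by blast
    have k: "k \<in> gunits H" using \<theta>_units[OF K(1,4)] yk(2) by blast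
    have "gsource H (\<phi> x) = gsource H k"
      unfolding yk(4) using H.cob_arrow[OF \<theta>_cob[OF V(1)] yk(1)] H.unit_arrow[OF k] yk(3)
      by (rule H.source_mult)
    also have "\<dots> = k" using k by (rule H.unit_source)
    finally show "gsource H (\<phi> x) \<in> \<theta> U" using \<theta>_mono[OF K(1) U(1) K(3)] yk(2) by blast
  qed
  have range: "\<phi> (grange G x) = grange H (\<phi> x)" if x: "x \<in> arrows G" for x
  proof (rule uniq[OF G.range_closed[OF x] H.range_closed[OF \<phi>A[OF x]]])
    fix U assume U: "U \<in> cobs G" "grange G x \<in> U"
    obtain K where K: "K \<in> cobs G" "grange G x \<in> K" "K \<subseteq> U" "K \<subseteq> gunits G"
      by (rule G.unit_cob[OF G.cob_open[OF U(1)] U(2) G.range_unit[OF x]])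
    obtain V where V: "V \<in> cobs G" "x \<in> V" using X.base_cover[OF x] by blast
    have "x \<in> G.set_mult K V"
      unfolding G.set_mult_iff[OF G.cob_subset[OF K(1)] G.cob_subset[OF V(1)]]
      using V(2) K(2) G.source_range[OF x] G.mult_range[OF x] by metis
    then have "\<phi> x \<in> H.set_mult (\<theta> K) (\<theta> V)"
      using \<phi>[OF x G.cob_set_mult[OF K(1) V(1)]] \<theta>_mult[OF K(1) V(1)] by simp
    then obtain k y where yk: "k \<in> \<theta> K" "y \<in> \<theta> V" "gsource H k = grange H y" "\<phi> x = gmult H k y"
      unfolding H.set_mult_iff[OF H.cob_subset[OF \<theta>_cob[OF K(1)]] H.cob_subset[OF \<theta>_cob[OF V(1)]]]
      by blast
    have k: "k \<in> gunits H" using \<theta>_units[OF K(1,4)] yk(1) by blast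
    have "grange H (\<phi> x) = grange H k"
      unfolding yk(4) using H.unit_arrow[OF k] H.cob_arrow[OF \<theta>_cob[OF V(1)] yk(2)] yk(3)
      by (rule H.range_mult)
    also have "\<dots> = k" using k by (rule H.unit_range)
    finally show "grange H (\<phi> x) \<in> \<theta> U" using \<theta>_mono[OF K(1) U(1) K(3)] yk(1) by blast
  qed
  have mult: "(\<phi> x, \<phi> y) \<in> gcomp H \<and> \<phi> (gmult G x y) = gmult H (\<phi> x) (\<phi> y)"
    if xy: "(x, y) \<in> gcomp G" for x y
  proof
    have x: "x \<in> arrows G" and y: "y \<in> arrows G" and sr: "gsource G x = grange G y"
      using xy unfolding G.comp_iff by blast+
    have sr': "gsource H (\<phi> x) = grange H (\<phi> y)" using source[OF x] range[OF y] sr by simp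
    then show "(\<phi> x, \<phi> y) \<in> gcomp H" unfolding H.comp_iff using \<phi>A[OF x] \<phi>A[OF y] by blast
    show "\<phi> (gmult G x y) = gmult H (\<phi> x) (\<phi> y)"
    proof (rule uniq[OF G.mult_closed[OF x y sr] H.mult_closed[OF \<phi>A[OF x] \<phi>A[OF y] sr']])
      fix W assume W: "W \<in> cobs G" "gmult G x y \<in> W"
      obtain U where U: "U \<in> cobs G" "x \<in> U" using X.base_cover[OF x] by blast
      have U': "ginv G ` U \<in> cobs G" by (rule G.cob_inv_image[OF U(1)])
      \<comment> \<open>The set U^{-1} W contains y = x^{-1} (x y), and U (U^{-1} W) stays inside
        \<open>W\<close> because \<open>s\<close> is injective on \<open>U\<close>. Every
        neighbourhood \<open>W\<close> of the product thus contains a product of bisections around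
        \<open>x\<close> and \<open>y\<close>.\<close>
      define V where "V = G.set_mult (ginv G ` U) W"
      note V_iff = G.set_mult_iff[OF G.cob_subset[OF U'] G.cob_subset[OF W(1)], folded V_def]
      have V: "V \<in> cobs G" unfolding V_def by (rule G.cob_set_mult[OF U' W(1)])
      have "gsource G (ginv G x) = grange G (gmult G x y)"
        using x y sr by (simp only: G.source_inv G.range_mult)
      moreover have "y = gmult G (ginv G x) (gmult G x y)"
        using x y sr by (simp only: G.inv_mult_cancel)
      ultimately have yV: "y \<in> V" unfolding V_iff using U(2) W(2) by blast
      have sub: "G.set_mult U V \<subseteq> W"
      proof
        fix z assume "z \<in> G.set_mult U V"
        then obtain u v where uv: "u \<in> U" "v \<in> V" "gsource G u = grange G v" "z = gmult G u v"
          unfolding G.set_mult_iff[OF G.cob_subset[OF U(1)] G.cob_subset[OF V]] by blast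
        obtain u' w where w: "u' \<in> U" "w \<in> W" "gsource G (ginv G u') = grange G w"
          "v = gmult G (ginv G u') w"
          using uv(2) unfolding V_iff by blast
        have A: "u \<in> arrows G" "u' \<in> arrows G" "w \<in> arrows G"
          using G.cob_subset[OF U(1)] G.cob_subset[OF W(1)] uv(1) w(1,2) by blast+
        have "gsource G u = gsource G u'"
          using uv(3) unfolding w(4) using G.range_mult[OF G.inv_closed[OF A(2)] A(3) w(3)] A
          by simp
        then have "u = u'" using inj_onD[OF G.cob_inj_source[OF U(1)]] uv(1) w(1) by blast
        then have "z = w"
          unfolding uv(4) w(4) using w(3) A by (simp only: G.mult_inv_mult_cancel G.source_inv)
        then show "z \<in> W" using w(2) by simp
      qed
      have "\<phi> x \<in> \<theta> U" "\<phi> y \<in> \<theta> V" using \<phi>[OF x U(1)] \<phi>[OF y V] U(2) yV by simp_all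
      then have "gmult H (\<phi> x) (\<phi> y) \<in> H.set_mult (\<theta> U) (\<theta> V)"
        unfolding H.set_mult_iff[OF H.cob_subset[OF \<theta>_cob[OF U(1)]] H.cob_subset[OF \<theta>_cob[OF V]]]
        using sr' by blast
      then show "gmult H (\<phi> x) (\<phi> y) \<in> \<theta> W"
        using \<theta>_mono[OF G.cob_set_mult[OF U(1) V] W(1) sub] \<theta>_mult[OF U(1) V] by blast
    qed
  qed
  have "groupoid_hom G H \<phi>"
    unfolding groupoid_hom_def using \<phi>A mult by (auto simp only: Pi_iff)
  then have "topgroupoid_iso G H \<phi>" using hom by (simp add: topgroupoid_iso_def)
  then show ?thesis by (rule exI[of _ \<phi>])
qed

end

subsection \<open>The algebra isomorphism induced by a groupoid isomorphism\<close>

context ample_pair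
begin

lemma hom_arrow: "groupoid_hom G H \<phi> \<Longrightarrow> x \<in> arrows G \<Longrightarrow> \<phi> x \<in> arrows H"
  and hom_comp: "groupoid_hom G H \<phi> \<Longrightarrow> (x, y) \<in> gcomp G \<Longrightarrow> (\<phi> x, \<phi> y) \<in> gcomp H"
  and hom_mult: "groupoid_hom G H \<phi> \<Longrightarrow> (x, y) \<in> gcomp G \<Longrightarrow>
    \<phi> (gmult G x y) = gmult H (\<phi> x) (\<phi> y)"
  unfolding groupoid_hom_def by blast+

text \<open>A homomorphism is only required to respect products. The image of \<open>r x\<close> is
  a left identity for \<open>\<phi> x\<close>, so right cancellation identifies it as the range;
  left cancellation then gives the inverse.\<close>

lemma hom_range_inv:
  assumes \<phi>: "groupoid_hom G H \<phi>" and x: "x \<in> arrows G"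
  shows hom_range: "\<phi> (grange G x) = grange H (\<phi> x)"
    and hom_inv: "\<phi> (ginv G x) = ginv H (\<phi> x)"
proof -
  note arrow = hom_arrow[OF \<phi>] and comp = hom_comp[OF \<phi>] and mult = hom_mult[OF \<phi>]
  have "(grange G x, x) \<in> gcomp G" unfolding G.comp_iff using x by simp
  from comp[OF this] mult[OF this] x
  have 1: "gsource H (\<phi> (grange G x)) = grange H (\<phi> x)"
    "gmult H (\<phi> (grange G x)) (\<phi> x) = \<phi> x"
    unfolding H.comp_iff by simp_all
  have "\<phi> (grange G x) = gmult H (gmult H (\<phi> (grange G x)) (\<phi> x)) (ginv H (\<phi> x))"
    using H.mult_inv_cancel[OF _ arrow[OF x] 1(1)] arrow[OF G.range_closed[OF x]] by simp
  then show range: "\<phi> (grange G x) = grange H (\<phi> x)"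
    unfolding 1(2) using arrow[OF x] by simp
  have "(x, ginv G x) \<in> gcomp G" unfolding G.comp_iff using x by simp
  from comp[OF this] mult[OF this] x
  have 2: "gsource H (\<phi> x) = grange H (\<phi> (ginv G x))"
    "gmult H (\<phi> x) (\<phi> (ginv G x)) = \<phi> (grange G x)"
    unfolding H.comp_iff by simp_all
  have "\<phi> (ginv G x) = gmult H (ginv H (\<phi> x)) (gmult H (\<phi> x) (\<phi> (ginv G x)))"
    using H.inv_mult_cancel[OF arrow[OF x] _ 2(1)] arrow[OF G.inv_closed[OF x]] by simp
  also have "\<dots> = gmult H (ginv H (\<phi> x)) (gsource H (ginv H (\<phi> x)))"
    unfolding 2(2) range using arrow[OF x] by simp
  also have "\<dots> = ginv H (\<phi> x)"
    using H.mult_source[OF H.inv_closed[OF arrow[OF x]]] .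
  finally show "\<phi> (ginv G x) = ginv H (\<phi> x)" .
qed

lemma hom_source:
  assumes \<phi>: "groupoid_hom G H \<phi>" and x: "x \<in> arrows G"
  shows "\<phi> (gsource G x) = gsource H (\<phi> x)"
  using hom_range[OF \<phi> G.inv_closed[OF x]] hom_inv[OF \<phi> x] hom_arrow[OF \<phi> x] x by simp

end

section \<open>Transport of functions along a groupoid isomorphism\<close>

locale groupoid_iso_pair = ample_pair G H
  for G :: "('a, 'm) topgroupoid_scheme" and H :: "('b, 'n) topgroupoid_scheme" +
  fixes \<phi> \<psi>
  assumes \<phi>: "groupoid_hom G H \<phi>" and \<psi>: "groupoid_hom H G \<psi>"
    and homeo: "homeomorphic_maps (gtop G) (gtop H) \<phi> \<psi>"
begin

lemma swap: "groupoid_iso_pair H G \<psi> \<phi>"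
  by unfold_locales (fact \<phi> \<psi> homeo[THEN homeomorphic_maps_sym[THEN iffD1]])+

lemma \<phi>_arrow: "x \<in> arrows G \<Longrightarrow> \<phi> x \<in> arrows H"
  and \<psi>_arrow: "y \<in> arrows H \<Longrightarrow> \<psi> y \<in> arrows G"
  and \<psi>\<phi>: "x \<in> arrows G \<Longrightarrow> \<psi> (\<phi> x) = x"
  and \<phi>\<psi>: "y \<in> arrows H \<Longrightarrow> \<phi> (\<psi> y) = y"
  using \<phi> \<psi> homeo by (auto simp: groupoid_hom_def homeomorphic_maps_def)

lemmas \<phi>_range = hom_range[OF \<phi>] and \<phi>_source = hom_source[OF \<phi>] and \<phi>_inv = hom_inv[OF \<phi>]
  and \<phi>_mult = hom_mult[OF \<phi>]

definition transport :: "('a \<Rightarrow> complex) \<Rightarrow> 'b \<Rightarrow> complex" where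
  "transport f y = (if y \<in> arrows H then f (\<psi> y) else 0)"

lemma transport_diff: "transport (\<lambda>x. f x - g x) = (\<lambda>y. transport f y - transport g y)"
  by (auto simp: transport_def)

text \<open>\<psi> is injective on arrows and carries fibres into fibres, so finite fibre sums over
  \<open>H\<close> are finite fibre sums over \<open>G\<close>.\<close>

lemma transport_fibre_bounded:
  assumes "fibre_bounded G f C" shows "fibre_bounded H (transport f) C"
  unfolding fibre_bounded_def
proof (intro allI impI)
  interpret inv: groupoid_iso_pair H G \<psi> \<phi> by (rule swap)
  fix F u assume F: "finite F" "F \<subseteq> source_fibre H u \<or> F \<subseteq> range_fibre H u"
  then have A: "F \<subseteq> arrows H" by (auto simp: source_fibre_def range_fibre_def)
  have inj: "inj_on \<psi> F" using A \<phi>\<psi> by (metis inj_onI subsetD)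
  have "\<psi> ` F \<subseteq> source_fibre G (\<psi> u) \<or> \<psi> ` F \<subseteq> range_fibre G (\<psi> u)"
    using F(2)
  proof
    assume F: "F \<subseteq> source_fibre H u"
    have "\<psi> y \<in> source_fibre G (\<psi> u)" if "y \<in> F" for y
    proof -
      have "y \<in> arrows H" "gsource H y = u" using F that by (auto simp: H.source_fibre_iff)
      then show ?thesis using inv.\<phi>_source[of y] \<psi>_arrow[of y] by (simp add: G.source_fibre_iff)
    qed
    then show ?thesis by blast
  next
    assume F: "F \<subseteq> range_fibre H u"
    have "\<psi> y \<in> range_fibre G (\<psi> u)" if "y \<in> F" for y
    proof -
      have "y \<in> arrows H" "grange H y = u" using F that by (auto simp: H.range_fibre_iff)
      then show ?thesis using inv.\<phi>_range[of y] \<psi>_arrow[of y] by (simp add: G.range_fibre_iff)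
    qed
    then show ?thesis by blast
  qed
  then have "(\<Sum>x\<in>\<psi> ` F. cmod (f x)) \<le> C"
    using fibre_bounded_source[OF assms finite_imageI[OF F(1)]]
      fibre_bounded_range[OF assms finite_imageI[OF F(1)]] by (elim disjE)
  moreover have "(\<Sum>y\<in>F. cmod (transport f y)) = (\<Sum>x\<in>\<psi> ` F. cmod (f x))"
    unfolding sum.reindex[OF inj] o_def
    by (rule sum.cong) (use A in \<open>auto simp: transport_def\<close>)
  ultimately show "(\<Sum>y\<in>F. cmod (transport f y)) \<le> C" by simp
qed

lemma transport_Cc:
  assumes "f \<in> Cc_funs G" shows "transport f \<in> Cc_funs H"
proof -
  obtain K where K: "continuous_map (gtop G) euclidean f" "compactin (gtop G) K" "\<And>x. f x \<noteq> 0 \<Longrightarrow> x \<in> K"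
    using G.CcD[OF assms] by blast
  have c: "continuous_map (gtop G) (gtop H) \<phi>" "continuous_map (gtop H) (gtop G) \<psi>"
    using homeo by (auto simp: homeomorphic_maps_def)
  show ?thesis
  proof (rule H.CcI)
    have "continuous_map (gtop H) euclidean (f \<circ> \<psi>)"
      using c(2) K(1) by (rule continuous_map_compose)
    then show "continuous_map (gtop H) euclidean (transport f)"
      by (rule continuous_map_eq) (simp add: transport_def)
    show "compactin (gtop H) (\<phi> ` K)" using K(2) c(1) by (rule image_compactin)
    fix y assume "transport f y \<noteq> 0"
    then have "y \<in> arrows H" "\<psi> y \<in> K" using K(3) by (auto simp: transport_def split: if_splits)
    then show "y \<in> \<phi> ` K" using \<phi>\<psi>[of y] by force
  qed
qed

lemma transport_LF:
  assumes "f \<in> LF G" shows "transport f \<in> LF H"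
  unfolding LF_def mem_Collect_eq
proof (intro conjI allI impI)
  fix e :: real assume "0 < e"
  then obtain g where g: "g \<in> Cc_funs G" "fibre_bounded G (\<lambda>x. f x - g x) e"
    using LF_approx[OF assms] by blast
  have "fibre_bounded H (\<lambda>y. transport f y - transport g y) e"
    using transport_fibre_bounded[OF g(2)] unfolding transport_diff .
  then show "\<exists>g\<in>Cc_funs H. fibre_bounded H (\<lambda>x. transport f x - g x) e"
    using transport_Cc[OF g(1)] by (rule bexI)
qed (simp add: transport_def)

text \<open>The reverse inequality is this one for the inverse pair, which is how the isometry is
  obtained.\<close>

lemma transport_norm_le:
  assumes "f \<in> LF G" shows "I_norm H (transport f) \<le> I_norm G f"
  by (rule H.I_norm_le[OF transport_fibre_bounded[OF G.LF_I_norm[OF assms]]])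

lemma transport_conv:
  "transport (gconvolution G f g) = gconvolution H (transport f) (transport g)"
proof
  interpret inv: groupoid_iso_pair H G \<psi> \<phi> by (rule swap)
  fix y
  show "transport (gconvolution G f g) y = gconvolution H (transport f) (transport g) y"
  proof (cases "y \<in> arrows H")
    case y: True
    have \<psi>y: "\<psi> y \<in> arrows G" using \<psi>_arrow[OF y] .
    have bij: "bij_betw \<psi> (source_fibre H (gsource H y)) (source_fibre G (gsource G (\<psi> y)))"
    proof (rule bij_betw_byWitness[of _ \<phi>])
      show "\<forall>z\<in>source_fibre H (gsource H y). \<phi> (\<psi> z) = z"
        using \<phi>\<psi> by (simp add: H.source_fibre_iff)
      show "\<forall>x\<in>source_fibre G (gsource G (\<psi> y)). \<psi> (\<phi> x) = x"
        using \<psi>\<phi> by (simp add: G.source_fibre_iff)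
      show "\<psi> ` source_fibre H (gsource H y) \<subseteq> source_fibre G (gsource G (\<psi> y))"
        using inv.\<phi>_source \<psi>_arrow y by (auto simp: H.source_fibre_iff G.source_fibre_iff) metis
      show "\<phi> ` source_fibre G (gsource G (\<psi> y)) \<subseteq> source_fibre H (gsource H y)"
        using \<phi>_source \<phi>_arrow \<psi>y \<phi>\<psi>[OF y] by (auto simp: H.source_fibre_iff G.source_fibre_iff) metis
    qed
    have "gconvolution G f g (\<psi> y) =
        (\<Sum>\<^sub>\<infinity>x\<in>source_fibre G (gsource G (\<psi> y)). f (gmult G (\<psi> y) (ginv G x)) * g x)"
      using \<psi>y by (simp add: gconvolution_def)
    also have "\<dots> = (\<Sum>\<^sub>\<infinity>z\<in>source_fibre H (gsource H y). f (gmult G (\<psi> y) (ginv G (\<psi> z))) * g (\<psi> z))"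
      using infsum_reindex_bij_betw[OF bij, of "\<lambda>x. f (gmult G (\<psi> y) (ginv G x)) * g x"] by presburger
    also have "\<dots> = (\<Sum>\<^sub>\<infinity>z\<in>source_fibre H (gsource H y). transport f (gmult H y (ginv H z)) * transport g z)"
    proof (rule infsum_cong)
      fix z assume "z \<in> source_fibre H (gsource H y)"
      then have z: "z \<in> arrows H" "gsource H z = gsource H y" by (auto simp: H.source_fibre_iff)
      have sr: "gsource H y = grange H (ginv H z)" using z by simp
      have "(y, ginv H z) \<in> gcomp H" unfolding H.comp_iff using y z sr by simp
      then have "\<psi> (gmult H y (ginv H z)) = gmult G (\<psi> y) (ginv G (\<psi> z))"
        using inv.\<phi>_mult inv.\<phi>_inv[OF z(1)] by simp
      then show "f (gmult G (\<psi> y) (ginv G (\<psi> z))) * g (\<psi> z) =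
          transport f (gmult H y (ginv H z)) * transport g z"
        using H.mult_closed[OF y H.inv_closed[OF z(1)] sr] z(1) by (simp add: transport_def)
    qed
    finally show ?thesis using y by (simp add: transport_def gconvolution_def)
  qed (simp add: transport_def gconvolution_def)
qed

lemma LF_alg_iso: "isometric_alg_iso (LF_alg G) (LF_alg H) transport"
proof -
  interpret inv: groupoid_iso_pair H G \<psi> \<phi> by (rule swap)
  have inv1: "inv.transport (transport f) = f" if "f \<in> LF G" for f
  proof
    fix x show "inv.transport (transport f) x = f x"
      using LF_outside[OF that, of x] \<psi>\<phi>[of x] \<phi>_arrow[of x]
      by (cases "x \<in> arrows G") (simp_all add: transport_def inv.transport_def)
  qed
  have inv2: "transport (inv.transport f) = f" if "f \<in> LF H" for f
  proof
    fix y show "transport (inv.transport f) y = f y"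
      using LF_outside[OF that, of y] \<phi>\<psi>[of y] \<psi>_arrow[of y]
      by (cases "y \<in> arrows H") (simp_all add: transport_def inv.transport_def)
  qed
  have "bij_betw transport (LF G) (LF H)"
    by (rule bij_betw_byWitness[of _ inv.transport])
      (auto simp: inv1 inv2 transport_LF inv.transport_LF)
  moreover have "I_norm H (transport f) = I_norm G f" if "f \<in> LF G" for f
    using transport_norm_le[OF that] inv.transport_norm_le[OF transport_LF[OF that]] inv1[OF that] by simp
  moreover have "transport (\<lambda>x. f x + g x) = (\<lambda>y. transport f y + transport g y)"
    "transport (\<lambda>x. c * f x) = (\<lambda>y. c * transport f y)" for f g c
    by (auto simp: transport_def)
  ultimately show ?thesis by (simp add: isometric_alg_iso_def transport_conv)
qed

end

section \<open>Passage between completions, function algebras and groupoids\<close>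

context ample_pair
begin

lemma groupoid_iso_pair:
  assumes "topgroupoid_iso G H \<phi>"
  obtains \<psi> where "groupoid_iso_pair G H \<phi> \<psi>"
proof -
  have hom: "groupoid_hom G H \<phi>" and homeo: "homeomorphic_map (gtop G) (gtop H) \<phi>"
    using assms by (auto simp: topgroupoid_iso_def)
  obtain \<psi> where maps: "homeomorphic_maps (gtop G) (gtop H) \<phi> \<psi>"
    using homeo unfolding homeomorphic_map_maps by blast
  have inverse: "\<And>x. x \<in> arrows G \<Longrightarrow> \<psi> (\<phi> x) = x" "\<And>y. y \<in> arrows H \<Longrightarrow> \<phi> (\<psi> y) = y"
    "\<And>y. y \<in> arrows H \<Longrightarrow> \<psi> y \<in> arrows G" "\<And>x. x \<in> arrows G \<Longrightarrow> \<phi> x \<in> arrows H"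
    using maps by (auto simp: homeomorphic_maps_def continuous_map_def)
  have "groupoid_hom H G \<psi>"
    unfolding groupoid_hom_def
  proof (intro conjI ballI)
    show "\<psi> \<in> arrows H \<rightarrow> arrows G" using inverse(3) by (simp add: Pi_def)
    fix p assume p: "p \<in> gcomp H"
    obtain y z where yz: "p = (y, z)" by (cases p)
    then have A: "y \<in> arrows H" "z \<in> arrows H" and sr: "gsource H y = grange H z"
      using p unfolding yz H.comp_iff by simp_all
    have "\<phi> (gsource G (\<psi> y)) = \<phi> (grange G (\<psi> z))"
      using hom_source[OF hom inverse(3)[OF A(1)]] hom_range[OF hom inverse(3)[OF A(2)]]
        inverse(2)[OF A(1)] inverse(2)[OF A(2)] sr by simp
    then have "\<psi> (\<phi> (gsource G (\<psi> y))) = \<psi> (\<phi> (grange G (\<psi> z)))" by simp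
    then have "gsource G (\<psi> y) = grange G (\<psi> z)"
      using inverse(1)[OF G.source_closed[OF inverse(3)[OF A(1)]]]
        inverse(1)[OF G.range_closed[OF inverse(3)[OF A(2)]]] by simp
    then have comp: "(\<psi> y, \<psi> z) \<in> gcomp G"
      unfolding G.comp_iff using inverse(3)[OF A(1)] inverse(3)[OF A(2)] by simp
    have closed: "gmult G (\<psi> y) (\<psi> z) \<in> arrows G"
      using comp unfolding G.comp_iff by (simp add: G.mult_closed)
    have "\<phi> (gmult G (\<psi> y) (\<psi> z)) = gmult H y z"
      using hom_mult[OF hom comp] inverse(2)[OF A(1)] inverse(2)[OF A(2)] by simp
    then have "\<psi> (gmult H y z) = gmult G (\<psi> y) (\<psi> z)" using inverse(1)[OF closed] by simp
    then show "case p of (y, z) \<Rightarrow> (\<psi> y, \<psi> z) \<in> gcomp G \<and>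
        \<psi> (gmult H y z) = gmult G (\<psi> y) (\<psi> z)"
      using comp by (simp add: yz)
  qed
  then have "groupoid_iso_pair G H \<phi> \<psi>"
    using hom maps by unfold_locales
  then show ?thesis by (rule that)
qed

lemma LI_iso_iff_LF_iso:
  "(\<exists>\<Phi>. isometric_alg_iso (LI G) (LI H) \<Phi>) \<longleftrightarrow> (\<exists>\<Phi>. isometric_alg_iso (LF_alg G) (LF_alg H) \<Phi>)"
proof
  assume "\<exists>\<Phi>. isometric_alg_iso (LI G) (LI H) \<Phi>"
  then obtain \<Phi> where \<Phi>: "isometric_alg_iso (LI G) (LI H) \<Phi>" by blast
  from isometric_alg_iso_trans[OF isometric_alg_iso_trans[OF G.LI_iso \<Phi>]
      isometric_alg_iso_inverse[OF H.LI_iso H.alg_closed_LF]]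
  show "\<exists>\<Phi>. isometric_alg_iso (LF_alg G) (LF_alg H) \<Phi>" by blast
next
  assume "\<exists>\<Phi>. isometric_alg_iso (LF_alg G) (LF_alg H) \<Phi>"
  then obtain \<Phi> where \<Phi>: "isometric_alg_iso (LF_alg G) (LF_alg H) \<Phi>" by blast
  from isometric_alg_iso_trans[OF isometric_alg_iso_trans[OF
      isometric_alg_iso_inverse[OF G.LI_iso G.alg_closed_LF] \<Phi>] H.LI_iso]
  show "\<exists>\<Phi>. isometric_alg_iso (LI G) (LI H) \<Phi>" by blast
qed

lemma LF_iso_iff_groupoid_iso:
  "(\<exists>\<Phi>. isometric_alg_iso (LF_alg G) (LF_alg H) \<Phi>) \<longleftrightarrow> (\<exists>\<phi>. topgroupoid_iso G H \<phi>)"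
proof
  assume "\<exists>\<Phi>. isometric_alg_iso (LF_alg G) (LF_alg H) \<Phi>"
  then obtain \<Phi> where \<Phi>: "isometric_alg_iso (LF_alg G) (LF_alg H) \<Phi>" by blast
  let ?\<Psi> = "inv_into (LF G) \<Phi>"
  have bij: "bij_betw \<Phi> (LF G) (LF H)" using \<Phi> by (simp add: isometric_alg_iso_def)
  have "ample_alg_iso G H \<Phi> ?\<Psi>"
  proof unfold_locales
    show "isometric_alg_iso (LF_alg H) (LF_alg G) ?\<Psi>"
      using isometric_alg_iso_inverse[OF \<Phi> G.alg_closed_LF] by simp
  qed (use \<Phi> bij in \<open>auto simp: bij_betw_inv_into_left bij_betw_inv_into_right\<close>)
  then show "\<exists>\<phi>. topgroupoid_iso G H \<phi>" by (rule ample_alg_iso.topgroupoid_iso_exists)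
next
  assume "\<exists>\<phi>. topgroupoid_iso G H \<phi>"
  then obtain \<phi> where "topgroupoid_iso G H \<phi>" by blast
  then obtain \<psi> where "groupoid_iso_pair G H \<phi> \<psi>" by (rule groupoid_iso_pair)
  from groupoid_iso_pair.LF_alg_iso[OF this]
  show "\<exists>\<Phi>. isometric_alg_iso (LF_alg G) (LF_alg H) \<Phi>" by blast
qed

end

theorem theoremA:
  fixes G :: "'a topgroupoid" and H :: "'b topgroupoid"
  assumes "ample_groupoid G" and "Hausdorff_space (gtop G)"
    and "ample_groupoid H" and "Hausdorff_space (gtop H)"
  shows "(\<exists>\<Phi>. isometric_alg_iso (LI G) (LI H) \<Phi>) \<longleftrightarrow> (\<exists>\<phi>. topgroupoid_iso G H \<phi>)"
proof -
  interpret ample_pair G H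
    using assms by unfold_locales
  show ?thesis using LI_iso_iff_LF_iso LF_iso_iff_groupoid_iso by blast
qed

end
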